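(* Let $\{\mathcal{G}_h\}$ be a shape-regular family of uniform rectangular grids of a rectangle $\Omega$, each satisfying Hypothesis RT. Let $u\in H^1_0(\Omega)$ be the solution of $$\int_\Omega\nabla u\cdot\nabla v\,dx\,dy=\int_\Omega \rho f v\,dx\,dy\quad\forall v\in H^1_0(\Omega),$$ with $f\in L^2(\Omega)$, and let $u_h^{\rm R}\in V_{hs}^{\rm R}$ be the solution of $a_h(u_h^{\rm R},v_h)=b(f,v_h)$ for all $v_h\in V_{hs}^{\rm R}$. If $\|f\|_{0,\rho}\neq0$ and $u\in H^1_0(\Omega)\cap H^3(\Omega)$, then there exist a constant $c>0$ independent of $h$ and $h_0>0$ such that $\|u-u_h^{\rm R}\|_{0,\rho}\ge c\,h^2$ whenever $h\le h_0$.
   Context: $\Omega\subset\mathbb{R}^2$ is a rectangle with sides parallel to the axes; $\rho\in L^\infty(\Omega)$ with $\rho\ge c_0>0$. A rectangular grid $\mathcal{G}_h$ of $\Omega$ is a partition of $\Omega$ into axis-parallel rectangles $K$ (side lengths $h_{x,K},h_{y,K}$) without hanging nodes; $h=\max_K\max\{h_{x,K},h_{y,K}\}$. Shape-regular: the ratios $h_{x,K}/h_{y,K}$ are bounded above and below by positive constants uniformly over the family. Uniform: $h_{x,K}$ and $h_{y,K}$ do not depend on $K$. Hypothesis RT: $\mathcal{G}_h$ is obtained by refining a rectangular grid $\mathcal{G}_{4h}$ of $\Omega$ twice, each refinement dividing every rectangle into four congruent rectangles by joining midpoints of opposite sides. $\mathcal{N}_h^i,\mathcal{N}_h^b$ are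 the interior and boundary vertices, $\mathcal{E}_h^i$ the interior edges, $n_e$ a unit normal of the edge $e$, $\fint_e$ the mean value over $e$, and $P_2(K)$ the polynomials of total degree at most 2. The reduced rectangular Morley (RRM) space $V_{hs}^{\rm R}$ consists of all $w_h\in L^2(\Omega)$ such that $w_h|_K\in P_2(K)$ for all $K\in\mathcal{G}_h$, $w_h$ is continuous at every $a\in\mathcal{N}_h^i$, $\fint_e\partial_{n_e}w_h\,ds$ is continuous across every $e\in\mathcal{E}_h^i$, and $w_h(a)=0$ for all $a\in\mathcal{N}_h^b$. $a_h(w,v)=\sum_{K}\int_K\nabla w\cdot\nabla v\,dx\,dy$, $b(f,v)=\int_\Omega\rho fv\,dx\,dy$, $\|v\|_{0,\rho}=b(v,v)^{1/2}$. *)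

theory Defs
  imports "HOL-Analysis.Analysis"
begin

type_synonym point = "real \<times> real"
type_synonym field = "point \<Rightarrow> real"


section \<open>Lebesgue and Sobolev spaces\<close>

text \<open>Elements of the Lebesgue and Sobolev spaces are represented by functions, not by classes;
  membership in these spaces is invariant under modification on null sets.\<close>

definition L2 :: "point set \<Rightarrow> field set" where
  "L2 S = {f. f \<in> borel_measurable (lebesgue_on S) \<and> integrable (lebesgue_on S) (\<lambda>z. (f z)\<^sup>2)}"

definition Linf :: "point set \<Rightarrow> field set" where
  "Linf S = {f. f \<in> borel_measurable (lebesgue_on S) \<and> (\<exists>C. AE z in lebesgue_on S. \<bar>f z\<bar> \<le> C)}"

definition dx :: "field \<Rightarrow> field" where
  "dx f = (\<lambda>z. frechet_derivative f (at z) (1, 0))"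

definition dy :: "field \<Rightarrow> field" where
  "dy f = (\<lambda>z. frechet_derivative f (at z) (0, 1))"

definition grad :: "field \<Rightarrow> point \<Rightarrow> point" where
  "grad f z = (dx f z, dy f z)"

fun Ck :: "nat \<Rightarrow> field \<Rightarrow> bool" where
  "Ck 0 f \<longleftrightarrow> continuous_on UNIV f"
| "Ck (Suc k) f \<longleftrightarrow> (\<forall>z. f differentiable (at z)) \<and> Ck k (dx f) \<and> Ck k (dy f)"

definition test_functions :: "point set \<Rightarrow> field set" where
  "test_functions S = {\<phi>. (\<forall>k. Ck k \<phi>) \<and>
     compact (closure {z. \<phi> z \<noteq> 0}) \<and> closure {z. \<phi> z \<noteq> 0} \<subseteq> S}"

definition has_weak_deriv :: "point set \<Rightarrow> nat \<Rightarrow> nat \<Rightarrow> field \<Rightarrow> field \<Rightarrow> bool" where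
  "has_weak_deriv S i j f g \<longleftrightarrow>
     (\<forall>\<phi>\<in>test_functions S.
        (LINT z|lebesgue_on S. f z * (dx ^^ i) ((dy ^^ j) \<phi>) z)
          = (- 1) ^ (i + j) * (LINT z|lebesgue_on S. g z * \<phi> z))"

definition Hk :: "nat \<Rightarrow> point set \<Rightarrow> field set" where
  "Hk k S = {f \<in> L2 S. \<forall>i j. i + j \<le> k \<longrightarrow> (\<exists>g\<in>L2 S. has_weak_deriv S i j f g)}"

text \<open>Weak derivatives are unique up to null sets, so the choice of representative is immaterial.\<close>

definition weak_deriv :: "point set \<Rightarrow> nat \<Rightarrow> nat \<Rightarrow> field \<Rightarrow> field" where
  "weak_deriv S i j f = (SOME g. g \<in> L2 S \<and> has_weak_deriv S i j f g)"

definition weak_grad :: "point set \<Rightarrow> field \<Rightarrow> point \<Rightarrow> point" where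
  "weak_grad S f z = (weak_deriv S 1 0 f z, weak_deriv S 0 1 f z)"

definition H1_norm :: "point set \<Rightarrow> field \<Rightarrow> real" where
  "H1_norm S f =
     sqrt ((LINT z|lebesgue_on S. (f z)\<^sup>2) + (LINT z|lebesgue_on S. (norm (weak_grad S f z))\<^sup>2))"

definition H10 :: "point set \<Rightarrow> field set" where
  "H10 S = {f \<in> Hk 1 S. \<exists>\<phi>. (\<forall>n::nat. \<phi> n \<in> test_functions S) \<and>
     (\<lambda>n. H1_norm S (\<lambda>z. f z - \<phi> n z)) \<longlonglongrightarrow> 0}"


section \<open>Rectangular grids\<close>

datatype rect = Rect (xl: real) (xr: real) (yl: real) (yr: real)

definition nondegenerate :: "rect \<Rightarrow> bool" where
  "nondegenerate K \<longleftrightarrow> xl K < xr K \<and> yl K < yr K"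

definition hx :: "rect \<Rightarrow> real" where "hx K = xr K - xl K"
definition hy :: "rect \<Rightarrow> real" where "hy K = yr K - yl K"

definition closed_rect :: "rect \<Rightarrow> point set" where
  "closed_rect K = cbox (xl K, yl K) (xr K, yr K)"

definition open_rect :: "rect \<Rightarrow> point set" where
  "open_rect K = box (xl K, yl K) (xr K, yr K)"

definition vertices :: "rect \<Rightarrow> point set" where
  "vertices K = {(xl K, yl K), (xr K, yl K), (xl K, yr K), (xr K, yr K)}"

text \<open>An edge is the pair of its end points, the one with the smaller coordinates first, so that
  an edge shared by two cells is represented by the same pair in both.\<close>

definition edges :: "rect \<Rightarrow> (point \<times> point) set" where
  "edges K = {((xl K, yl K), (xr K, yl K)), ((xl K, yr K), (xr K, yr K)),
              ((xl K, yl K), (xl K, yr K)), ((xr K, yl K), (xr K, yr K))}"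

text \<open>The last conjunct excludes hanging nodes.\<close>

definition rect_grid :: "rect \<Rightarrow> rect set \<Rightarrow> bool" where
  "rect_grid \<Omega> G \<longleftrightarrow>
     finite G \<and> (\<forall>K\<in>G. nondegenerate K) \<and>
     (\<Union>K\<in>G. closed_rect K) = closed_rect \<Omega> \<and>
     (\<forall>K\<in>G. \<forall>L\<in>G. K \<noteq> L \<longrightarrow> open_rect K \<inter> open_rect L = {}) \<and>
     (\<forall>K\<in>G. \<forall>L\<in>G. vertices K \<inter> closed_rect L \<subseteq> vertices L)"

definition mesh_size :: "rect set \<Rightarrow> real" where
  "mesh_size G = Max ((\<lambda>K. max (hx K) (hy K)) ` G)"

definition uniform_grid :: "rect set \<Rightarrow> bool" where
  "uniform_grid G \<longleftrightarrow> (\<forall>K\<in>G. \<forall>L\<in>G. hx K = hx L \<and> hy K = hy L)"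

definition shape_regular :: "('i \<Rightarrow> rect set) \<Rightarrow> bool" where
  "shape_regular \<G> \<longleftrightarrow>
     (\<exists>c1>0. \<exists>c2>0. \<forall>i. \<forall>K\<in>\<G> i. c1 \<le> hx K / hy K \<and> hx K / hy K \<le> c2)"

definition quarters :: "rect \<Rightarrow> rect set" where
  "quarters K = (let mx = (xl K + xr K) / 2; my = (yl K + yr K) / 2 in
     {Rect (xl K) mx (yl K) my, Rect mx (xr K) (yl K) my,
      Rect (xl K) mx my (yr K), Rect mx (xr K) my (yr K)})"

definition refine_grid :: "rect set \<Rightarrow> rect set" where
  "refine_grid G = (\<Union>K\<in>G. quarters K)"

definition hypothesis_RT :: "rect \<Rightarrow> rect set \<Rightarrow> bool" where
  "hypothesis_RT \<Omega> G \<longleftrightarrow> (\<exists>G4. rect_grid \<Omega> G4 \<and> G = refine_grid (refine_grid G4))"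

definition interior_vertices :: "rect \<Rightarrow> rect set \<Rightarrow> point set" where
  "interior_vertices \<Omega> G = (\<Union>K\<in>G. vertices K) \<inter> open_rect \<Omega>"

definition boundary_vertices :: "rect \<Rightarrow> rect set \<Rightarrow> point set" where
  "boundary_vertices \<Omega> G = (\<Union>K\<in>G. vertices K) - open_rect \<Omega>"

definition interior_edges :: "rect \<Rightarrow> rect set \<Rightarrow> (point \<times> point) set" where
  "interior_edges \<Omega> G =
     {(a, b) \<in> (\<Union>K\<in>G. edges K). open_segment a b \<subseteq> open_rect \<Omega>}"

definition unit_normal :: "point \<times> point \<Rightarrow> point" where
  "unit_normal e = (let d = snd e - fst e in (1 / norm d) *\<^sub>R (snd d, - fst d))"

text \<open>The mean value with respect to arc length over a straight edge: the affine
  parametrization over the unit interval has constant speed.\<close>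

definition edge_mean :: "point \<times> point \<Rightarrow> field \<Rightarrow> real" where
  "edge_mean e g = integral {0..1} (\<lambda>t. g (linepath (fst e) (snd e) t))"


section \<open>The reduced rectangular Morley space\<close>

definition Pk :: "nat \<Rightarrow> field set" where
  "Pk k = {p. \<exists>c :: nat \<Rightarrow> nat \<Rightarrow> real.
     \<forall>x y. p (x, y) = (\<Sum>i\<le>k. \<Sum>j\<le>k - i. c i j * x ^ i * y ^ j)}"

definition restricts_to :: "field \<Rightarrow> rect \<Rightarrow> field \<Rightarrow> bool" where
  "restricts_to w K p \<longleftrightarrow> (AE z in lebesgue_on (closed_rect K). w z = p z)"

text \<open>The polynomial with which \<open>w\<close> agrees on the nondegenerate cell \<open>K\<close>; it is unique if it
  exists, and supplies the one-sided traces of \<open>w\<close> at vertices and edges of \<open>K\<close>.\<close>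

definition piece :: "field \<Rightarrow> rect \<Rightarrow> field" where
  "piece w K = (SOME p. p \<in> Pk 2 \<and> restricts_to w K p)"

definition normal_deriv :: "point \<times> point \<Rightarrow> field \<Rightarrow> field" where
  "normal_deriv e p z = grad p z \<bullet> unit_normal e"

definition RRM :: "rect \<Rightarrow> rect set \<Rightarrow> field set" where
  "RRM \<Omega> G = {w \<in> L2 (open_rect \<Omega>).
     (\<forall>K\<in>G. \<exists>p\<in>Pk 2. restricts_to w K p) \<and>
     (\<forall>a\<in>interior_vertices \<Omega> G. \<forall>K\<in>G. \<forall>L\<in>G.
        a \<in> vertices K \<longrightarrow> a \<in> vertices L \<longrightarrow> piece w K a = piece w L a) \<and>
     (\<forall>e\<in>interior_edges \<Omega> G. \<forall>K\<in>G. \<forall>L\<in>G.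
        e \<in> edges K \<longrightarrow> e \<in> edges L \<longrightarrow>
        edge_mean e (normal_deriv e (piece w K)) = edge_mean e (normal_deriv e (piece w L))) \<and>
     (\<forall>a\<in>boundary_vertices \<Omega> G. \<forall>K\<in>G. a \<in> vertices K \<longrightarrow> piece w K a = 0)}"

definition a_h :: "rect set \<Rightarrow> field \<Rightarrow> field \<Rightarrow> real" where
  "a_h G w v =
     (\<Sum>K\<in>G. LINT z|lebesgue_on (closed_rect K). grad (piece w K) z \<bullet> grad (piece v K) z)"

definition b_form :: "rect \<Rightarrow> field \<Rightarrow> field \<Rightarrow> field \<Rightarrow> real" where
  "b_form \<Omega> \<rho> f v = (LINT z|lebesgue_on (open_rect \<Omega>). \<rho> z * f z * v z)"

definition norm_0 :: "rect \<Rightarrow> field \<Rightarrow> field \<Rightarrow> real" where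
  "norm_0 \<Omega> \<rho> v = sqrt (b_form \<Omega> \<rho> v v)"

end

theory Submission
  imports Defs "HOL-Real_Asymp.Real_Asymp"
begin

text \<open>The error is tested against a sine mode \<open>\<phi> = sin (\<mu> x) sin (\<nu> y)\<close> of the rectangle that is
  not orthogonal to \<open>\<rho> f\<close>; one exists by Stone--Weierstrass. By duality, and with
  \<open>\<Lambda> = \<mu>\<^sup>2 + \<nu>\<^sup>2\<close>, the pairing \<open>(u - u_h, \<phi>)\<close> equals \<open>(\<rho> f, \<phi> / \<Lambda> - v_h)\<close>, where \<open>v_h\<close> is the
  discrete solution with right-hand side \<open>\<phi>\<close>. On a uniform grid with cells of size \<open>2 a \<times> 2 b\<close> this
  discrete solution is explicit: its nodal values are \<open>\<alpha> \<phi>\<close>, with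
  \<open>\<alpha> = 1 / \<Lambda> + 2 / 3 * \<mu>\<^sup>2 \<nu>\<^sup>2 (a\<^sup>2 + b\<^sup>2) / \<Lambda>\<^sup>2 + o(a\<^sup>2 + b\<^sup>2)\<close>, and \<open>v_h = \<alpha> \<phi>\<close> pointwise
  up to third order. Hence the pairing is exactly of second order, and
  Cauchy--Schwarz bounds the norm of the error from below.\<close>

section \<open>Integration\<close>

text \<open>For a quadratic on a cell, the means of the normal derivative over two opposite edges
  have a sum that the four vertex values determine. In the reduced space the edge means along a row
  of cells therefore obey a first-order recurrence driven by the nodal values. If these sample a
  sine, a cosine solves the recurrence, and adding its values at both ends of a cell yields twice
  its value at the centre times cos (\<mu> a): the origin of every division by a cosine below. The
  obstacle is that members of the space are not assembled from independent cell contributions, so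
  the discrete equation is not checked against a local basis. It is verified for an arbitrary
  \<open>w\<close>: the residual of one cell becomes a sum of differences of edge quantities, and
  the sum over the grid telescopes. One scalar condition stands in the way, and it fixes \<alpha>.
  The sign of \<alpha> - 1 / \<Lambda> comes from the stiffness alone: to second order the load
  symbol is 1, while the stiffness symbol falls short of \<Lambda> by 2/3 \<mu>^2 \<nu>^2 (a^2 +
  b^2), which is positive because both frequencies are.\<close>

lemma integrable_mult_bounded_right:
  fixes g f :: "'a \<Rightarrow> real"
  assumes g: "integrable M g" and f: "f \<in> borel_measurable M"
    and bd: "AE z in M. \<bar>f z\<bar> \<le> B"
  shows "integrable M (\<lambda>z. g z * f z)"
proof (rule Bochner_Integration.integrable_bound[of M "\<lambda>z. B * g z"])
  show "integrable M (\<lambda>z. B * g z)" using g by simp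
  show "(\<lambda>z. g z * f z) \<in> borel_measurable M" using g f by auto
  show "AE z in M. norm (g z * f z) \<le> norm (B * g z)"
    using bd
  proof eventually_elim
    case (elim z)
    then have "\<bar>f z\<bar> \<le> \<bar>B\<bar>" by linarith
    then have "\<bar>f z\<bar> * \<bar>g z\<bar> \<le> \<bar>B\<bar> * \<bar>g z\<bar>" by (rule mult_right_mono) simp
    then show ?case by (simp add: abs_mult mult.commute)
  qed
qed

lemma abs_integral_mult_le:
  fixes g f :: "'a \<Rightarrow> real"
  assumes g: "integrable M g" and f: "f \<in> borel_measurable M"
    and bd: "AE z in M. \<bar>f z\<bar> \<le> B"
  shows "\<bar>LINT z|M. g z * f z\<bar> \<le> B * (LINT z|M. \<bar>g z\<bar>)"
proof -
  have "\<bar>LINT z|M. g z * f z\<bar> \<le> (LINT z|M. \<bar>g z * f z\<bar>)"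
    by (rule integral_abs_bound)
  also have "\<dots> \<le> (LINT z|M. B * \<bar>g z\<bar>)"
  proof (rule integral_mono_AE)
    show "integrable M (\<lambda>z. \<bar>g z * f z\<bar>)"
      using integrable_mult_bounded_right[OF g f bd] by auto
    show "integrable M (\<lambda>z. B * \<bar>g z\<bar>)" using g by simp
    show "AE z in M. \<bar>g z * f z\<bar> \<le> B * \<bar>g z\<bar>"
      using bd by eventually_elim (simp add: abs_mult mult.commute mult_right_mono)
  qed
  finally show ?thesis by simp
qed

lemma integrable_mult_L2:
  fixes f g :: "'a \<Rightarrow> real"
  assumes f: "f \<in> borel_measurable M" "integrable M (\<lambda>z. (f z)\<^sup>2)"
    and g: "g \<in> borel_measurable M" "integrable M (\<lambda>z. (g z)\<^sup>2)"
  shows "integrable M (\<lambda>z. f z * g z)"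
proof (rule Bochner_Integration.integrable_bound[of M "\<lambda>z. (f z)\<^sup>2 + (g z)\<^sup>2"])
  have "\<bar>x * y\<bar> \<le> \<bar>x\<^sup>2 + y\<^sup>2\<bar>" for x y :: real
  proof -
    have "0 \<le> (\<bar>x\<bar> - \<bar>y\<bar>)\<^sup>2" "0 \<le> x\<^sup>2 + y\<^sup>2" by simp_all
    then have "2 * (\<bar>x\<bar> * \<bar>y\<bar>) \<le> x\<^sup>2 + y\<^sup>2" by (simp add: power2_diff)
    moreover have "0 \<le> \<bar>x\<bar> * \<bar>y\<bar>" by simp
    ultimately show ?thesis using \<open>0 \<le> x\<^sup>2 + y\<^sup>2\<close> unfolding abs_mult by linarith
  qed
  then show "AE z in M. norm (f z * g z) \<le> norm ((f z)\<^sup>2 + (g z)\<^sup>2)" by simp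
qed (use f g in auto)

lemma integral_Cauchy_Schwarz:
  fixes f g :: "'a \<Rightarrow> real"
  assumes f: "f \<in> borel_measurable M" "integrable M (\<lambda>z. (f z)\<^sup>2)"
    and g: "g \<in> borel_measurable M" "integrable M (\<lambda>z. (g z)\<^sup>2)"
  shows "(LINT z|M. f z * g z)\<^sup>2 \<le> (LINT z|M. (f z)\<^sup>2) * (LINT z|M. (g z)\<^sup>2)"
proof -
  define A B C where "A = (LINT z|M. (f z)\<^sup>2)" and "B = (LINT z|M. f z * g z)"
    and "C = (LINT z|M. (g z)\<^sup>2)"
  have fg: "integrable M (\<lambda>z. f z * g z)" by (rule integrable_mult_L2[OF f g])
  have q: "0 \<le> x\<^sup>2 * A - 2 * x * y * B + y\<^sup>2 * C" for x y
  proof -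
    have "0 \<le> (LINT z|M. (x * f z - y * g z)\<^sup>2)" by simp
    also have "\<dots> = (LINT z|M. x\<^sup>2 * (f z)\<^sup>2 - (2 * x * y) * (f z * g z) + y\<^sup>2 * (g z)\<^sup>2)"
      by (rule Bochner_Integration.integral_cong) (auto simp: power2_eq_square algebra_simps)
    also have "\<dots> = x\<^sup>2 * A - (2 * x * y) * B + y\<^sup>2 * C"
      unfolding A_def B_def C_def using f g fg by simp
    finally show ?thesis by simp
  qed
  have A0: "0 \<le> A" and C0: "0 \<le> C" unfolding A_def C_def by simp_all
  show ?thesis
  proof (cases "C = 0")
    case True
    show ?thesis
    proof (rule ccontr)
      assume "\<not> ?thesis"
      then have "B \<noteq> 0" using True by (auto simp: A_def B_def C_def)
      \<comment> \<open>With C = 0 the form is affine in y, and this y gives it the value - A - 2 <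
        0.\<close>
      have "0 \<le> 1\<^sup>2 * A - 2 * 1 * ((A + 1) / B) * B + ((A + 1) / B)\<^sup>2 * C" by (rule q)
      moreover have "2 * 1 * ((A + 1) / B) * B = 2 * (A + 1)" using \<open>B \<noteq> 0\<close> by simp
      ultimately show False using True A0 by simp
    qed
  next
    case False
    \<comment> \<open>At x = C, y = B the form equals C (A C - B^2).\<close>
    have "0 \<le> C\<^sup>2 * A - 2 * C * B * B + B\<^sup>2 * C" by (rule q)
    then have "0 \<le> C * (A * C - B\<^sup>2)" by (simp add: power2_eq_square algebra_simps)
    then have "0 \<le> A * C - B\<^sup>2" using False C0 by (simp add: zero_le_mult_iff)
    then show ?thesis by (simp add: A_def B_def C_def)
  qed
qed

text \<open>Stone--Weierstrass extends the orthogonality to all continuous functions; approximating the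
  sign of \<open>g\<close> pointwise by continuous functions then gives \<open>\<integral>\<bar>g\<bar> = 0\<close>.\<close>

lemma AE_zero_if_orthogonal_function_ring:
  fixes g :: "'a::euclidean_space \<Rightarrow> real"
  assumes R: "function_ring_on R C" and S: "S \<in> sets lebesgue" "S \<subseteq> C"
    and g: "integrable (lebesgue_on S) g"
    and orth: "\<And>P. P \<in> R \<Longrightarrow> (LINT z|lebesgue_on S. g z * P z) = 0"
  shows "AE z in lebesgue_on S. g z = 0"
proof -
  interpret function_ring_on R C by (rule R)
  let ?M = "lebesgue_on S"
  have meas: "F \<in> borel_measurable ?M" if "continuous_on C F" for F :: "'a \<Rightarrow> real"
    using that S continuous_imp_measurable_on_sets_lebesgue continuous_on_subset by blast
  have bdd: "\<exists>B. \<forall>z\<in>C. \<bar>F z\<bar> \<le> B" if "continuous_on C F" for F :: "'a \<Rightarrow> real"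
    using compact_imp_bounded[OF compact_continuous_image[OF that compact]]
    by (auto simp: bounded_iff)
  have sp: "space ?M = S" by (simp add: space_restrict_space)
  have gF: "integrable ?M (\<lambda>z. g z * F z)" if "continuous_on C F" for F :: "'a \<Rightarrow> real"
  proof -
    obtain B where "\<forall>z\<in>C. \<bar>F z\<bar> \<le> B" using bdd[OF \<open>continuous_on C F\<close>] by blast
    then show ?thesis
      by (intro integrable_mult_bounded_right[OF g meas[OF that], of B] AE_I2) (use S sp in auto)
  qed
  have cont0: "(LINT z|?M. g z * F z) = 0" if F: "continuous_on C F" for F :: "'a \<Rightarrow> real"
  proof -
    define I where "I = (LINT z|?M. \<bar>g z\<bar>)"
    have I0: "0 \<le> I" by (simp add: I_def)
    have "\<bar>LINT z|?M. g z * F z\<bar> \<le> 0 + e" if "e > 0" for e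
    proof -
      \<comment> \<open>The summand 1 covers the case that \<open>g\<close> has vanishing L1
        norm.\<close>
      have e': "e / (I + 1) > 0" using \<open>e > 0\<close> I0 by simp
      obtain P where P: "P \<in> R" "\<forall>x\<in>C. \<bar>F x - P x\<bar> < e / (I + 1)"
        using Stone_Weierstrass_basic[OF F e'] by blast
      have cP: "continuous_on C P" using continuous[OF P(1)] .
      have "(LINT z|?M. g z * F z) = (LINT z|?M. g z * (F z - P z)) + (LINT z|?M. g z * P z)"
        using gF[OF F] gF[OF cP] by (simp add: algebra_simps)
      then have "\<bar>LINT z|?M. g z * F z\<bar> = \<bar>LINT z|?M. g z * (F z - P z)\<bar>"
        using orth[OF P(1)] by simp
      also have "\<dots> \<le> e / (I + 1) * (LINT z|?M. \<bar>g z\<bar>)"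
        by (rule abs_integral_mult_le[OF g _ AE_I2]) (use P S sp meas[OF F] meas[OF cP] in \<open>auto intro: less_imp_le\<close>)
      also have "\<dots> \<le> e" using I0 \<open>e > 0\<close> unfolding I_def[symmetric] by (simp add: field_simps)
      finally show ?thesis by simp
    qed
    then have "\<bar>LINT z|?M. g z * F z\<bar> \<le> 0" by (rule field_le_epsilon)
    then show ?thesis by simp
  qed
  have "(\<lambda>z. sgn (g z)) \<in> borel_measurable ?M" using g by auto
  then have "(\<lambda>z. sgn (g z)) measurable_on S"
    using S measurable_on_iff_borel_measurable by blast
  then obtain N F where N: "negligible N" and F: "\<And>n. continuous_on UNIV (F n)"
    and lim: "\<And>x. x \<notin> N \<Longrightarrow> (\<lambda>n. F n x) \<longlonglongrightarrow> (if x \<in> S then sgn (g x) else 0)"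
    unfolding measurable_on_def by blast
  \<comment> \<open>Clipping to [-1, 1] leaves the limit sgn (g x) unchanged and makes |g| a
    dominating function.\<close>
  define H where "H n x = max (-1) (min 1 (F n x))" for n :: nat and x
  have H: "continuous_on A (H n)" for n A
    unfolding H_def by (intro continuous_intros continuous_on_subset[OF F[of n]]) auto
  have aeN: "AE z in ?M. z \<notin> N"
  proof -
    have "AE z in lebesgue. z \<notin> N"
      using N by (simp add: negligible_iff_null_sets AE_not_in)
    then show ?thesis using S by (auto simp: AE_restrict_space_iff)
  qed
  have "(\<lambda>n. LINT z|?M. g z * H n z) \<longlonglongrightarrow> (LINT z|?M. \<bar>g z\<bar>)"
  proof (rule integral_dominated_convergence[where w = "\<lambda>z. \<bar>g z\<bar>"])
    show "AE x in ?M. (\<lambda>i. g x * H i x) \<longlonglongrightarrow> \<bar>g x\<bar>"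
      using aeN AE_space
    proof eventually_elim
      case (elim x)
      then have "(\<lambda>n. F n x) \<longlonglongrightarrow> sgn (g x)" using lim[of x] sp by simp
      then have "(\<lambda>n. H n x) \<longlonglongrightarrow> max (-1) (min 1 (sgn (g x)))"
        unfolding H_def by (intro tendsto_intros)
      also have "max (-1) (min 1 (sgn (g x))) = sgn (g x)" by (auto simp: sgn_if)
      finally have "(\<lambda>n. g x * H n x) \<longlonglongrightarrow> g x * sgn (g x)" by (intro tendsto_intros)
      then show ?case by (metis mult_sgn_abs mult.commute abs_sgn)
    qed
    show "AE x in ?M. norm (g x * H i x) \<le> \<bar>g x\<bar>" for i
      by (intro AE_I2) (auto simp: H_def abs_mult intro!: mult_left_le)
  qed (use g meas[OF H] in auto)
  then have "(LINT z|?M. \<bar>g z\<bar>) = 0"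
    using cont0[OF H] by (auto dest: LIMSEQ_unique[OF tendsto_const])
  then have "AE z in ?M. \<bar>g z\<bar> = 0"
    by (subst integral_nonneg_eq_0_iff_AE[symmetric]) (use g in auto)
  then show ?thesis by simp
qed

section \<open>Smooth functions\<close>

lemma dx_eq: "(f has_derivative D) (at z) \<Longrightarrow> dx f z = D (1, 0)"
  and dy_eq: "(f has_derivative D) (at z) \<Longrightarrow> dy f z = D (0, 1)"
  by (simp_all add: dx_def dy_def frechet_derivative_at[symmetric])

lemma dx_const [simp]: "dx (\<lambda>z. c) = (\<lambda>z. 0)" and dy_const [simp]: "dy (\<lambda>z. c) = (\<lambda>z. 0)"
  by (auto simp: dx_def dy_def)

lemma has_derivative_dx_dy:
  assumes "f differentiable at z"
  shows "(f has_derivative (\<lambda>h. fst h * dx f z + snd h * dy f z)) (at z)"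
proof -
  have d: "(f has_derivative frechet_derivative f (at z)) (at z)"
    using assms frechet_derivative_works by blast
  interpret linear "frechet_derivative f (at z)"
    using d has_derivative_linear by blast
  have "frechet_derivative f (at z) h = fst h * dx f z + snd h * dy f z" for h
  proof -
    have "h = fst h *\<^sub>R (1, 0) + snd h *\<^sub>R (0, 1)" by (simp add: prod_eq_iff)
    then have "frechet_derivative f (at z) h = frechet_derivative f (at z) (fst h *\<^sub>R (1, 0) + snd h *\<^sub>R (0, 1))"
      by (rule arg_cong)
    also have "\<dots> = fst h * dx f z + snd h * dy f z"
      unfolding add scale by (simp add: dx_def dy_def)
    finally show ?thesis .
  qed
  moreover have "frechet_derivative f (at z) = (\<lambda>h. frechet_derivative f (at z) h)" ..
  ultimately show ?thesis using d by simp
qed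

lemma dx_add: "f differentiable at z \<Longrightarrow> g differentiable at z \<Longrightarrow> dx (\<lambda>z. f z + g z) z = dx f z + dx g z"
  and dy_add: "f differentiable at z \<Longrightarrow> g differentiable at z \<Longrightarrow> dy (\<lambda>z. f z + g z) z = dy f z + dy g z"
  using dx_eq[OF has_derivative_add[OF has_derivative_dx_dy[of f z] has_derivative_dx_dy[of g z]]]
    dy_eq[OF has_derivative_add[OF has_derivative_dx_dy[of f z] has_derivative_dx_dy[of g z]]]
  by simp_all

lemma dx_mult: "f differentiable at z \<Longrightarrow> g differentiable at z \<Longrightarrow>
    dx (\<lambda>z. f z * g z) z = f z * dx g z + dx f z * g z"
  and dy_mult: "f differentiable at z \<Longrightarrow> g differentiable at z \<Longrightarrow>
    dy (\<lambda>z. f z * g z) z = f z * dy g z + dy f z * g z"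
  using dx_eq[OF has_derivative_mult[OF has_derivative_dx_dy[of f z] has_derivative_dx_dy[of g z]]]
    dy_eq[OF has_derivative_mult[OF has_derivative_dx_dy[of f z] has_derivative_dx_dy[of g z]]]
  by simp_all

lemma Ck_differentiable: "Ck (Suc k) f \<Longrightarrow> f differentiable at z"
  by (simp del: split_paired_All)

lemma Ck_const [simp]: "Ck k (\<lambda>z. c)"
  by (induction k arbitrary: c) (auto simp: continuous_on_const)

lemma Ck_continuous: "Ck k f \<Longrightarrow> continuous_on UNIV f"
proof (cases k)
  case (Suc n)
  assume "Ck k f"
  then have "f differentiable at z" for z using Ck_differentiable Suc by blast
  then show ?thesis
    by (blast intro: continuous_at_imp_continuous_on differentiable_imp_continuous_within)
qed simp

lemma Ck_Suc_imp: "Ck (Suc k) f \<Longrightarrow> Ck k f"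
proof (induction k arbitrary: f)
  case 0
  from Ck_continuous[OF this] show ?case by simp
next
  case (Suc k)
  show ?case
    using Suc.prems Suc.IH[of "dx f"] Suc.IH[of "dy f"] unfolding Ck.simps(2)[of "Suc k"] Ck.simps(2)[of k f] by blast
qed

lemma Ck_add: "Ck k f \<Longrightarrow> Ck k g \<Longrightarrow> Ck k (\<lambda>z. f z + g z)"
proof (induction k arbitrary: f g)
  case 0
  then show ?case by (auto intro: continuous_intros)
next
  case (Suc k)
  have "dx (\<lambda>z. f z + g z) = (\<lambda>z. dx f z + dx g z)" "dy (\<lambda>z. f z + g z) = (\<lambda>z. dy f z + dy g z)"
    using Suc.prems by (auto intro!: ext simp: dx_add dy_add)
  then show ?case using Suc by (simp add: differentiable_add)
qed

lemma Ck_mult: "Ck k f \<Longrightarrow> Ck k g \<Longrightarrow> Ck k (\<lambda>z. f z * g z)"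
proof (induction k arbitrary: f g)
  case 0
  then show ?case by (auto intro: continuous_intros)
next
  case (Suc k)
  have eq: "dx (\<lambda>z. f z * g z) = (\<lambda>z. f z * dx g z + dx f z * g z)"
    "dy (\<lambda>z. f z * g z) = (\<lambda>z. f z * dy g z + dy f z * g z)"
    using Suc.prems by (auto intro!: ext simp: dx_mult dy_mult)
  have "Ck k f" "Ck k g" using Suc.prems Ck_Suc_imp by blast+
  then show ?case using Suc unfolding Ck.simps eq
    by (auto intro!: Ck_add differentiable_mult)
qed

lemma Ck_diff: "Ck k f \<Longrightarrow> Ck k g \<Longrightarrow> Ck k (\<lambda>z. f z - g z)"
  using Ck_add[of k f "\<lambda>z. -1 * g z"] Ck_mult[of k "\<lambda>z. -1" g] by simp

lemma Ck_dx: "Ck (Suc k) f \<Longrightarrow> Ck k (dx f)" and Ck_dy: "Ck (Suc k) f \<Longrightarrow> Ck k (dy f)"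
  by simp_all

lemma has_derivative_compose_affine:
  fixes F :: "real \<Rightarrow> real"
  assumes "(F has_real_derivative D) (at (p * fst z + q * snd z + r))"
  shows "((\<lambda>z. F (p * fst z + q * snd z + r)) has_derivative (\<lambda>h. D * (p * fst h + q * snd h))) (at z)"
proof -
  have *: "((\<lambda>z. p * fst z + q * snd z + r) has_derivative (\<lambda>h. p * fst h + q * snd h)) (at z)"
    by (auto intro!: derivative_eq_intros)
  show ?thesis
    using has_derivative_compose[OF * assms[THEN has_field_derivative_imp_has_derivative]] by simp
qed

lemma dx_compose_affine:
  fixes F F' :: "real \<Rightarrow> real"
  assumes "\<And>t. (F has_real_derivative F' t) (at t)"
  shows "dx (\<lambda>z. F (p * fst z + q * snd z + r)) = (\<lambda>z. p * F' (p * fst z + q * snd z + r))"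
    and "dy (\<lambda>z. F (p * fst z + q * snd z + r)) = (\<lambda>z. q * F' (p * fst z + q * snd z + r))"
    and "(\<lambda>z. F (p * fst z + q * snd z + r)) differentiable at z"
proof -
  note d = has_derivative_compose_affine[OF assms, of p q r]
  show "dx (\<lambda>z. F (p * fst z + q * snd z + r)) = (\<lambda>z. p * F' (p * fst z + q * snd z + r))"
    "dy (\<lambda>z. F (p * fst z + q * snd z + r)) = (\<lambda>z. q * F' (p * fst z + q * snd z + r))"
    using dx_eq[OF d] dy_eq[OF d] by (simp_all add: fun_eq_iff mult.commute del: split_paired_All)
  show "(\<lambda>z. F (p * fst z + q * snd z + r)) differentiable at z"
    using d[of z] by (rule differentiableI)
qed

text \<open>Reading the cosine as a sine shifted by pi / 2 keeps the derivatives inside the family,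
  so the induction closes once the shift \<open>r\<close> is arbitrary.\<close>

lemma Ck_sin_affine: "Ck k (\<lambda>z. sin (p * fst z + q * snd z + r))"
proof (induction k arbitrary: r)
  case 0
  show ?case by (auto intro!: continuous_intros)
next
  case (Suc k)
  have d: "(sin has_real_derivative sin (t + pi / 2)) (at t)" for t
    using DERIV_sin[of t] by (simp add: sin_add)
  have "Ck k (\<lambda>z. sin (p * fst z + q * snd z + r + pi / 2))"
    using Suc[of "r + pi / 2"] by (simp only: add.assoc)
  then show ?case
    using dx_compose_affine[OF d, of p q r] by (simp add: Ck_mult)
qed

lemma Ck_affine: "Ck k (\<lambda>z. p * fst z + q * snd z + r)"
proof (cases k)
  case 0
  then show ?thesis by (auto intro!: continuous_intros)
next
  case (Suc n)
  have d: "((\<lambda>t. t) has_real_derivative 1) (at t)" for t :: real by auto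
  show ?thesis
    unfolding Suc by (simp add: dx_compose_affine[OF d])
qed

text \<open>The powers of t in the denominator make the family closed under differentiation up to
  linear combinations, so smoothness of the standard flat function exp (-1/t) follows by one
  induction over all \<open>k\<close>.\<close>

definition flat_exp :: "nat \<Rightarrow> real \<Rightarrow> real" where
  "flat_exp k t = (if t > 0 then exp (- (1 / t)) / t ^ k else 0)"

lemma flat_exp_tendsto_0: "(flat_exp k \<longlongrightarrow> 0) (at 0)"
proof -
  have "((\<lambda>y::real. y ^ k / exp y) \<longlongrightarrow> 0) at_top" by (rule tendsto_power_div_exp_0)
  then have "((\<lambda>t::real. inverse t ^ k / exp (inverse t)) \<longlongrightarrow> 0) (at_right 0)"
    by (rule filterlim_compose[OF _ filterlim_inverse_at_top_right])
  then have r: "(flat_exp k \<longlongrightarrow> 0) (at_right 0)"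
    by (rule Lim_transform_eventually)
      (auto simp: flat_exp_def eventually_at_filter field_simps exp_minus power_divide)
  have l: "(flat_exp k \<longlongrightarrow> 0) (at_left 0)"
    by (rule Lim_transform_eventually[OF tendsto_const]) (auto simp: flat_exp_def eventually_at_filter)
  show ?thesis using l r by (simp add: filterlim_split_at)
qed

lemma DERIV_flat_exp: "(flat_exp k has_real_derivative - real k * flat_exp (k + 1) t + flat_exp (k + 2) t) (at t)"
proof (cases "t = 0")
  case True
  \<comment> \<open>The difference quotient at 0 is again a member of the family, with index k +
    1.\<close>
  have "((\<lambda>h. (flat_exp k (0 + h) - flat_exp k 0) / h) \<longlongrightarrow> 0) (at 0)"
    by (rule Lim_transform_eventually[OF flat_exp_tendsto_0[of "k + 1"]])
      (auto simp: flat_exp_def eventually_at_filter)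
  then show ?thesis
    unfolding True DERIV_def by (simp add: flat_exp_def)
next
  case False
  show ?thesis
  proof (cases "t > 0")
    case True
    have "((\<lambda>t. exp (- (1 / t)) / t ^ k) has_real_derivative
        - real k * (exp (- (1 / t)) / t ^ (k + 1)) + exp (- (1 / t)) / t ^ (k + 2)) (at t)"
      using True
      by (auto intro!: derivative_eq_intros simp: field_simps power2_eq_square)
         (cases k; simp add: field_simps)
    then have "((\<lambda>t. exp (- (1 / t)) / t ^ k) has_real_derivative
        - real k * flat_exp (k + 1) t + flat_exp (k + 2) t) (at t)"
      using True by (simp add: flat_exp_def)
    then show ?thesis
      by (rule DERIV_cong_ev[THEN iffD1, rotated -1, OF _ refl _ refl])
        (use True eventually_nhds_in_open[of "{0<..}" t] in \<open>auto simp: flat_exp_def elim!: eventually_mono\<close>)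
  next
    case neg: False
    have "((\<lambda>t. 0) has_real_derivative - real k * flat_exp (k + 1) t + flat_exp (k + 2) t) (at t)"
      using neg by (simp add: flat_exp_def)
    then show ?thesis
      by (rule DERIV_cong_ev[THEN iffD1, rotated -1, OF _ refl _ refl])
        (use neg False eventually_nhds_in_open[of "{..<0}" t] in \<open>auto simp: flat_exp_def elim!: eventually_mono\<close>)
  qed
qed

lemma Ck_flat_exp_affine: "Ck k (\<lambda>z. flat_exp j (p * fst z + q * snd z + r))"
proof (induction k arbitrary: j)
  case 0
  have "continuous_on UNIV (flat_exp j)"
    using DERIV_flat_exp by (intro continuous_at_imp_continuous_on) (blast intro: DERIV_isCont)
  then show ?case
    by (auto intro!: continuous_on_compose2[of UNIV "flat_exp j"] continuous_intros)
next
  case (Suc k)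
  then show ?case
    using dx_compose_affine[OF DERIV_flat_exp, of j p q r]
    by (auto intro!: Ck_mult Ck_add Ck_diff)
qed

section \<open>Integration over rectangles\<close>

lemma closed_rect_times: "closed_rect K = {xl K..xr K} \<times> {yl K..yr K}"
  and open_rect_times: "open_rect K = {xl K<..<xr K} \<times> {yl K<..<yr K}"
  by (auto simp: closed_rect_def open_rect_def cbox_Pair_eq mem_box Basis_prod_def)

lemma open_rect_subset: "open_rect K \<subseteq> closed_rect K"
  by (simp add: closed_rect_def open_rect_def box_subset_cbox)

lemma rect_sets [simp]: "open_rect K \<in> sets lebesgue" "closed_rect K \<in> sets lebesgue"
  by (simp_all add: closed_rect_def open_rect_def)

lemma compact_closed_rect: "compact (closed_rect K)"
  by (simp add: closed_rect_def)

lemma integrable_closed_rect: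
  "continuous_on (closed_rect K) f \<Longrightarrow> integrable (lebesgue_on (closed_rect K)) f" for f :: field
  unfolding closed_rect_def by (rule continuous_imp_integrable)

lemma integrable_open_rect:
  fixes f :: field
  assumes "continuous_on (closed_rect K) f"
  shows "integrable (lebesgue_on (open_rect K)) f"
proof -
  have "set_integrable lebesgue (closed_rect K) f"
    using integrable_closed_rect[OF assms] unfolding set_integrable_def by (simp add: integrable_restrict_space)
  then have "set_integrable lebesgue (open_rect K) f"
    by (rule set_integrable_subset) (use open_rect_subset in auto)
  then show ?thesis unfolding set_integrable_def by (simp add: integrable_restrict_space)
qed

lemma integral_open_rect:
  fixes f :: field
  assumes "integrable (lebesgue_on (open_rect K)) f"
  shows "(LINT z|lebesgue_on (open_rect K). f z) = integral (closed_rect K) f"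
  using lebesgue_integral_eq_integral[OF assms] integral_open_interval[of "(xl K, yl K)" "(xr K, yr K)" f]
  by (simp add: open_rect_def closed_rect_def)

lemma has_integral_times:
  fixes f g :: "real \<Rightarrow> real"
  assumes f: "(f has_integral A) {a..b}" "continuous_on {a..b} f"
    and g: "(g has_integral B) {c..d}" "continuous_on {c..d} g"
  shows "((\<lambda>z. f (fst z) * g (snd z)) has_integral A * B) (cbox (a, c) (b, d))"
proof -
  have cont: "continuous_on (cbox (a, c) (b, d)) (\<lambda>z. f (fst z) * g (snd z))"
    by (intro continuous_intros continuous_on_compose2[OF f(2)] continuous_on_compose2[OF g(2)])
      (auto simp: cbox_Pair_eq)
  have "integral (cbox (a, c) (b, d)) (\<lambda>z. f (fst z) * g (snd z))
      = integral (cbox a b) (\<lambda>x. integral (cbox c d) (\<lambda>y. f x * g y))"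
    using integral_prod_continuous[OF cont] by simp
  also have "\<dots> = integral (cbox a b) (\<lambda>x. f x * B)"
    using integral_unique[OF g(1)] by simp
  also have "\<dots> = A * B"
    using integral_unique[OF f(1)] by simp
  finally show ?thesis
    using integrable_continuous[OF cont] by (metis has_integral_integral)
qed

lemma partial_has_vector_derivative:
  assumes "F differentiable at (x, y)"
  shows "((\<lambda>x. F (x, y)) has_vector_derivative dx F (x, y)) (at x)" (is ?x)
    and "((\<lambda>y. F (x, y)) has_vector_derivative dy F (x, y)) (at y)" (is ?y)
proof -
  have 1: "((\<lambda>x. (x, y)) has_derivative (\<lambda>h. (h, 0))) (at x)"
    and 2: "((\<lambda>y. (x, y)) has_derivative (\<lambda>h. (0, h))) (at y)"
    by (auto intro!: derivative_eq_intros)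
  show ?x ?y
    using has_derivative_compose[OF 1 has_derivative_dx_dy[OF assms]]
      has_derivative_compose[OF 2 has_derivative_dx_dy[OF assms]]
    by (simp_all add: has_vector_derivative_def)
qed

text \<open>Integrating first in the direction of the derivative reduces both identities to the
  fundamental theorem of calculus on segments whose end points lie outside the open
  rectangle.\<close>

lemma integral_dx_dy_zero:
  assumes K: "nondegenerate K" and F: "Ck (Suc 0) F" and zero: "\<And>z. z \<notin> open_rect K \<Longrightarrow> F z = 0"
  shows "integral (closed_rect K) (dx F) = 0" "integral (closed_rect K) (dy F) = 0"
proof -
  note d = partial_has_vector_derivative[OF Ck_differentiable[OF F]]
  have c: "continuous_on A (dx F)" "continuous_on A (dy F)" for A
    using F by (auto intro: continuous_on_subset)
  have le: "xl K \<le> xr K" "yl K \<le> yr K" using K by (auto simp: nondegenerate_def)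
  have x0: "integral (cbox (xl K) (xr K)) (\<lambda>x. dx F (x, y)) = 0" for y
  proof -
    have "((\<lambda>x. dx F (x, y)) has_integral F (xr K, y) - F (xl K, y)) {xl K..xr K}"
      by (rule fundamental_theorem_of_calculus[OF le(1)]) (rule has_vector_derivative_at_within[OF d(1)])
    then show ?thesis using zero by (auto simp: open_rect_times dest!: integral_unique)
  qed
  have y0: "integral (cbox (yl K) (yr K)) (\<lambda>y. dy F (x, y)) = 0" for x
  proof -
    have "((\<lambda>y. dy F (x, y)) has_integral F (x, yr K) - F (x, yl K)) {yl K..yr K}"
      by (rule fundamental_theorem_of_calculus[OF le(2)]) (rule has_vector_derivative_at_within[OF d(2)])
    then show ?thesis using zero by (auto simp: open_rect_times dest!: integral_unique)
  qed
  have "integral (closed_rect K) (dx F)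
      = integral (cbox (xl K) (xr K)) (\<lambda>x. integral (cbox (yl K) (yr K)) (\<lambda>y. dx F (x, y)))"
    using integral_prod_continuous[OF c(1)[of "cbox (xl K, yl K) (xr K, yr K)"]] by (simp only: closed_rect_def)
  also have "\<dots> = integral (cbox (yl K) (yr K)) (\<lambda>y. integral (cbox (xl K) (xr K)) (\<lambda>x. dx F (x, y)))"
    using integral_swap_continuous[of "xl K" "yl K" "xr K" "yr K" "\<lambda>x y. dx F (x, y)"]
      c(1)[of "cbox (xl K, yl K) (xr K, yr K)"] by (simp add: case_prod_unfold)
  finally show "integral (closed_rect K) (dx F) = 0" using x0 by simp
  have "integral (closed_rect K) (dy F)
      = integral (cbox (xl K) (xr K)) (\<lambda>x. integral (cbox (yl K) (yr K)) (\<lambda>y. dy F (x, y)))"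
    using integral_prod_continuous[OF c(2)[of "cbox (xl K, yl K) (xr K, yr K)"]] by (simp only: closed_rect_def)
  then show "integral (closed_rect K) (dy F) = 0" using y0 by simp
qed

lemma L2_integrable: "f \<in> L2 (open_rect K) \<Longrightarrow> integrable (lebesgue_on (open_rect K)) f"
  using integrable_mult_L2[of f "lebesgue_on (open_rect K)" "\<lambda>z. 1"] integrable_open_rect[of K "\<lambda>z. 1"]
  by (auto simp: L2_def)

lemma L2_integrable_mult:
  "f \<in> L2 S \<Longrightarrow> g \<in> L2 S \<Longrightarrow> integrable (lebesgue_on S) (\<lambda>z. f z * g z)"
  by (auto simp: L2_def integrable_mult_L2)

lemma L2_diff: "f \<in> L2 S \<Longrightarrow> g \<in> L2 S \<Longrightarrow> (\<lambda>z. f z - g z) \<in> L2 S"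
  using L2_integrable_mult[of f S g] by (auto simp: L2_def power2_diff mult.assoc)

lemma continuous_L2:
  assumes "continuous_on (closed_rect K) f"
  shows "f \<in> L2 (open_rect K)"
  unfolding L2_def using integrable_open_rect[OF assms] integrable_open_rect[of K "\<lambda>z. (f z)\<^sup>2"] assms
  by (auto intro!: continuous_intros)

lemma space_lebesgue_on [simp]: "space (lebesgue_on S) = S"
  by (simp add: space_restrict_space)

lemma bounded_on_closed_rect:
  fixes f :: field
  assumes "continuous_on (closed_rect K) f"
  obtains B where "\<And>z. z \<in> closed_rect K \<Longrightarrow> \<bar>f z\<bar> \<le> B"
  using compact_imp_bounded[OF compact_continuous_image[OF assms compact_closed_rect]]
  by (auto simp: bounded_iff)

lemma integrable_mult_continuous:
  fixes f g :: field
  assumes g: "integrable (lebesgue_on (open_rect K)) g" and f: "continuous_on (closed_rect K) f"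
  shows "integrable (lebesgue_on (open_rect K)) (\<lambda>z. g z * f z)"
proof -
  obtain B where "\<And>z. z \<in> closed_rect K \<Longrightarrow> \<bar>f z\<bar> \<le> B" by (rule bounded_on_closed_rect[OF f]) blast
  then show ?thesis
    using continuous_L2[OF f] open_rect_subset[of K]
    by (intro integrable_mult_bounded_right[OF g, of _ B] AE_I2) (auto simp: L2_def)
qed

section \<open>Test functions\<close>

lemma test_function_Ck: "\<psi> \<in> test_functions S \<Longrightarrow> Ck k \<psi>"
  by (simp add: test_functions_def)

lemma test_function_zero: "\<psi> \<in> test_functions S \<Longrightarrow> z \<notin> S \<Longrightarrow> \<psi> z = 0"
  using closure_subset[of "{z. \<psi> z \<noteq> 0}"] by (auto simp: test_functions_def)

lemma test_functionI:
  assumes "\<And>k. Ck k \<psi>" "\<And>z. \<psi> z \<noteq> 0 \<Longrightarrow> z \<in> C" "compact C" "C \<subseteq> S"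
  shows "\<psi> \<in> test_functions S"
proof -
  have "closure {z. \<psi> z \<noteq> 0} \<subseteq> C"
    using assms by (intro closure_minimal) (auto simp: compact_imp_closed)
  then show ?thesis
    using assms compact_Int_closed[of C "closure {z. \<psi> z \<noteq> 0}"]
    by (auto simp: test_functions_def Int_absorb1)
qed

text \<open>The factor \<open>n\<close> in the derivative is compensated by functions vanishing on the boundary,
  since \<open>(t + 1) flat_exp 2 t\<close> is bounded.\<close>

definition cutoff :: "rect \<Rightarrow> nat \<Rightarrow> field" where
  "cutoff K n z =
     flat_exp 0 (real n * (fst z - xl K) - 1) * flat_exp 0 (real n * (xr K - fst z) - 1) *
     (flat_exp 0 (real n * (snd z - yl K) - 1) * flat_exp 0 (real n * (yr K - snd z) - 1))"

lemma Ck_cutoff: "Ck k (cutoff K n)"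
proof -
  have eq: "cutoff K n = (\<lambda>z.
     flat_exp 0 (real n * fst z + 0 * snd z + (- real n * xl K - 1)) *
     flat_exp 0 (- real n * fst z + 0 * snd z + (real n * xr K - 1)) *
     (flat_exp 0 (0 * fst z + real n * snd z + (- real n * yl K - 1)) *
      flat_exp 0 (0 * fst z + - real n * snd z + (real n * yr K - 1))))"
    by (auto simp: cutoff_def fun_eq_iff algebra_simps)
  show ?thesis unfolding eq by (intro Ck_mult Ck_flat_exp_affine)
qed

lemma flat_exp_0_bounds: "0 \<le> flat_exp k t" "flat_exp 0 t \<le> 1"
  by (auto simp: flat_exp_def)

lemma cutoff_bounds: "0 \<le> cutoff K n z" "cutoff K n z \<le> 1"
  unfolding cutoff_def
  by (auto intro!: mult_nonneg_nonneg mult_le_one flat_exp_0_bounds)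

text \<open>The shift by 1 inside the flat exponentials makes the cutoff vanish within distance 1 /
  n of every side, so the support is compact whatever \<open>f\<close> does at the boundary.\<close>

lemma cutoff_mult_test_function:
  assumes "\<And>k. Ck k f" "n > 0"
  shows "(\<lambda>z. cutoff K n z * f z) \<in> test_functions (open_rect K)"
proof (rule test_functionI)
  define e where "e = 1 / real n"
  let ?C = "closed_rect (Rect (xl K + e) (xr K - e) (yl K + e) (yr K - e))"
  have e: "0 < e" using \<open>n > 0\<close> by (simp add: e_def)
  show "Ck k (\<lambda>z. cutoff K n z * f z)" for k by (intro Ck_mult Ck_cutoff assms)
  show "compact ?C" by (rule compact_closed_rect)
  show "?C \<subseteq> open_rect K"
    unfolding open_rect_times closed_rect_times using e by (intro Sigma_mono) auto
  show "z \<in> ?C" if "cutoff K n z * f z \<noteq> 0" for z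
  proof -
    have pos: "t > e" if "flat_exp 0 (real n * t - 1) \<noteq> 0" for t
      using that \<open>n > 0\<close> by (simp add: e_def flat_exp_def field_simps split: if_splits)
    have "flat_exp 0 (real n * (fst z - xl K) - 1) \<noteq> 0" "flat_exp 0 (real n * (xr K - fst z) - 1) \<noteq> 0"
      "flat_exp 0 (real n * (snd z - yl K) - 1) \<noteq> 0" "flat_exp 0 (real n * (yr K - snd z) - 1) \<noteq> 0"
      using that by (auto simp: cutoff_def)
    from this[THEN pos] show ?thesis by (cases z) (auto simp: closed_rect_times)
  qed
qed

lemma cutoff_tendsto_1:
  assumes "z \<in> open_rect K"
  shows "(\<lambda>n. cutoff K n z) \<longlonglongrightarrow> 1"
proof -
  have *: "(\<lambda>n. flat_exp 0 (real n * d - 1)) \<longlonglongrightarrow> 1" if "d > 0" for d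
  proof (rule Lim_transform_eventually)
    show "(\<lambda>n. exp (- (1 / (real n * d - 1)))) \<longlonglongrightarrow> 1"
      using that by real_asymp
    have "\<forall>\<^sub>F n in sequentially. real n * d - 1 > 0"
      using that by real_asymp
    then show "\<forall>\<^sub>F n in sequentially. exp (- (1 / (real n * d - 1))) = flat_exp 0 (real n * d - 1)"
      by eventually_elim (auto simp: flat_exp_def)
  qed
  have "(\<lambda>n. cutoff K n z) \<longlonglongrightarrow> 1 * 1 * (1 * 1)"
    unfolding cutoff_def using assms
    by (intro tendsto_mult *) (auto simp: open_rect_times)
  then show ?thesis by simp
qed

text \<open>The quadratic Taylor bound of the exponential gives t^2 exp (1/t) \<ge> t^2 + t + 1/2,
  which is at least (t + 1) / 2. In the application t = n d - 1, so that t + 1 is the product of the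
  derivative factor n and the distance d.\<close>

lemma flat_exp_2_bound: "\<bar>t + 1\<bar> * flat_exp 2 t \<le> 2 \<or> t < -1"
proof (cases "t > 0")
  case True
  have "1 + 1 / t + (1 / t)\<^sup>2 / 2 \<le> exp (1 / t)"
    using True by (intro exp_lower_Taylor_quadratic) simp
  then have "(1 + 1 / t + (1 / t)\<^sup>2 / 2) * t\<^sup>2 \<le> exp (1 / t) * t\<^sup>2"
    by (rule mult_right_mono) simp
  moreover have "(1 + 1 / t + (1 / t)\<^sup>2 / 2) * t\<^sup>2 = t\<^sup>2 + t + 1 / 2"
    using True by (simp add: field_simps power2_eq_square)
  moreover have "0 \<le> t\<^sup>2" by simp
  ultimately have "t + 1 \<le> 2 * (exp (1 / t) * t\<^sup>2)" using True by linarith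
  then have "(t + 1) / (exp (1 / t) * t\<^sup>2) \<le> 2"
    using True by (simp add: pos_divide_le_eq)
  then show ?thesis using True by (simp add: flat_exp_def exp_minus field_simps)
qed (auto simp: flat_exp_def)

text \<open>A bound on \<open>f\<close> that is linear in the distance d absorbs the factor n,
  uniformly in n.\<close>

lemma cutoff_derivative_factor:
  assumes "d > 0" "\<bar>f\<bar> \<le> B * d"
  shows "\<bar>real n * flat_exp 2 (real n * d - 1) * f\<bar> \<le> 2 * B"
proof -
  have "\<bar>real n * d - 1 + 1\<bar> * flat_exp 2 (real n * d - 1) \<le> 2"
    using flat_exp_2_bound[of "real n * d - 1"] assms(1) by (auto simp: mult_less_0_iff)
  then have "real n * d * flat_exp 2 (real n * d - 1) \<le> 2"
    using assms(1) by (simp add: abs_mult)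
  moreover have "0 \<le> B * d" using assms(2) abs_ge_zero[of f] by linarith
  then have "0 \<le> B" using assms(1) by (simp add: zero_le_mult_iff)
  ultimately have *: "B * (real n * d * flat_exp 2 (real n * d - 1)) \<le> B * 2"
    by (intro mult_left_mono)
  have "\<bar>real n * flat_exp 2 (real n * d - 1) * f\<bar> \<le> real n * flat_exp 2 (real n * d - 1) * (B * d)"
    using assms flat_exp_0_bounds(1)[of 2] by (auto simp: abs_mult intro!: mult_left_mono)
  also have "\<dots> \<le> 2 * B" using * by (simp add: algebra_simps)
  finally show ?thesis .
qed

text \<open>At a fixed distance d the factor decays like 1 / (n d^2); only near the boundary is it
  large.\<close>

lemma cutoff_derivative_factor_tendsto:
  assumes "d > 0"
  shows "(\<lambda>n. real n * flat_exp 2 (real n * d - 1)) \<longlonglongrightarrow> 0"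
proof (rule Lim_transform_eventually)
  show "(\<lambda>n. real n * (exp (- (1 / (real n * d - 1))) / (real n * d - 1)\<^sup>2)) \<longlonglongrightarrow> 0"
    using assms by real_asymp
  have "\<forall>\<^sub>F n in sequentially. real n * d - 1 > 0"
    using assms by real_asymp
  then show "\<forall>\<^sub>F n in sequentially. real n * (exp (- (1 / (real n * d - 1))) / (real n * d - 1)\<^sup>2)
      = real n * flat_exp 2 (real n * d - 1)"
    by eventually_elim (auto simp: flat_exp_def)
qed

lemma dx_dy_times:
  assumes "\<And>x. (X has_real_derivative X' x) (at x)" "\<And>y. (Y has_real_derivative Y' y) (at y)"
  shows "dx (\<lambda>z. X (fst z) * Y (snd z)) z = X' (fst z) * Y (snd z)" (is ?x)
    and "dy (\<lambda>z. X (fst z) * Y (snd z)) z = X (fst z) * Y' (snd z)" (is ?y)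
proof -
  have "((\<lambda>z. X (fst z)) has_derivative (\<lambda>h. X' (fst z) * (fst h))) (at z)"
    "((\<lambda>z. Y (snd z)) has_derivative (\<lambda>h. Y' (snd z) * (snd h))) (at z)"
    using has_derivative_compose_affine[of X "X' (fst z)" 1 z 0 0]
      has_derivative_compose_affine[of Y "Y' (snd z)" 0 z 1 0] assms by simp_all
  from has_derivative_mult[OF this] show ?x ?y
    by (auto simp: dx_eq dy_eq)
qed

lemma dx_cutoff:
  "dx (cutoff K n) z =
    (real n * flat_exp 2 (real n * (fst z - xl K) - 1) * flat_exp 0 (real n * (xr K - fst z) - 1)
     - flat_exp 0 (real n * (fst z - xl K) - 1) * (real n * flat_exp 2 (real n * (xr K - fst z) - 1))) *
    (flat_exp 0 (real n * (snd z - yl K) - 1) * flat_exp 0 (real n * (yr K - snd z) - 1))" (is ?x)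
  and dy_cutoff:
  "dy (cutoff K n) z =
    flat_exp 0 (real n * (fst z - xl K) - 1) * flat_exp 0 (real n * (xr K - fst z) - 1) *
    (real n * flat_exp 2 (real n * (snd z - yl K) - 1) * flat_exp 0 (real n * (yr K - snd z) - 1)
     - flat_exp 0 (real n * (snd z - yl K) - 1) * (real n * flat_exp 2 (real n * (yr K - snd z) - 1)))" (is ?y)
proof -
  have d: "(flat_exp 0 has_real_derivative flat_exp 2 t) (at t)" for t
    using DERIV_flat_exp[of 0 t] by (simp add: numeral_2_eq_2)
  have d1: "((\<lambda>x. flat_exp 0 (real n * (x - p) - 1)) has_real_derivative
      real n * flat_exp 2 (real n * (x - p) - 1)) (at x)" for x p
  proof -
    have "((\<lambda>x. real n * (x - p) - 1) has_real_derivative real n) (at x)"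
      by (auto intro!: derivative_eq_intros)
    from DERIV_chain2[OF d this] show ?thesis by (simp add: mult.commute)
  qed
  have d2: "((\<lambda>x. flat_exp 0 (real n * (p - x) - 1)) has_real_derivative
      - (real n * flat_exp 2 (real n * (p - x) - 1))) (at x)" for x p
  proof -
    have "((\<lambda>x. real n * (p - x) - 1) has_real_derivative - real n) (at x)"
      by (auto intro!: derivative_eq_intros)
    from DERIV_chain2[OF d this] show ?thesis by (simp add: mult.commute)
  qed
  note prod = dx_dy_times[OF DERIV_mult[OF d1[where p="xl K"] d2[where p="xr K"]]
     DERIV_mult[OF d1[where p="yl K"] d2[where p="yr K"]], of z]
  show ?x ?y
    using prod unfolding cutoff_def[abs_def] by (simp_all only:) (simp_all add: algebra_simps)
qed

section \<open>Weak derivatives\<close>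

lemma integral_mult_cutoff_tendsto:
  assumes g: "integrable (lebesgue_on (open_rect K)) g"
  shows "(\<lambda>n. LINT z|lebesgue_on (open_rect K). g z * cutoff K n z)
    \<longlonglongrightarrow> (LINT z|lebesgue_on (open_rect K). g z)"
proof (rule integral_dominated_convergence[where w = "\<lambda>z. \<bar>g z\<bar>"])
  show "AE z in lebesgue_on (open_rect K). (\<lambda>n. g z * cutoff K n z) \<longlonglongrightarrow> g z"
  proof (rule AE_I2)
    fix z assume "z \<in> space (lebesgue_on (open_rect K))"
    then have "(\<lambda>n. g z * cutoff K n z) \<longlonglongrightarrow> g z * 1" by (intro tendsto_intros cutoff_tendsto_1) simp
    then show "(\<lambda>n. g z * cutoff K n z) \<longlonglongrightarrow> g z" by simp
  qed
  have "cutoff K n \<in> borel_measurable (lebesgue_on (open_rect K))" for n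
    using continuous_L2[of K "cutoff K n"] continuous_on_subset[OF Ck_continuous[OF Ck_cutoff[of 0]]]
    by (auto simp: L2_def)
  then show "(\<lambda>z. g z * cutoff K n z) \<in> borel_measurable (lebesgue_on (open_rect K))" for n
    using g by auto
  show "AE z in lebesgue_on (open_rect K). norm (g z * cutoff K n z) \<le> \<bar>g z\<bar>" for n
    using cutoff_bounds[of K n] by (intro AE_I2) (simp add: abs_mult mult_left_le)
qed (use g in auto)

lemma function_ring_on_smooth: "function_ring_on {P. \<forall>k. Ck k P} (closed_rect K)"
proof
  show "\<exists>f\<in>{P. \<forall>k. Ck k P}. f z \<noteq> f w" if "z \<noteq> w" for z w :: point
  proof (cases "fst z = fst w")
    case True
    then show ?thesis using that Ck_affine[of _ 0 1 0]
      by (intro bexI[of _ "\<lambda>z. 0 * fst z + 1 * snd z + 0"]) (auto simp: prod_eq_iff)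
  next
    case False
    then show ?thesis using that Ck_affine[of _ 1 0 0]
      by (intro bexI[of _ "\<lambda>z. 1 * fst z + 0 * snd z + 0"]) (auto simp: prod_eq_iff)
  qed
qed (auto simp: compact_closed_rect Ck_add Ck_mult
    intro: continuous_on_subset[OF Ck_continuous[of 0]] simp del: Ck.simps)

text \<open>Stone-Weierstrass needs an algebra with constants, and test functions have none. All
  smooth functions form one, and orthogonality to them follows by multiplying with the cutoffs and
  passing to the limit.\<close>

lemma AE_zero_if_orthogonal_test_functions:
  assumes g: "integrable (lebesgue_on (open_rect K)) g"
    and orth: "\<And>\<psi>. \<psi> \<in> test_functions (open_rect K) \<Longrightarrow> (LINT z|lebesgue_on (open_rect K). g z * \<psi> z) = 0"
  shows "AE z in lebesgue_on (open_rect K). g z = 0"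
proof (rule AE_zero_if_orthogonal_function_ring[OF function_ring_on_smooth _ open_rect_subset g])
  fix P assume P: "P \<in> {P. \<forall>k. Ck k P}"
  then have cP: "continuous_on (closed_rect K) P"
    by (auto intro: continuous_on_subset[OF Ck_continuous[of 0]] simp del: Ck.simps)
  from integral_mult_cutoff_tendsto[OF integrable_mult_continuous[OF g cP]]
  have lim: "(\<lambda>n. LINT z|lebesgue_on (open_rect K). g z * (cutoff K n z * P z))
      \<longlonglongrightarrow> (LINT z|lebesgue_on (open_rect K). g z * P z)"
    by (simp add: mult.assoc mult.commute[of "P _"])
  have ev: "\<forall>\<^sub>F n in sequentially. (LINT z|lebesgue_on (open_rect K). g z * (cutoff K n z * P z)) = 0"
    using eventually_gt_at_top[of 0]
    by eventually_elim (use P in \<open>auto intro!: orth cutoff_mult_test_function simp del: Ck.simps\<close>)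
  show "(LINT z|lebesgue_on (open_rect K). g z * P z) = 0"
    by (rule LIMSEQ_unique[OF lim tendsto_eventually[OF ev]])
qed simp

lemma integrable_mult_test_function:
  "g \<in> L2 (open_rect K) \<Longrightarrow> \<psi> \<in> test_functions (open_rect K) \<Longrightarrow>
    integrable (lebesgue_on (open_rect K)) (\<lambda>z. g z * \<psi> z)"
  using Ck_continuous[OF test_function_Ck[of \<psi> "open_rect K" 0]]
  by (intro L2_integrable_mult[OF _ continuous_L2]) (auto intro: continuous_on_subset)

lemma has_weak_deriv_unique:
  assumes "g1 \<in> L2 (open_rect K)" "g2 \<in> L2 (open_rect K)"
    and "has_weak_deriv (open_rect K) i j f g1" "has_weak_deriv (open_rect K) i j f g2"
  shows "AE z in lebesgue_on (open_rect K). g1 z = g2 z"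
proof -
  have "AE z in lebesgue_on (open_rect K). g1 z - g2 z = 0"
  proof (rule AE_zero_if_orthogonal_test_functions)
    show "integrable (lebesgue_on (open_rect K)) (\<lambda>z. g1 z - g2 z)"
      using assms by (intro L2_integrable L2_diff)
    fix \<psi> assume \<psi>: "\<psi> \<in> test_functions (open_rect K)"
    have "(- 1) ^ (i + j) * (LINT z|lebesgue_on (open_rect K). g1 z * \<psi> z)
        = (- 1) ^ (i + j) * (LINT z|lebesgue_on (open_rect K). g2 z * \<psi> z)"
      using bspec[OF assms(3)[unfolded has_weak_deriv_def] \<psi>] bspec[OF assms(4)[unfolded has_weak_deriv_def] \<psi>]
      by (simp only:)
    then have "(LINT z|lebesgue_on (open_rect K). g1 z * \<psi> z) = (LINT z|lebesgue_on (open_rect K). g2 z * \<psi> z)"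
      by simp
    then show "(LINT z|lebesgue_on (open_rect K). (g1 z - g2 z) * \<psi> z) = 0"
      using integrable_mult_test_function[OF assms(1) \<psi>] integrable_mult_test_function[OF assms(2) \<psi>]
      by (simp add: left_diff_distrib)
  qed
  then show ?thesis by simp
qed

lemma weak_deriv_works:
  assumes "g \<in> L2 S" "has_weak_deriv S i j f g"
  shows "weak_deriv S i j f \<in> L2 S" "has_weak_deriv S i j f (weak_deriv S i j f)"
  using someI[of "\<lambda>g. g \<in> L2 S \<and> has_weak_deriv S i j f g", OF conjI[OF assms]]
  by (simp_all add: weak_deriv_def)

lemma weak_deriv_AE_eq:
  assumes "g \<in> L2 (open_rect K)" "has_weak_deriv (open_rect K) i j f g"
  shows "AE z in lebesgue_on (open_rect K). weak_deriv (open_rect K) i j f z = g z"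
  by (rule has_weak_deriv_unique[OF weak_deriv_works(1)[OF assms] assms(1) weak_deriv_works(2)[OF assms] assms(2)])

lemma integral_by_parts:
  assumes K: "nondegenerate K" and f: "Ck (Suc 0) f" and g: "Ck (Suc 0) g"
    and zero: "\<And>z. z \<notin> open_rect K \<Longrightarrow> g z = 0"
  shows "(LINT z|lebesgue_on (open_rect K). f z * dx g z) = - (LINT z|lebesgue_on (open_rect K). dx f z * g z)" (is ?x)
    and "(LINT z|lebesgue_on (open_rect K). f z * dy g z) = - (LINT z|lebesgue_on (open_rect K). dy f z * g z)" (is ?y)
proof -
  have c: "continuous_on A f" "continuous_on A g" "continuous_on A (dx f)" "continuous_on A (dx g)"
    "continuous_on A (dy f)" "continuous_on A (dy g)" for A
    using f g Ck_continuous[OF f] Ck_continuous[OF g] by (auto intro: continuous_on_subset)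
  have fg: "Ck (Suc 0) (\<lambda>z. f z * g z)" using f g by (rule Ck_mult)
  have i: "integrable (lebesgue_on (open_rect K)) (\<lambda>z. f z * dx g z)"
    "integrable (lebesgue_on (open_rect K)) (\<lambda>z. dx f z * g z)"
    "integrable (lebesgue_on (open_rect K)) (\<lambda>z. f z * dy g z)"
    "integrable (lebesgue_on (open_rect K)) (\<lambda>z. dy f z * g z)"
    by (intro integrable_open_rect continuous_intros c)+
  have z: "integral (closed_rect K) (dx (\<lambda>z. f z * g z)) = 0"
    "integral (closed_rect K) (dy (\<lambda>z. f z * g z)) = 0"
    using integral_dx_dy_zero[OF K fg] zero by auto
  have eq: "dx (\<lambda>z. f z * g z) = (\<lambda>z. f z * dx g z + dx f z * g z)"
    "dy (\<lambda>z. f z * g z) = (\<lambda>z. f z * dy g z + dy f z * g z)"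
    using Ck_differentiable[OF f] Ck_differentiable[OF g] by (simp_all add: fun_eq_iff dx_mult dy_mult del: split_paired_All)
  show ?x ?y
    using integral_open_rect[of K "\<lambda>z. f z * dx g z + dx f z * g z"]
      integral_open_rect[of K "\<lambda>z. f z * dy g z + dy f z * g z"] i z unfolding eq by auto
qed

lemma has_weak_deriv_test_function:
  assumes K: "nondegenerate K" and \<psi>: "\<psi> \<in> test_functions (open_rect K)"
  shows "has_weak_deriv (open_rect K) 1 0 \<psi> (dx \<psi>)" "has_weak_deriv (open_rect K) 0 1 \<psi> (dy \<psi>)"
    "dx \<psi> \<in> L2 (open_rect K)" "dy \<psi> \<in> L2 (open_rect K)" "\<psi> \<in> L2 (open_rect K)"
proof -
  have C: "Ck (Suc 0) \<psi>" by (rule test_function_Ck[OF \<psi>])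
  have parts: "(LINT z|lebesgue_on (open_rect K). \<psi> z * dx \<phi> z) = - (LINT z|lebesgue_on (open_rect K). dx \<psi> z * \<phi> z)"
    "(LINT z|lebesgue_on (open_rect K). \<psi> z * dy \<phi> z) = - (LINT z|lebesgue_on (open_rect K). dy \<psi> z * \<phi> z)"
    if "\<phi> \<in> test_functions (open_rect K)" for \<phi>
    using integral_by_parts[OF K C test_function_Ck[OF that] test_function_zero[OF that]] by blast+
  show "has_weak_deriv (open_rect K) 1 0 \<psi> (dx \<psi>)" "has_weak_deriv (open_rect K) 0 1 \<psi> (dy \<psi>)"
    unfolding has_weak_deriv_def using parts by simp_all
  show "dx \<psi> \<in> L2 (open_rect K)" "dy \<psi> \<in> L2 (open_rect K)" "\<psi> \<in> L2 (open_rect K)"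
    using C Ck_continuous[OF C] by (auto intro!: continuous_L2 intro: continuous_on_subset)
qed

lemma has_weak_deriv_diff:
  assumes "nondegenerate K" "f \<in> L2 (open_rect K)" "f' \<in> L2 (open_rect K)" "g \<in> L2 (open_rect K)" "g' \<in> L2 (open_rect K)"
    "has_weak_deriv (open_rect K) i j f f'" "has_weak_deriv (open_rect K) i j g g'" "i + j = 1"
  shows "has_weak_deriv (open_rect K) i j (\<lambda>z. f z - g z) (\<lambda>z. f' z - g' z)"
  unfolding has_weak_deriv_def
proof
  fix \<psi> assume \<psi>: "\<psi> \<in> test_functions (open_rect K)"
  have ij: "i = 1 \<and> j = 0 \<or> i = 0 \<and> j = 1" using \<open>i + j = 1\<close> by auto
  let ?D = "(dx ^^ i) ((dy ^^ j) \<psi>)"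
  have D: "?D \<in> L2 (open_rect K)" using ij has_weak_deriv_test_function[OF assms(1) \<psi>] by auto
  note int = L2_integrable_mult[OF assms(2) D] L2_integrable_mult[OF assms(4) D]
    integrable_mult_test_function[OF assms(3) \<psi>] integrable_mult_test_function[OF assms(5) \<psi>]
  show "(LINT z|lebesgue_on (open_rect K). (f z - g z) * ?D z)
      = (- 1) ^ (i + j) * (LINT z|lebesgue_on (open_rect K). (f' z - g' z) * \<psi> z)"
    using int assms(6,7) \<psi> unfolding has_weak_deriv_def
    by (simp add: left_diff_distrib right_diff_distrib)
qed

text \<open>Even for the zero function the weak gradient is a chosen representative, so it vanishes
  only almost everywhere.\<close>

lemma H1_norm_zero: 
  assumes K: "nondegenerate K"
  shows "H1_norm (open_rect K) (\<lambda>z. 0) = 0"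
proof -
  have t: "(\<lambda>z. 0) \<in> test_functions (open_rect K)" by (simp add: test_functions_def)
  note w = has_weak_deriv_test_function[OF K t]
  have "AE z in lebesgue_on (open_rect K). (norm (weak_grad (open_rect K) (\<lambda>z. 0) z))\<^sup>2 = 0"
    using weak_deriv_AE_eq[OF w(3,1)] weak_deriv_AE_eq[OF w(4,2)]
    by eventually_elim (simp add: weak_grad_def)
  then have "(LINT z|lebesgue_on (open_rect K). (norm (weak_grad (open_rect K) (\<lambda>z. 0) z))\<^sup>2) = 0"
    by (rule integral_eq_zero_AE)
  then show ?thesis by (simp add: H1_norm_def)
qed

lemma test_function_H10:
  assumes K: "nondegenerate K" and \<psi>: "\<psi> \<in> test_functions (open_rect K)"
  shows "\<psi> \<in> H10 (open_rect K)"
proof -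
  note w = has_weak_deriv_test_function[OF K \<psi>]
  have "\<exists>g\<in>L2 (open_rect K). has_weak_deriv (open_rect K) i j \<psi> g" if "i + j \<le> 1" for i j
  proof -
    have "i = 0 \<and> j = 0 \<or> i = 1 \<and> j = 0 \<or> i = 0 \<and> j = 1" using that by arith
    moreover have "has_weak_deriv (open_rect K) 0 0 \<psi> \<psi>" by (simp add: has_weak_deriv_def)
    ultimately show ?thesis using w by blast
  qed
  then show ?thesis
    unfolding H10_def Hk_def using w(5) \<psi> H1_norm_zero[OF K] by (auto intro!: exI[of _ "\<lambda>n. \<psi>"])
qed

lemma abs_integral_mult_L2_le:
  assumes "f \<in> L2 S" "g \<in> L2 S"
  shows "\<bar>LINT z|lebesgue_on S. f z * g z\<bar>
    \<le> sqrt (LINT z|lebesgue_on S. (f z)\<^sup>2) * sqrt (LINT z|lebesgue_on S. (g z)\<^sup>2)"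
proof -
  have "(LINT z|lebesgue_on S. f z * g z)\<^sup>2 \<le> (LINT z|lebesgue_on S. (f z)\<^sup>2) * (LINT z|lebesgue_on S. (g z)\<^sup>2)"
    using assms by (intro integral_Cauchy_Schwarz) (auto simp: L2_def)
  from real_sqrt_le_mono[OF this] show ?thesis
    by (simp add: real_sqrt_mult)
qed

lemma integral_mult_tendsto_zero:
  assumes g: "\<And>n. g n \<in> L2 S" and f: "f \<in> L2 S"
    and lim: "X \<longlonglongrightarrow> 0" and le: "\<And>n. (LINT z|lebesgue_on S. (g n z)\<^sup>2) \<le> (X n)\<^sup>2"
  shows "(\<lambda>n::nat. LINT z|lebesgue_on S. g n z * f z) \<longlonglongrightarrow> 0"
proof (rule Lim_null_comparison)
  have "norm (LINT z|lebesgue_on S. g n z * f z) \<le> \<bar>X n\<bar> * sqrt (LINT z|lebesgue_on S. (f z)\<^sup>2)" for n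
  proof -
    have "sqrt (LINT z|lebesgue_on S. (g n z)\<^sup>2) \<le> \<bar>X n\<bar>"
      using real_sqrt_le_mono[OF le[of n]] by simp
    then have "sqrt (LINT z|lebesgue_on S. (g n z)\<^sup>2) * sqrt (LINT z|lebesgue_on S. (f z)\<^sup>2)
        \<le> \<bar>X n\<bar> * sqrt (LINT z|lebesgue_on S. (f z)\<^sup>2)"
      by (rule mult_right_mono) simp
    then show ?thesis using abs_integral_mult_L2_le[OF g[of n] f] by simp
  qed
  then show "\<forall>\<^sub>F n in sequentially. norm (LINT z|lebesgue_on S. g n z * f z)
      \<le> \<bar>X n\<bar> * sqrt (LINT z|lebesgue_on S. (f z)\<^sup>2)" by (rule always_eventually[OF allI])
  have "(\<lambda>n. \<bar>X n\<bar> * sqrt (LINT z|lebesgue_on S. (f z)\<^sup>2)) \<longlonglongrightarrow> \<bar>0\<bar> * sqrt (LINT z|lebesgue_on S. (f z)\<^sup>2)"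
    by (intro tendsto_intros lim)
  then show "(\<lambda>n. \<bar>X n\<bar> * sqrt (LINT z|lebesgue_on S. (f z)\<^sup>2)) \<longlonglongrightarrow> 0" by simp
qed

text \<open>Here the boundary condition of \<open>u\<close> enters: \<open>f\<close> need not vanish on the boundary.\<close>

lemma H10_integral_by_parts:
  assumes K: "nondegenerate K" and u: "u \<in> H10 (open_rect K)" and f: "Ck (Suc 0) f"
  shows "(LINT z|lebesgue_on (open_rect K). weak_deriv (open_rect K) 1 0 u z * f z)
      = - (LINT z|lebesgue_on (open_rect K). u z * dx f z)"
    and "(LINT z|lebesgue_on (open_rect K). weak_deriv (open_rect K) 0 1 u z * f z)
      = - (LINT z|lebesgue_on (open_rect K). u z * dy f z)"
    and "weak_deriv (open_rect K) 1 0 u \<in> L2 (open_rect K)"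
    and "weak_deriv (open_rect K) 0 1 u \<in> L2 (open_rect K)"
proof -
  let ?S = "open_rect K"
  let ?M = "lebesgue_on ?S"
  obtain \<phi> where \<phi>: "\<And>n::nat. \<phi> n \<in> test_functions ?S"
    and lim: "(\<lambda>n. H1_norm ?S (\<lambda>z. u z - \<phi> n z)) \<longlonglongrightarrow> 0"
    and uL: "u \<in> L2 ?S" and uH: "u \<in> Hk 1 ?S"
    using u by (auto simp: H10_def Hk_def)
  have ex: "\<exists>g\<in>L2 ?S. has_weak_deriv ?S i j u g" if "i + j = 1" for i j
    using uH that by (auto simp: Hk_def)
  have w: "weak_deriv ?S i j u \<in> L2 ?S" "has_weak_deriv ?S i j u (weak_deriv ?S i j u)" if "i + j = 1" for i j
    using ex[OF that] weak_deriv_works by blast+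
  show w1: "weak_deriv ?S 1 0 u \<in> L2 ?S" and w2: "weak_deriv ?S 0 1 u \<in> L2 ?S"
    using w by simp_all
  have fL: "f \<in> L2 ?S" "dx f \<in> L2 ?S" "dy f \<in> L2 ?S"
    using f Ck_continuous[OF f] by (auto intro!: continuous_L2 intro: continuous_on_subset)
  note t = has_weak_deriv_test_function[OF K \<phi>]
  define H where "H n = H1_norm ?S (\<lambda>z. u z - \<phi> n z)" for n
  define D1 where "D1 n = weak_deriv ?S 1 0 (\<lambda>z. u z - \<phi> n z)" for n
  define D2 where "D2 n = weak_deriv ?S 0 1 (\<lambda>z. u z - \<phi> n z)" for n
  have d1: "has_weak_deriv ?S 1 0 (\<lambda>z. u z - \<phi> n z) (\<lambda>z. weak_deriv ?S 1 0 u z - dx (\<phi> n) z)"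
    and d2: "has_weak_deriv ?S 0 1 (\<lambda>z. u z - \<phi> n z) (\<lambda>z. weak_deriv ?S 0 1 u z - dy (\<phi> n) z)" for n
    by (rule has_weak_deriv_diff[OF K uL w(1) t(5) t(3) w(2) t(1)]
        has_weak_deriv_diff[OF K uL w(1) t(5) t(4) w(2) t(2)]; simp)+
  have e1: "AE z in ?M. D1 n z = weak_deriv ?S 1 0 u z - dx (\<phi> n) z"
    and e2: "AE z in ?M. D2 n z = weak_deriv ?S 0 1 u z - dy (\<phi> n) z"
    and DL: "D1 n \<in> L2 ?S" "D2 n \<in> L2 ?S" for n
    unfolding D1_def D2_def
    using weak_deriv_AE_eq[OF L2_diff[OF w1 t(3)] d1] weak_deriv_AE_eq[OF L2_diff[OF w2 t(4)] d2]
      weak_deriv_works(1)[OF L2_diff[OF w1 t(3)] d1] weak_deriv_works(1)[OF L2_diff[OF w2 t(4)] d2]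
    by auto
  have Hsq: "(H n)\<^sup>2 = (LINT z|?M. (u z - \<phi> n z)\<^sup>2) + ((LINT z|?M. (D1 n z)\<^sup>2) + (LINT z|?M. (D2 n z)\<^sup>2))" for n
  proof -
    have "(LINT z|?M. (norm (weak_grad ?S (\<lambda>z. u z - \<phi> n z) z))\<^sup>2) = (LINT z|?M. (D1 n z)\<^sup>2 + (D2 n z)\<^sup>2)"
      by (simp add: weak_grad_def D1_def D2_def norm_Pair)
    also have "\<dots> = (LINT z|?M. (D1 n z)\<^sup>2) + (LINT z|?M. (D2 n z)\<^sup>2)"
      using DL[of n] by (auto simp: L2_def)
    finally show ?thesis unfolding H_def H1_norm_def by simp
  qed
  have nn: "0 \<le> (LINT z|?M. (u z - \<phi> n z)\<^sup>2)" "0 \<le> (LINT z|?M. (D1 n z)\<^sup>2)" "0 \<le> (LINT z|?M. (D2 n z)\<^sup>2)" for n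
    by simp_all
  have le: "(LINT z|?M. (u z - \<phi> n z)\<^sup>2) \<le> (H n)\<^sup>2" "(LINT z|?M. (D1 n z)\<^sup>2) \<le> (H n)\<^sup>2"
     "(LINT z|?M. (D2 n z)\<^sup>2) \<le> (H n)\<^sup>2" for n
    using nn[of n] Hsq[of n] by linarith+
  have Hlim: "H \<longlonglongrightarrow> 0" using lim by (simp add: H_def[abs_def])
  \<comment> \<open>\<open>W\<close> and \<open>E n\<close> are derivatives of \<open>u\<close> and
    of the approximation \<open>\<phi> n\<close>, and \<open>D n\<close> is that of their
    difference. The sum of the pairings of \<open>D n\<close> with \<open>f\<close> and of
    \<open>u - \<phi> n\<close> with \<open>f'\<close> tends to 0; it does not depend on n, since
    the terms with \<open>\<phi> n\<close> cancel by the classical formula.\<close>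
  have parts: "(LINT z|?M. W z * f z) = - (LINT z|?M. u z * f' z)"
    if W: "W \<in> L2 ?S" and D: "\<And>n. D n \<in> L2 ?S" and E: "\<And>n. E n \<in> L2 ?S" and f': "f' \<in> L2 ?S"
      and le_H: "\<And>n. (LINT z|?M. (D n z)\<^sup>2) \<le> (H n)\<^sup>2" and eq: "\<And>n. AE z in ?M. D n z = W z - E n z"
      and test: "\<And>n. (LINT z|?M. f z * E n z) = - (LINT z|?M. f' z * \<phi> n z)"
    for W f' :: field and D E :: "nat \<Rightarrow> field"
  proof -
    have "(\<lambda>n. (LINT z|?M. D n z * f z) + (LINT z|?M. (u z - \<phi> n z) * f' z)) \<longlonglongrightarrow> 0 + 0"
      by (intro tendsto_add integral_mult_tendsto_zero[OF D fL(1) Hlim le_H]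
          integral_mult_tendsto_zero[OF L2_diff[OF uL t(5)] f' Hlim le(1)])
    moreover have "(LINT z|?M. D n z * f z) + (LINT z|?M. (u z - \<phi> n z) * f' z)
        = (LINT z|?M. W z * f z) + (LINT z|?M. u z * f' z)" for n
    proof -
      have "(LINT z|?M. D n z * f z) = (LINT z|?M. (W z - E n z) * f z)"
        by (rule integral_cong_AE) (use D[of n] fL W E[of n] eq[of n] in \<open>auto simp: L2_def\<close>)
      also have "\<dots> = (LINT z|?M. W z * f z) - (LINT z|?M. E n z * f z)"
        using L2_integrable_mult[OF W fL(1)] L2_integrable_mult[OF E fL(1)] by (simp add: left_diff_distrib)
      also have "(LINT z|?M. E n z * f z) = - (LINT z|?M. \<phi> n z * f' z)"
        using test[of n] by (simp add: mult.commute)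
      finally show ?thesis
        using L2_integrable_mult[OF uL f'] L2_integrable_mult[OF t(5) f'] by (simp add: left_diff_distrib)
    qed
    ultimately have "(\<lambda>n::nat. (LINT z|?M. W z * f z) + (LINT z|?M. u z * f' z)) \<longlonglongrightarrow> 0"
      by simp
    from LIMSEQ_unique[OF tendsto_const this] show ?thesis by simp
  qed
  show "(LINT z|?M. weak_deriv ?S 1 0 u z * f z) = - (LINT z|?M. u z * dx f z)"
    by (rule parts[OF w1 DL(1) t(3) fL(2) le(2) e1
          integral_by_parts(1)[OF K f test_function_Ck[OF \<phi>] test_function_zero[OF \<phi>]]])
  show "(LINT z|?M. weak_deriv ?S 0 1 u z * f z) = - (LINT z|?M. u z * dy f z)"
    by (rule parts[OF w2 DL(2) t(4) fL(3) le(3) e2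
          integral_by_parts(2)[OF K f test_function_Ck[OF \<phi>] test_function_zero[OF \<phi>]]])
qed

text \<open>A Lipschitz form of the boundary condition, stated for each side separately because each
  factor of the cutoff depends on the distance to one side.\<close>

definition vanishes_linearly :: "rect \<Rightarrow> real \<Rightarrow> field \<Rightarrow> bool" where
  "vanishes_linearly K B f \<longleftrightarrow> (\<forall>z\<in>open_rect K.
     \<bar>f z\<bar> \<le> B * (fst z - xl K) \<and> \<bar>f z\<bar> \<le> B * (xr K - fst z) \<and>
     \<bar>f z\<bar> \<le> B * (snd z - yl K) \<and> \<bar>f z\<bar> \<le> B * (yr K - snd z))"

lemma dx_cutoff_mult_bound:
  assumes "vanishes_linearly K B f" "z \<in> open_rect K"
  shows "\<bar>dx (cutoff K n) z * f z\<bar> \<le> 4 * B" "\<bar>dy (cutoff K n) z * f z\<bar> \<le> 4 * B"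
proof -
  \<comment> \<open>The product rule leaves two summands. Each has one differentiated factor,
    bounded by 2 B after multiplication with \<open>f\<close>; the other factors lie in
    [0, 1].\<close>
  have bd: "\<bar>(a * p - q * b) * r * f z\<bar> \<le> 4 * B"
    if "\<bar>a * f z\<bar> \<le> 2 * B" "\<bar>b * f z\<bar> \<le> 2 * B" "0 \<le> p" "p \<le> 1" "0 \<le> q" "q \<le> 1" "0 \<le> r" "r \<le> 1" for a b p q r
  proof -
    have "\<bar>(a * f z) * p\<bar> \<le> 2 * B * 1" "\<bar>q * (b * f z)\<bar> \<le> 1 * (2 * B)"
      unfolding abs_mult[of "a * f z"] abs_mult[of q] using that by (intro mult_mono; simp)+
    then have "\<bar>(a * f z) * p - q * (b * f z)\<bar> \<le> 4 * B" by linarith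
    then have "\<bar>(a * f z) * p - q * (b * f z)\<bar> * r \<le> 4 * B * 1"
      using that by (intro mult_mono) auto
    moreover have "(a * p - q * b) * r * f z = ((a * f z) * p - q * (b * f z)) * r"
      by (simp add: algebra_simps)
    then have "\<bar>(a * p - q * b) * r * f z\<bar> = \<bar>(a * f z) * p - q * (b * f z)\<bar> * r"
      using that by (simp only: abs_mult abs_of_nonneg)
    ultimately show ?thesis by simp
  qed
  have r: "0 \<le> flat_exp 0 s * flat_exp 0 t" "flat_exp 0 s * flat_exp 0 t \<le> 1" for s t
    by (auto intro!: mult_nonneg_nonneg mult_le_one flat_exp_0_bounds)
  show "\<bar>dx (cutoff K n) z * f z\<bar> \<le> 4 * B" 
    unfolding dx_cutoff using assms
    by (intro bd cutoff_derivative_factor flat_exp_0_bounds r) (auto simp: vanishes_linearly_def open_rect_times)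
  have "\<bar>(real n * flat_exp 2 (real n * (snd z - yl K) - 1) * flat_exp 0 (real n * (yr K - snd z) - 1)
     - flat_exp 0 (real n * (snd z - yl K) - 1) * (real n * flat_exp 2 (real n * (yr K - snd z) - 1)))
     * (flat_exp 0 (real n * (fst z - xl K) - 1) * flat_exp 0 (real n * (xr K - fst z) - 1)) * f z\<bar> \<le> 4 * B"
    using assms
    by (intro bd cutoff_derivative_factor flat_exp_0_bounds r) (auto simp: vanishes_linearly_def open_rect_times)
  then show "\<bar>dy (cutoff K n) z * f z\<bar> \<le> 4 * B"
    unfolding dy_cutoff by (simp only: mult.commute)
qed

lemma dx_cutoff_tendsto_0:
  assumes "z \<in> open_rect K"
  shows "(\<lambda>n. dx (cutoff K n) z) \<longlonglongrightarrow> 0" "(\<lambda>n. dy (cutoff K n) z) \<longlonglongrightarrow> 0"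
proof -
  have b: "norm (flat_exp 0 t) \<le> 1" "norm (flat_exp 0 s * flat_exp 0 t) \<le> 1" for s t
    using flat_exp_0_bounds(1)[of 0] flat_exp_0_bounds(2) by (auto simp: abs_mult intro!: mult_le_one)
  have z0: "(\<lambda>n. a n * p n) \<longlonglongrightarrow> 0" "(\<lambda>n. p n * a n) \<longlonglongrightarrow> 0"
    if "a \<longlonglongrightarrow> 0" "\<And>n. norm (p n) \<le> 1" for a p :: "nat \<Rightarrow> real"
  proof -
    have "norm (a n * p n) \<le> \<bar>a n\<bar>" "norm (p n * a n) \<le> \<bar>a n\<bar>" for n
      using that(2)[of n] mult_left_mono[of "\<bar>p n\<bar>" 1 "\<bar>a n\<bar>"] by (simp_all add: abs_mult mult.commute)
    from this[THEN always_eventually[OF allI], THEN Lim_null_comparison, OF tendsto_rabs_zero[OF that(1)]]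
    show "(\<lambda>n. a n * p n) \<longlonglongrightarrow> 0" "(\<lambda>n. p n * a n) \<longlonglongrightarrow> 0" .
  qed
  have d: "0 < fst z - xl K" "0 < xr K - fst z" "0 < snd z - yl K" "0 < yr K - snd z"
    using assms by (auto simp: open_rect_times)
  note l = cutoff_derivative_factor_tendsto[OF d(1)] cutoff_derivative_factor_tendsto[OF d(2)]
    cutoff_derivative_factor_tendsto[OF d(3)] cutoff_derivative_factor_tendsto[OF d(4)]
  show "(\<lambda>n. dx (cutoff K n) z) \<longlonglongrightarrow> 0" unfolding dx_cutoff
    by (intro z0 b tendsto_diff[of _ 0 _ _ 0, simplified] l)
  show "(\<lambda>n. dy (cutoff K n) z) \<longlonglongrightarrow> 0" unfolding dy_cutoff
    by (intro z0 b tendsto_diff[of _ 0 _ _ 0, simplified] l)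
qed

text \<open>\<open>f\<close> vanishes on the boundary but not near it, so it is not a test function.
  Its products with the cutoffs are; their gradients are bounded uniformly in n and converge
  pointwise to that of \<open>f\<close>, so dominated convergence carries the weak equation
  over.\<close>

lemma weak_solution_tested:
  assumes K: "nondegenerate K" and u: "u \<in> H10 (open_rect K)" and g: "g \<in> L2 (open_rect K)"
    and weak: "\<And>v. v \<in> H10 (open_rect K) \<Longrightarrow>
      (LINT z|lebesgue_on (open_rect K). weak_grad (open_rect K) u z \<bullet> weak_grad (open_rect K) v z)
        = (LINT z|lebesgue_on (open_rect K). g z * v z)"
    and f: "\<And>k. Ck k f" and van: "vanishes_linearly K B f"
  shows "(LINT z|lebesgue_on (open_rect K). weak_deriv (open_rect K) 1 0 u z * dx f z)
      + (LINT z|lebesgue_on (open_rect K). weak_deriv (open_rect K) 0 1 u z * dy f z)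
    = (LINT z|lebesgue_on (open_rect K). g z * f z)"
proof -
  let ?S = "open_rect K"
  let ?M = "lebesgue_on ?S"
  \<comment> \<open>The shift to \<open>Suc n\<close> meets the positivity hypothesis of
    \<open>cutoff_mult_test_function\<close> for every index.\<close>
  define \<phi> where "\<phi> n z = cutoff K (Suc n) z * f z" for n z
  have \<phi>: "\<phi> n \<in> test_functions ?S" for n
    unfolding \<phi>_def[abs_def] by (rule cutoff_mult_test_function[OF f]) simp
  note t = has_weak_deriv_test_function[OF K \<phi>]
  note w = H10_integral_by_parts(3,4)[OF K u f]
  have fL: "f \<in> L2 ?S" "dx f \<in> L2 ?S" "dy f \<in> L2 ?S"
    using f[of "Suc 0"] Ck_continuous[OF f[of 0]] by (auto intro!: continuous_L2 intro: continuous_on_subset)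
  have c: "continuous_on (closed_rect K) (dx f)" "continuous_on (closed_rect K) (dy f)"
    using f[of "Suc 0"] by (auto intro: continuous_on_subset)
  obtain C1 where C1: "\<And>z. z \<in> closed_rect K \<Longrightarrow> \<bar>dx f z\<bar> \<le> C1" by (rule bounded_on_closed_rect[OF c(1)]) blast
  obtain C2 where C2: "\<And>z. z \<in> closed_rect K \<Longrightarrow> \<bar>dy f z\<bar> \<le> C2" by (rule bounded_on_closed_rect[OF c(2)]) blast
  have d\<phi>: "dx (\<phi> n) z = cutoff K (Suc n) z * dx f z + dx (cutoff K (Suc n)) z * f z"
    "dy (\<phi> n) z = cutoff K (Suc n) z * dy f z + dy (cutoff K (Suc n)) z * f z" for n z
    using Ck_differentiable[OF f] Ck_differentiable[OF Ck_cutoff]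
    by (simp_all add: \<phi>_def[abs_def] dx_mult dy_mult)
  have cut: "\<bar>cutoff K n z * y\<bar> \<le> \<bar>y\<bar>" for n z y
    using cutoff_bounds[of K n z] by (simp add: abs_mult mult_left_le_one_le)
  have bd: "\<bar>dx (\<phi> n) z\<bar> \<le> C1 + 4 * B" "\<bar>dy (\<phi> n) z\<bar> \<le> C2 + 4 * B" if "z \<in> ?S" for n z
  proof -
    have "z \<in> closed_rect K" using that open_rect_subset by blast
    then have "\<bar>dx f z\<bar> \<le> C1" "\<bar>dy f z\<bar> \<le> C2" using C1 C2 by auto
    then show "\<bar>dx (\<phi> n) z\<bar> \<le> C1 + 4 * B" "\<bar>dy (\<phi> n) z\<bar> \<le> C2 + 4 * B"
      using dx_cutoff_mult_bound[OF van that, of "Suc n"] cut[of "Suc n" z "dx f z"] cut[of "Suc n" z "dy f z"]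
      unfolding d\<phi> by linarith+
  qed
  have lim: "(\<lambda>n. dx (\<phi> n) z) \<longlonglongrightarrow> dx f z" "(\<lambda>n. dy (\<phi> n) z) \<longlonglongrightarrow> dy f z" if "z \<in> ?S" for z
  proof -
    have "(\<lambda>n. cutoff K n z * dx f z + dx (cutoff K n) z * f z) \<longlonglongrightarrow> 1 * dx f z + 0 * f z"
      "(\<lambda>n. cutoff K n z * dy f z + dy (cutoff K n) z * f z) \<longlonglongrightarrow> 1 * dy f z + 0 * f z"
      by (intro tendsto_intros cutoff_tendsto_1 dx_cutoff_tendsto_0 that)+
    from this[THEN LIMSEQ_Suc] show "(\<lambda>n. dx (\<phi> n) z) \<longlonglongrightarrow> dx f z" "(\<lambda>n. dy (\<phi> n) z) \<longlonglongrightarrow> dy f z"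
      unfolding d\<phi> by simp_all
  qed
  have conv: "(\<lambda>n. LINT z|?M. h z * D n z) \<longlonglongrightarrow> (LINT z|?M. h z * E z)"
    if h: "h \<in> L2 ?S" and D: "\<And>n. D n \<in> L2 ?S" and E: "E \<in> L2 ?S"
      and bdD: "\<And>n z. z \<in> ?S \<Longrightarrow> \<bar>D n z\<bar> \<le> C" and limD: "\<And>z. z \<in> ?S \<Longrightarrow> (\<lambda>n. D n z) \<longlonglongrightarrow> E z"
    for h E :: field and D :: "nat \<Rightarrow> field" and C
  proof (rule integral_dominated_convergence[where w = "\<lambda>z. C * \<bar>h z\<bar>"])
    show "AE z in ?M. (\<lambda>n. h z * D n z) \<longlonglongrightarrow> h z * E z"
      by (intro AE_I2 tendsto_intros limD) simp
    show "AE z in ?M. norm (h z * D n z) \<le> C * \<bar>h z\<bar>" for n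
    proof (rule AE_I2)
      fix z assume "z \<in> space ?M"
      then have "\<bar>D n z\<bar> * \<bar>h z\<bar> \<le> C * \<bar>h z\<bar>" using bdD by (intro mult_right_mono) auto
      then show "norm (h z * D n z) \<le> C * \<bar>h z\<bar>" by (simp add: abs_mult mult.commute)
    qed
    show "integrable ?M (\<lambda>z. C * \<bar>h z\<bar>)" using L2_integrable[OF h] by simp
  qed (use h D E in \<open>auto simp: L2_def intro!: borel_measurable_times\<close>)
  have "(\<lambda>n. (LINT z|?M. weak_deriv ?S 1 0 u z * dx (\<phi> n) z) + (LINT z|?M. weak_deriv ?S 0 1 u z * dy (\<phi> n) z))
    \<longlonglongrightarrow> (LINT z|?M. weak_deriv ?S 1 0 u z * dx f z) + (LINT z|?M. weak_deriv ?S 0 1 u z * dy f z)"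
    by (intro tendsto_add conv w t fL; fact bd lim)
  moreover have "(LINT z|?M. weak_deriv ?S 1 0 u z * dx (\<phi> n) z) + (LINT z|?M. weak_deriv ?S 0 1 u z * dy (\<phi> n) z)
      = (LINT z|?M. (g z * f z) * cutoff K (Suc n) z)" for n
  proof -
    have "(LINT z|?M. weak_deriv ?S 1 0 u z * dx (\<phi> n) z) + (LINT z|?M. weak_deriv ?S 0 1 u z * dy (\<phi> n) z)
      = (LINT z|?M. weak_deriv ?S 1 0 u z * dx (\<phi> n) z + weak_deriv ?S 0 1 u z * dy (\<phi> n) z)"
      using L2_integrable_mult[OF w(1) t(3)] L2_integrable_mult[OF w(2) t(4)] by simp
    also have "\<dots> = (LINT z|?M. weak_grad ?S u z \<bullet> weak_grad ?S (\<phi> n) z)"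
    proof (rule integral_cong_AE)
      show "AE z in ?M. weak_deriv ?S 1 0 u z * dx (\<phi> n) z + weak_deriv ?S 0 1 u z * dy (\<phi> n) z
          = weak_grad ?S u z \<bullet> weak_grad ?S (\<phi> n) z"
        using weak_deriv_AE_eq[OF t(3,1), of n] weak_deriv_AE_eq[OF t(4,2), of n]
        by eventually_elim (simp add: weak_grad_def)
      show "(\<lambda>z. weak_grad ?S u z \<bullet> weak_grad ?S (\<phi> n) z) \<in> borel_measurable ?M"
        unfolding weak_grad_def inner_Pair inner_real_def
        using w weak_deriv_works(1)[OF t(3,1), of n] weak_deriv_works(1)[OF t(4,2), of n] by (auto simp: L2_def)
      show "(\<lambda>z. weak_deriv ?S 1 0 u z * dx (\<phi> n) z + weak_deriv ?S 0 1 u z * dy (\<phi> n) z) \<in> borel_measurable ?M"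
        using w t(3,4)[of n] by (auto simp: L2_def)
    qed
    also have "\<dots> = (LINT z|?M. g z * \<phi> n z)" by (rule weak[OF test_function_H10[OF K \<phi>]])
    finally show ?thesis by (simp add: \<phi>_def algebra_simps)
  qed
  ultimately have "(\<lambda>n. LINT z|?M. (g z * f z) * cutoff K (Suc n) z)
    \<longlonglongrightarrow> (LINT z|?M. weak_deriv ?S 1 0 u z * dx f z) + (LINT z|?M. weak_deriv ?S 0 1 u z * dy f z)"
    by simp
  from LIMSEQ_unique[OF this LIMSEQ_Suc[OF integral_mult_cutoff_tendsto[OF L2_integrable_mult[OF g fL(1)]]]]
  show ?thesis .
qed

section \<open>Sine modes\<close>

definition sine_mode :: "rect \<Rightarrow> real \<Rightarrow> real \<Rightarrow> field" where
  "sine_mode K \<mu> \<nu> z = sin (\<mu> * (fst z - xl K)) * sin (\<nu> * (snd z - yl K))"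

lemma sine_mode_eq_affine: "sine_mode K \<mu> \<nu> =
    (\<lambda>z. sin (\<mu> * fst z + 0 * snd z + - \<mu> * xl K) * sin (0 * fst z + \<nu> * snd z + - \<nu> * yl K))"
  by (simp add: sine_mode_def fun_eq_iff algebra_simps)

lemma Ck_sine_mode: "Ck k (sine_mode K \<mu> \<nu>)"
  unfolding sine_mode_eq_affine by (intro Ck_mult Ck_sin_affine)

lemma continuous_sine_mode: "continuous_on A (sine_mode K \<mu> \<nu>)"
  unfolding sine_mode_def by (intro continuous_intros)

lemma dx_sine_mode:
  shows "dx (sine_mode K \<mu> \<nu>) = (\<lambda>z. \<mu> * cos (\<mu> * (fst z - xl K)) * sin (\<nu> * (snd z - yl K)))"
    and "dy (sine_mode K \<mu> \<nu>) = (\<lambda>z. sin (\<mu> * (fst z - xl K)) * (\<nu> * cos (\<nu> * (snd z - yl K))))"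
    and "dx (dx (sine_mode K \<mu> \<nu>)) = (\<lambda>z. - \<mu>\<^sup>2 * sine_mode K \<mu> \<nu> z)"
    and "dy (dy (sine_mode K \<mu> \<nu>)) = (\<lambda>z. - \<nu>\<^sup>2 * sine_mode K \<mu> \<nu> z)"
proof -
  have s: "((\<lambda>x. sin (p * (x - q))) has_real_derivative p * cos (p * (x - q))) (at x)" for p q x
    by (auto intro!: derivative_eq_intros)
  have c: "((\<lambda>x. p * cos (p * (x - q))) has_real_derivative - p\<^sup>2 * sin (p * (x - q))) (at x)" for p q x
    by (auto intro!: derivative_eq_intros simp: power2_eq_square)
  show x: "dx (sine_mode K \<mu> \<nu>) = (\<lambda>z. \<mu> * cos (\<mu> * (fst z - xl K)) * sin (\<nu> * (snd z - yl K)))"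
    and y: "dy (sine_mode K \<mu> \<nu>) = (\<lambda>z. sin (\<mu> * (fst z - xl K)) * (\<nu> * cos (\<nu> * (snd z - yl K))))"
    unfolding sine_mode_def[abs_def] using dx_dy_times[OF s s] by (simp_all add: fun_eq_iff)
  show "dx (dx (sine_mode K \<mu> \<nu>)) = (\<lambda>z. - \<mu>\<^sup>2 * sine_mode K \<mu> \<nu> z)"
    unfolding x using dx_dy_times(1)[OF c s] by (simp add: fun_eq_iff sine_mode_def)
  show "dy (dy (sine_mode K \<mu> \<nu>)) = (\<lambda>z. - \<nu>\<^sup>2 * sine_mode K \<mu> \<nu> z)"
    unfolding y using dx_dy_times(2)[OF s c] by (simp add: fun_eq_iff sine_mode_def)
qed

lemma sine_mode_vanishes_linearly:
  assumes "sin (\<mu> * hx K) = 0" "sin (\<nu> * hy K) = 0"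
  shows "vanishes_linearly K (max \<bar>\<mu>\<bar> \<bar>\<nu>\<bar>) (sine_mode K \<mu> \<nu>)"
  unfolding vanishes_linearly_def
proof
  fix z assume z: "z \<in> open_rect K"
  \<comment> \<open>Towards the far end the sine is expanded about its zero at \<open>r\<close>
    instead of the one at \<open>q\<close>.\<close>
  have refl: "\<bar>sin (p * (x - q))\<bar> \<le> \<bar>p\<bar> * (r - x)" if "sin (p * (r - q)) = 0" "x < r" for p q r x :: real
  proof -
    have "sin (p * (x - q)) = sin (p * (r - q) - p * (r - x))" by (simp add: algebra_simps)
    also have "\<dots> = - (cos (p * (r - q)) * sin (p * (r - x)))" using that by (simp add: sin_diff)
    finally have "\<bar>sin (p * (x - q))\<bar> = \<bar>cos (p * (r - q))\<bar> * \<bar>sin (p * (r - x))\<bar>" by (simp add: abs_mult)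
    also have "\<dots> \<le> 1 * \<bar>sin (p * (r - x))\<bar>" by (rule mult_right_mono) auto
    also have "\<dots> \<le> \<bar>p\<bar> * (r - x)"
      using abs_sin_x_le_abs_x[of "p * (r - x)"] that by (simp add: abs_mult)
    finally show ?thesis .
  qed
  have direct: "\<bar>sin (p * (x - q))\<bar> \<le> \<bar>p\<bar> * (x - q)" if "q < x" for p q x :: real
    using abs_sin_x_le_abs_x[of "p * (x - q)"] that by (simp add: abs_mult)
  have le: "\<bar>s * t\<bar> \<le> max \<bar>\<mu>\<bar> \<bar>\<nu>\<bar> * d"
    if "\<bar>s\<bar> \<le> \<bar>\<mu>\<bar> * d \<and> \<bar>t\<bar> \<le> 1 \<or> \<bar>s\<bar> \<le> 1 \<and> \<bar>t\<bar> \<le> \<bar>\<nu>\<bar> * d" "0 < d" for s t d :: real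
  proof -
    have "\<bar>s * t\<bar> \<le> \<bar>\<mu>\<bar> * d \<or> \<bar>s * t\<bar> \<le> \<bar>\<nu>\<bar> * d"
      using that mult_mono[of "\<bar>s\<bar>" "\<bar>\<mu>\<bar> * d" "\<bar>t\<bar>" 1] mult_mono[of "\<bar>s\<bar>" 1 "\<bar>t\<bar>" "\<bar>\<nu>\<bar> * d"]
      by (auto simp: abs_mult)
    moreover have "\<bar>\<mu>\<bar> * d \<le> max \<bar>\<mu>\<bar> \<bar>\<nu>\<bar> * d" "\<bar>\<nu>\<bar> * d \<le> max \<bar>\<mu>\<bar> \<bar>\<nu>\<bar> * d"
      using that by (auto intro!: mult_right_mono)
    ultimately show ?thesis by linarith
  qed
  from z show "\<bar>sine_mode K \<mu> \<nu> z\<bar> \<le> max \<bar>\<mu>\<bar> \<bar>\<nu>\<bar> * (fst z - xl K) \<and>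
         \<bar>sine_mode K \<mu> \<nu> z\<bar> \<le> max \<bar>\<mu>\<bar> \<bar>\<nu>\<bar> * (xr K - fst z) \<and>
         \<bar>sine_mode K \<mu> \<nu> z\<bar> \<le> max \<bar>\<mu>\<bar> \<bar>\<nu>\<bar> * (snd z - yl K) \<and>
         \<bar>sine_mode K \<mu> \<nu> z\<bar> \<le> max \<bar>\<mu>\<bar> \<bar>\<nu>\<bar> * (yr K - snd z)"
    unfolding sine_mode_def using assms
    by (intro conjI le) (auto simp: open_rect_times hx_def hy_def direct refl)
qed

text \<open>The mode is an eigenfunction of the negative Laplacian. Since it vanishes on the
  boundary it may be tested with, and since \<open>u\<close> does, a second integration by parts
  moves all derivatives onto the mode, although the gradient of the mode is not zero on the
  boundary.\<close>

lemma weak_solution_sine_mode: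
  assumes K: "nondegenerate K" and u: "u \<in> H10 (open_rect K)" and g: "g \<in> L2 (open_rect K)"
    and weak: "\<And>v. v \<in> H10 (open_rect K) \<Longrightarrow>
      (LINT z|lebesgue_on (open_rect K). weak_grad (open_rect K) u z \<bullet> weak_grad (open_rect K) v z)
        = (LINT z|lebesgue_on (open_rect K). g z * v z)"
    and per: "sin (\<mu> * hx K) = 0" "sin (\<nu> * hy K) = 0"
  shows "(\<mu>\<^sup>2 + \<nu>\<^sup>2) * (LINT z|lebesgue_on (open_rect K). u z * sine_mode K \<mu> \<nu> z)
    = (LINT z|lebesgue_on (open_rect K). g z * sine_mode K \<mu> \<nu> z)"
proof -
  let ?f = "sine_mode K \<mu> \<nu>"
  have C: "Ck (Suc 0) (dx ?f)" "Ck (Suc 0) (dy ?f)"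
    by (rule Ck_dx Ck_dy, rule Ck_sine_mode)+
  have "(LINT z|lebesgue_on (open_rect K). g z * ?f z)
      = - (LINT z|lebesgue_on (open_rect K). u z * dx (dx ?f) z)
        - (LINT z|lebesgue_on (open_rect K). u z * dy (dy ?f) z)"
    using weak_solution_tested[OF K u g weak Ck_sine_mode sine_mode_vanishes_linearly[OF per]]
    unfolding H10_integral_by_parts(1)[OF K u C(1)] H10_integral_by_parts(2)[OF K u C(2)] by simp
  also have "\<dots> = (\<mu>\<^sup>2 + \<nu>\<^sup>2) * (LINT z|lebesgue_on (open_rect K). u z * ?f z)"
    unfolding dx_sine_mode(3,4) by (simp add: mult.left_commute[of "u _"] distrib_right)
  finally show ?thesis by simp
qed

section \<open>Completeness of the sine modes\<close>

inductive_set sine_span :: "rect \<Rightarrow> field set" for K where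
  mode: "sine_mode K (real m * pi / hx K) (real n * pi / hy K) \<in> sine_span K"
| add: "f \<in> sine_span K \<Longrightarrow> g \<in> sine_span K \<Longrightarrow> (\<lambda>z. f z + g z) \<in> sine_span K"
| scale: "f \<in> sine_span K \<Longrightarrow> (\<lambda>z. c * f z) \<in> sine_span K"

text \<open>By the product-to-sum formula, multiplication with the cosine of lowest frequency
  replaces a mode by the half sum of its two neighbours. The lower neighbour may have index 0 and is
  then the zero function, which is why \<open>sine_span\<close> admits that index.\<close>

lemma sine_span_mult_cos:
  assumes "f \<in> sine_span K"
  shows "(\<lambda>z. cos (pi / hx K * (fst z - xl K)) * f z) \<in> sine_span K"
    "(\<lambda>z. cos (pi / hy K * (snd z - yl K)) * f z) \<in> sine_span K"
  using assms
proof (induction)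
  case (mode m n)
  have step: "cos t * sin (real (Suc k) * t) = 1 / 2 * sin (real (Suc (Suc k)) * t) + 1 / 2 * sin (real k * t)" for t k
  proof -
    have "real (Suc (Suc k)) * t = real (Suc k) * t + t" "real k * t = real (Suc k) * t - t"
      by (simp_all add: algebra_simps)
    then show ?thesis by (simp only: sin_add sin_diff) (simp add: algebra_simps)
  qed
  have step1: "cos t * (sin (real (Suc k) * t) * c)
      = 1 / 2 * (sin (real (Suc (Suc k)) * t) * c) + 1 / 2 * (sin (real k * t) * c)" for t c k
    using arg_cong[OF step[of t k], of "\<lambda>s. s * c"] by (simp only: distrib_right mult.assoc)
  have step2: "cos t * (c * sin (real (Suc k) * t))
      = 1 / 2 * (c * sin (real (Suc (Suc k)) * t)) + 1 / 2 * (c * sin (real k * t))" for t c k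
    using step1[of t k c] by (simp only: mult.commute[of c])
  have arg: "real k * pi / h * x = real k * (pi / h * x)" for k h x by simp
  {
    case 1
    show ?case
    proof (cases m)
      case 0
      then have "(\<lambda>z. cos (pi / hx K * (fst z - xl K)) * sine_mode K (real m * pi / hx K) (real n * pi / hy K) z)
        = (\<lambda>z. 0 * sine_mode K (real m * pi / hx K) (real n * pi / hy K) z)"
        by (simp add: sine_mode_def)
      then show ?thesis by (simp only: sine_span.intros)
    next
      case (Suc k)
      have "(\<lambda>z. cos (pi / hx K * (fst z - xl K)) * sine_mode K (real m * pi / hx K) (real n * pi / hy K) z)
        = (\<lambda>z. 1 / 2 * sine_mode K (real (Suc (Suc k)) * pi / hx K) (real n * pi / hy K) z
             + 1 / 2 * sine_mode K (real k * pi / hx K) (real n * pi / hy K) z)"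
        unfolding sine_mode_def arg Suc by (rule ext) (rule step1)
      then show ?thesis by (simp only: sine_span.intros)
    qed
  next
    case 2
    show ?case
    proof (cases n)
      case 0
      then have "(\<lambda>z. cos (pi / hy K * (snd z - yl K)) * sine_mode K (real m * pi / hx K) (real n * pi / hy K) z)
        = (\<lambda>z. 0 * sine_mode K (real m * pi / hx K) (real n * pi / hy K) z)"
        by (simp add: sine_mode_def)
      then show ?thesis by (simp only: sine_span.intros)
    next
      case (Suc k)
      have "(\<lambda>z. cos (pi / hy K * (snd z - yl K)) * sine_mode K (real m * pi / hx K) (real n * pi / hy K) z)
        = (\<lambda>z. 1 / 2 * sine_mode K (real m * pi / hx K) (real (Suc (Suc k)) * pi / hy K) z
             + 1 / 2 * sine_mode K (real m * pi / hx K) (real k * pi / hy K) z)"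
        unfolding sine_mode_def arg Suc by (rule ext) (rule step2)
      then show ?thesis by (simp only: sine_span.intros)
    qed
  }
next
  case (add f g)
  { case 1 show ?case using sine_span.add[OF add.IH(1) add.IH(3)] by (simp add: distrib_left) }
  { case 2 show ?case using sine_span.add[OF add.IH(2) add.IH(4)] by (simp add: distrib_left) }
next
  case (scale f c)
  { case 1 show ?case using sine_span.scale[OF scale.IH(1), of c] by (simp add: mult.left_commute) }
  { case 2 show ?case using sine_span.scale[OF scale.IH(2), of c] by (simp add: mult.left_commute) }
qed

text \<open>The multipliers of the span of the sine modes form an algebra containing the cosines
  of \<open>x\<close> and \<open>y\<close>, which separate the points of the rectangle.\<close>

lemma exists_sine_mode_not_orthogonal:
  assumes K: "nondegenerate K" and g: "integrable (lebesgue_on (open_rect K)) g"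
    and nz: "\<not> (AE z in lebesgue_on (open_rect K). g z = 0)"
  shows "\<exists>m n. 0 < m \<and> 0 < n \<and>
    (LINT z|lebesgue_on (open_rect K). g z * sine_mode K (real m * pi / hx K) (real n * pi / hy K) z) \<noteq> 0"
proof (rule ccontr)
  assume contra: "\<not> ?thesis"
  let ?M = "lebesgue_on (open_rect K)"
  have orth0: "(LINT z|?M. g z * sine_mode K (real m * pi / hx K) (real n * pi / hy K) z) = 0"
    if "0 < m" "0 < n" for m n
  proof (rule ccontr)
    assume "(LINT z|?M. g z * sine_mode K (real m * pi / hx K) (real n * pi / hy K) z) \<noteq> 0"
    with that have "0 < m \<and> 0 < n \<and> (LINT z|?M. g z * sine_mode K (real m * pi / hx K) (real n * pi / hy K) z) \<noteq> 0"
      by (intro conjI)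
    then have "\<exists>m n. 0 < m \<and> 0 < n \<and>
        (LINT z|?M. g z * sine_mode K (real m * pi / hx K) (real n * pi / hy K) z) \<noteq> 0"
      by (rule exI[of _ m, OF exI[of _ n]])
    from contra this show False by (rule notE)
  qed
  have h: "0 < hx K" "0 < hy K" using K by (auto simp: nondegenerate_def hx_def hy_def)
  note int = integrable_mult_continuous[OF g]
  have orth: "continuous_on (closed_rect K) f \<and> (LINT z|?M. g z * f z) = 0" if "f \<in> sine_span K" for f
    using that
  proof induction
    case (mode m n)
    show ?case
    proof (cases "m = 0 \<or> n = 0")
      case True
      then show ?thesis by (auto simp: sine_mode_def)
    next
      case False
      then have "(LINT z|?M. g z * sine_mode K (real m * pi / hx K) (real n * pi / hy K) z) = 0"
        by (intro orth0) auto
      then show ?thesis by (simp add: continuous_sine_mode)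
    qed
  next
    case (add f f')
    then show ?case using int[of f] int[of f'] by (auto simp: distrib_left intro: continuous_intros)
  next
    case (scale f c)
    then show ?case by (auto simp: mult.left_commute[of "g _"] intro: continuous_intros)
  qed
  \<comment> \<open>Stone-Weierstrass does not apply to the span itself, whose members all vanish on
    the boundary; its multipliers include the constants.\<close>
  define R where "R = {F. continuous_on (closed_rect K) F \<and> (\<forall>f\<in>sine_span K. (\<lambda>z. F z * f z) \<in> sine_span K)}"
  let ?e = "sine_mode K (real 1 * pi / hx K) (real 1 * pi / hy K)"
  have "AE z in ?M. g z * ?e z = 0"
  proof (rule AE_zero_if_orthogonal_function_ring[OF _ _ open_rect_subset])
    show "integrable ?M (\<lambda>z. g z * ?e z)" by (rule int[OF continuous_sine_mode])
    show "(LINT z|?M. g z * ?e z * F z) = 0" if "F \<in> R" for F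
    proof -
      have "(\<lambda>z. F z * ?e z) \<in> sine_span K"
        using that sine_span.mode[where m=1 and n=1 and K=K] unfolding R_def by blast
      then have "(LINT z|?M. g z * (F z * ?e z)) = 0" using orth by blast
      moreover have "(\<lambda>z. g z * ?e z * F z) = (\<lambda>z. g z * (F z * ?e z))" by (simp add: ac_simps)
      ultimately show ?thesis by simp
    qed
    show "function_ring_on R (closed_rect K)"
    proof
      show "\<exists>F\<in>R. F z \<noteq> F w" if zw: "z \<in> closed_rect K" "w \<in> closed_rect K" "z \<noteq> w" for z w
      proof -
        \<comment> \<open>The cosine of lowest frequency runs through exactly half a period along a
          side, where it is injective.\<close>
        have inj: "pi / h * (s - q) = pi / h * (t - q)" if "cos (pi / h * (s - q)) = cos (pi / h * (t - q))"
          "q \<le> s" "s \<le> q + h" "q \<le> t" "t \<le> q + h" "h > 0" for h s t q :: real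
        proof -
          have range: "0 \<le> pi / h * (r - q)" "pi / h * (r - q) \<le> pi" if "q \<le> r" "r \<le> q + h" for r
            using mult_left_mono[of "r - q" h "pi / h"] that \<open>h > 0\<close> by simp_all
          show ?thesis
            by (rule cos_inj_pi[OF range(1)[OF that(2,3)] range(2)[OF that(2,3)]
                  range(1)[OF that(4,5)] range(2)[OF that(4,5)] that(1)])
        qed
        have X: "(\<lambda>z. cos (pi / hx K * (fst z - xl K))) \<in> R" and Y: "(\<lambda>z. cos (pi / hy K * (snd z - yl K))) \<in> R"
          unfolding R_def using sine_span_mult_cos[of _ K] h by (auto intro!: continuous_intros)
        show ?thesis
        proof (cases "fst z = fst w")
          case True
          then have "snd z \<noteq> snd w" using zw by (simp add: prod_eq_iff)
          then have "cos (pi / hy K * (snd z - yl K)) \<noteq> cos (pi / hy K * (snd w - yl K))"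
            using inj[of "hy K" "snd z" "yl K" "snd w"] zw h by (auto simp: closed_rect_times hy_def)
          then show ?thesis by (intro bexI[OF _ Y])
        next
          case False
          then have "cos (pi / hx K * (fst z - xl K)) \<noteq> cos (pi / hx K * (fst w - xl K))"
            using inj[of "hx K" "fst z" "xl K" "fst w"] zw h by (auto simp: closed_rect_times hx_def)
          then show ?thesis by (intro bexI[OF _ X])
        qed
      qed
      show "(\<lambda>z. F z * G z) \<in> R" if "F \<in> R" "G \<in> R" for F G
        using that unfolding R_def by (auto intro: continuous_intros simp: mult.assoc)
      show "(\<lambda>z. F z + G z) \<in> R" if "F \<in> R" "G \<in> R" for F G
        using that unfolding R_def by (auto intro: continuous_intros sine_span.add simp: distrib_right)
    qed (auto simp: R_def compact_closed_rect sine_span.scale)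
  qed simp_all
  \<comment> \<open>The lowest mode is positive inside the rectangle and can be cancelled from
    \<open>g z * ?e z = 0\<close>.\<close>
  moreover have "?e z \<noteq> 0" if "z \<in> open_rect K" for z
  proof -
    have "0 < sin (pi / h * (s - q))" if "q < s" "s < q + h" "h > 0" for h s q :: real
      using mult_strict_left_mono[of "s - q" h "pi / h"] that by (intro sin_gt_zero) simp_all
    from this[of "xl K" "fst z" "hx K"] this[of "yl K" "snd z" "hy K"]
    show ?thesis using that h by (auto simp: sine_mode_def open_rect_times hx_def hy_def)
  qed
  ultimately have "AE z in ?M. g z = 0"
    using AE_space by (auto elim!: eventually_elim2)
  with nz show False by simp
qed

section \<open>Uniform grids\<close>

lemma exists_gap_right:
  fixes p :: real
  assumes "finite X" "b \<in> X" "p < b"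
  shows "\<exists>e>p. e \<le> b \<and> (\<forall>x\<in>X. x \<le> p \<or> e \<le> x)"
proof -
  let ?Y = "{x \<in> X. p < x}"
  have fin: "finite ?Y" and "b \<in> ?Y" using assms by auto
  then have "Min ?Y \<in> ?Y" using Min_in[OF fin] by blast
  moreover have "\<forall>x\<in>?Y. Min ?Y \<le> x" using fin by simp
  ultimately have "p < Min ?Y" "\<forall>x\<in>?Y. Min ?Y \<le> x" by blast+
  then show ?thesis using \<open>b \<in> ?Y\<close> by (intro exI[of _ "Min ?Y"]) force
qed

text \<open>The point is moved right and up by less than the gap to the next left or lower side of
  any cell. A cell covering the moved point cannot begin beyond (p, q), yet it ends beyond
  it.\<close>

lemma grid_cell_right_above:
  assumes G: "rect_grid \<Omega> G" and p: "xl \<Omega> \<le> p" "p < xr \<Omega>" and q: "yl \<Omega> \<le> q" "q < yr \<Omega>"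
  shows "\<exists>L\<in>G. xl L \<le> p \<and> p < xr L \<and> yl L \<le> q \<and> q < yr L"
proof -
  have fin: "finite G" and cover: "(\<Union>K\<in>G. closed_rect K) = closed_rect \<Omega>"
    using G by (auto simp: rect_grid_def)
  obtain x where x: "p < x" "x \<le> xr \<Omega>" "\<forall>t\<in>insert (xr \<Omega>) (xl ` G). t \<le> p \<or> x \<le> t"
    using exists_gap_right[of "insert (xr \<Omega>) (xl ` G)" "xr \<Omega>" p] fin p by auto
  obtain y where y: "q < y" "y \<le> yr \<Omega>" "\<forall>t\<in>insert (yr \<Omega>) (yl ` G). t \<le> q \<or> y \<le> t"
    using exists_gap_right[of "insert (yr \<Omega>) (yl ` G)" "yr \<Omega>" q] fin q by auto
  have "((p + x) / 2, (q + y) / 2) \<in> closed_rect \<Omega>"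
    using x y p q by (auto simp: closed_rect_times)
  then obtain L where L: "L \<in> G" "((p + x) / 2, (q + y) / 2) \<in> closed_rect L"
    using cover by blast
  then have "xl L \<le> (p + x) / 2" "(p + x) / 2 \<le> xr L" "yl L \<le> (q + y) / 2" "(q + y) / 2 \<le> yr L"
    by (auto simp: closed_rect_times)
  moreover have "xl L \<le> p \<or> x \<le> xl L" "yl L \<le> q \<or> y \<le> yl L" using x y L by auto
  ultimately show ?thesis using L x y by (intro bexI[of _ L]) auto
qed

definition grid_cell :: "rect \<Rightarrow> real \<Rightarrow> real \<Rightarrow> nat \<times> nat \<Rightarrow> rect" where
  "grid_cell \<Omega> H V ij = Rect (xl \<Omega> + real (fst ij) * H) (xl \<Omega> + real (Suc (fst ij)) * H)
     (yl \<Omega> + real (snd ij) * V) (yl \<Omega> + real (Suc (snd ij)) * V)"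

lemma grid_subset: "rect_grid \<Omega> G \<Longrightarrow> K \<in> G \<Longrightarrow>
    xl \<Omega> \<le> xl K \<and> xl K < xr K \<and> xr K \<le> xr \<Omega> \<and> yl \<Omega> \<le> yl K \<and> yl K < yr K \<and> yr K \<le> yr \<Omega>"
proof -
  assume G: "rect_grid \<Omega> G" "K \<in> G"
  then have n: "xl K < xr K" "yl K < yr K" by (auto simp: rect_grid_def nondegenerate_def)
  have "closed_rect K \<subseteq> closed_rect \<Omega>" using G by (auto simp: rect_grid_def)
  moreover have "(xl K, yl K) \<in> closed_rect K" "(xr K, yr K) \<in> closed_rect K"
    using n by (auto simp: closed_rect_times)
  ultimately have "(xl K, yl K) \<in> closed_rect \<Omega>" "(xr K, yr K) \<in> closed_rect \<Omega>"
    by blast+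
  then show ?thesis using n by (auto simp: closed_rect_times)
qed

text \<open>The absence of hanging nodes makes the grid a product: it forces the cells to continue
  each other from the lower left corner along the bottom row and then up every column. No further
  cell fits in, because its interior would meet that of a cell already found.\<close>

lemma uniform_grid_eq_product:
  assumes \<Omega>: "nondegenerate \<Omega>" and G: "rect_grid \<Omega> G" and U: "uniform_grid G"
  obtains H V nx ny where "0 < H" "0 < V" "\<And>K. K \<in> G \<Longrightarrow> hx K = H \<and> hy K = V"
    "xl \<Omega> + real nx * H = xr \<Omega>" "yl \<Omega> + real ny * V = yr \<Omega>" "0 < nx" "0 < ny"
    "bij_betw (grid_cell \<Omega> H V) ({..<nx} \<times> {..<ny}) G"
proof -
  have O: "xl \<Omega> < xr \<Omega>" "yl \<Omega> < yr \<Omega>" using \<Omega> by (auto simp: nondegenerate_def)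
  note sub = grid_subset[OF G]
  obtain L0 where L0: "L0 \<in> G" "xl L0 \<le> xl \<Omega>" "yl L0 \<le> yl \<Omega>"
    using grid_cell_right_above[OF G, of "xl \<Omega>" "yl \<Omega>"] O by auto
  define H V where "H = hx L0" and "V = hy L0"
  have HV: "hx K = H" "hy K = V" if "K \<in> G" for K
    using U L0(1) that unfolding uniform_grid_def H_def V_def by blast+
  have pos: "0 < H" "0 < V" using sub[OF L0(1)] by (auto simp: H_def V_def hx_def hy_def)
  let ?c = "\<lambda>i j. grid_cell \<Omega> H V (i, j)"
  have cell_eq: "K = ?c i j" if "K \<in> G" "xl K = xl \<Omega> + real i * H" "yl K = yl \<Omega> + real j * V" for K i j
    using HV[OF that(1)] that(2,3) by (cases K) (auto simp: grid_cell_def hx_def hy_def algebra_simps)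
  \<comment> \<open>The cell containing the vertex (p, q) in the half-open sense must have it as a
    vertex, and of its four vertices only the lower left one is compatible with that.\<close>
  have next_cell: "\<exists>L\<in>G. xl L = p \<and> yl L = q"
    if hyp: "K \<in> G" "(p, q) \<in> vertices K" "p < xr \<Omega>" "q < yr \<Omega>" for K p q
  proof -
    have "xl \<Omega> \<le> p" "yl \<Omega> \<le> q" using sub[OF hyp(1)] hyp(2) by (auto simp: vertices_def)
    then obtain L where L: "L \<in> G" "xl L \<le> p \<and> p < xr L \<and> yl L \<le> q \<and> q < yr L"
      using grid_cell_right_above[OF G _ hyp(3) _ hyp(4)] by blast
    then have "(p, q) \<in> closed_rect L" by (simp add: closed_rect_times)
    then have "(p, q) \<in> vertices L"
      using G hyp L(1) unfolding rect_grid_def by blast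
    then show ?thesis using L by (intro bexI[of _ L]) (auto simp: vertices_def)
  qed
  have c00: "?c 0 0 \<in> G"
    using cell_eq[OF L0(1), of 0 0] sub[OF L0(1)] L0 by auto
  have ci0: "?c i 0 \<in> G" if "xl \<Omega> + real i * H < xr \<Omega>" for i
    using that
  proof (induction i)
    case (Suc i)
    have "xl \<Omega> + real i * H < xr \<Omega>" using Suc.prems pos by (simp add: algebra_simps)
    then have "?c i 0 \<in> G" by (rule Suc.IH)
    from next_cell[OF this, of "xl \<Omega> + real (Suc i) * H" "yl \<Omega>"] Suc.prems O
    obtain L where "L \<in> G" "xl L = xl \<Omega> + real (Suc i) * H" "yl L = yl \<Omega>"
      by (auto simp: vertices_def grid_cell_def)
    then show ?case using cell_eq[of L "Suc i" 0] by simp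
  qed (use c00 in simp)
  have cij: "?c i j \<in> G" if "xl \<Omega> + real i * H < xr \<Omega>" "yl \<Omega> + real j * V < yr \<Omega>" for i j
    using that(2)
  proof (induction j)
    case (Suc j)
    have "yl \<Omega> + real j * V < yr \<Omega>" using Suc.prems pos by (simp add: algebra_simps)
    then have "?c i j \<in> G" by (rule Suc.IH)
    from next_cell[OF this, of "xl \<Omega> + real i * H" "yl \<Omega> + real (Suc j) * V"] Suc.prems that(1)
    obtain L where "L \<in> G" "xl L = xl \<Omega> + real i * H" "yl L = yl \<Omega> + real (Suc j) * V"
      by (auto simp: vertices_def grid_cell_def)
    then show ?case using cell_eq[of L i "Suc j"] by simp
  qed (use ci0[OF that(1)] in simp)
  have count: "\<exists>n>0. \<forall>i. (l + real i * h < r \<longleftrightarrow> i < n) \<and> l + real (n - 1) * h < r \<and> r \<le> l + real n * h"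
    if "l < r" "0 < h" for l r h :: real
  proof -
    define n where "n = nat \<lceil>(r - l) / h\<rceil>"
    have i: "(l + real i * h < r) = (i < n)" for i
    proof -
      have "(l + real i * h < r) = (real i < (r - l) / h)" using that by (simp add: field_simps)
      also have "\<dots> = (i < n)" unfolding n_def by linarith
      finally show ?thesis .
    qed
    have "0 < n" using i[of 0] that by simp
    moreover from this have "l + real (n - 1) * h < r" unfolding i by simp
    moreover have "r \<le> l + real n * h" using i[of n] by linarith
    ultimately show ?thesis using i by (intro exI[of _ n] conjI allI)
  qed
  obtain nx where nx: "0 < nx" "\<And>i. xl \<Omega> + real i * H < xr \<Omega> \<longleftrightarrow> i < nx" "xr \<Omega> \<le> xl \<Omega> + real nx * H"
    using count[OF O(1) pos(1)] by blast
  obtain ny where ny: "0 < ny" "\<And>j. yl \<Omega> + real j * V < yr \<Omega> \<longleftrightarrow> j < ny" "yr \<Omega> \<le> yl \<Omega> + real ny * V"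
    using count[OF O(2) pos(2)] by blast
  \<comment> \<open>This cell begins inside \<Omega> by the choice of \<open>nx\<close> and
    \<open>ny\<close>, and as a cell of the grid it also ends inside. Together with the reverse
    inequalities the sides of \<Omega> are exact multiples of \<open>H\<close> and
    \<open>V\<close>.\<close>
  have last: "?c (nx - 1) (ny - 1) \<in> G" using cij nx ny by simp
  have ex: "xl \<Omega> + real nx * H = xr \<Omega>" and ey: "yl \<Omega> + real ny * V = yr \<Omega>"
    using sub[OF last] nx ny by (auto simp: grid_cell_def)
  have inj: "inj_on (grid_cell \<Omega> H V) ({..<nx} \<times> {..<ny})"
    using pos by (auto simp: inj_on_def grid_cell_def)
  have "K \<in> grid_cell \<Omega> H V ` ({..<nx} \<times> {..<ny})" if K: "K \<in> G" for K
  proof -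
    have fl: "\<exists>i. l + real i * h \<le> t \<and> t < l + real (Suc i) * h" if "l \<le> t" "0 < h" for l t h :: real
    proof -
      have "0 \<le> (t - l) / h" using that by simp
      then obtain i :: nat where "real i \<le> (t - l) / h" "(t - l) / h < real (Suc i)"
        by (rule_tac that[of "nat \<lfloor>(t - l) / h\<rfloor>"]; linarith)
      then have "real i * h \<le> t - l" "t - l < real (Suc i) * h"
        using that by (simp_all only: pos_le_divide_eq pos_divide_less_eq)
      then show ?thesis by (intro exI[of _ i]) auto
    qed
    obtain i where i: "xl \<Omega> + real i * H \<le> xl K" "xl K < xl \<Omega> + real (Suc i) * H"
      using fl sub[OF K] pos by blast
    obtain j where j: "yl \<Omega> + real j * V \<le> yl K" "yl K < yl \<Omega> + real (Suc j) * V"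
      using fl sub[OF K] pos by blast
    have ij: "i < nx" "j < ny" using i j sub[OF K] by (auto simp flip: nx(2) ny(2))
    then have c: "?c i j \<in> G" using cij nx ny by simp
    obtain x where "xl K < x" "x < min (xr K) (xl \<Omega> + real (Suc i) * H)"
      using dense[of "xl K" "min (xr K) (xl \<Omega> + real (Suc i) * H)"] i sub[OF K] by auto
    moreover obtain y where "yl K < y" "y < min (yr K) (yl \<Omega> + real (Suc j) * V)"
      using dense[of "yl K" "min (yr K) (yl \<Omega> + real (Suc j) * V)"] j sub[OF K] by auto
    ultimately have "(x, y) \<in> open_rect K \<inter> open_rect (?c i j)"
      using i j by (auto simp: open_rect_times grid_cell_def)
    then have "K = ?c i j" using G K c unfolding rect_grid_def by blast
    then show ?thesis using ij by auto
  qed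
  moreover have "grid_cell \<Omega> H V ` ({..<nx} \<times> {..<ny}) \<subseteq> G" using cij nx(2) ny(2) by auto
  ultimately have "bij_betw (grid_cell \<Omega> H V) ({..<nx} \<times> {..<ny}) G"
    using inj unfolding bij_betw_def by blast
  then show ?thesis using that pos HV ex ey nx(1) ny(1) by blast
qed

text \<open>The cells of a row share \<open>yl\<close>, so a quantity attached to vertical edges
  cancels between neighbours and only the ends of the row remain; columns behave likewise. The first
  argument of \<open>E\<close> is always the coordinate in which the sum telescopes.\<close>

lemma grid_telescope:
  fixes E :: "real \<Rightarrow> real \<Rightarrow> real"
  assumes \<Omega>: "nondegenerate \<Omega>" and G: "rect_grid \<Omega> G" and U: "uniform_grid G"
  shows "(\<And>y. E (xl \<Omega>) y = 0) \<Longrightarrow> (\<And>y. E (xr \<Omega>) y = 0) \<Longrightarrow>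
      (\<Sum>K\<in>G. E (xr K) (yl K) - E (xl K) (yl K)) = 0"
    and "(\<And>x. E (yl \<Omega>) x = 0) \<Longrightarrow> (\<And>x. E (yr \<Omega>) x = 0) \<Longrightarrow>
      (\<Sum>K\<in>G. E (yr K) (xl K) - E (yl K) (xl K)) = 0"
proof -
  obtain H V nx ny where g: "xl \<Omega> + real nx * H = xr \<Omega>" "yl \<Omega> + real ny * V = yr \<Omega>"
    "bij_betw (grid_cell \<Omega> H V) ({..<nx} \<times> {..<ny}) G"
    by (rule uniform_grid_eq_product[OF assms])
  have tel: "(\<Sum>i<n. E (l + real (Suc i) * h) y - E (l + real i * h) y) = E (l + real n * h) y - E l y" for n l h y
    using sum_lessThan_telescope[of "\<lambda>i. E (l + real i * h) y" n] by simp
  {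
    assume "\<And>y. E (xl \<Omega>) y = 0" "\<And>y. E (xr \<Omega>) y = 0"
    then show "(\<Sum>K\<in>G. E (xr K) (yl K) - E (xl K) (yl K)) = 0"
      unfolding sum.reindex_bij_betw[OF g(3), symmetric] sum.cartesian_product'
      by (subst sum.swap) (simp add: grid_cell_def tel g del: of_nat_Suc)
  }
  {
    assume "\<And>y. E (yl \<Omega>) y = 0" "\<And>y. E (yr \<Omega>) y = 0"
    then show "(\<Sum>K\<in>G. E (yr K) (xl K) - E (yl K) (xl K)) = 0"
      unfolding sum.reindex_bij_betw[OF g(3), symmetric] sum.cartesian_product'
      by (simp add: grid_cell_def tel g del: of_nat_Suc)
  }
qed

section \<open>Piecewise quadratic functions\<close>

definition xm :: "rect \<Rightarrow> real" where "xm K = (xl K + xr K) / 2"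
definition ym :: "rect \<Rightarrow> real" where "ym K = (yl K + yr K) / 2"

text \<open>Centring at the midpoint of the cell makes the odd moments vanish and lets the four
  vertex values differ in signs only.\<close>

definition quad :: "rect \<Rightarrow> (nat \<Rightarrow> real) \<Rightarrow> field" where
  "quad K d z = d 0 + d 1 * (fst z - xm K) + d 2 * (snd z - ym K) + d 3 * (fst z - xm K)\<^sup>2
     + d 4 * ((fst z - xm K) * (snd z - ym K)) + d 5 * (snd z - ym K)\<^sup>2"

lemma continuous_quad: "continuous_on A (quad K d)"
  unfolding quad_def by (intro continuous_intros)

lemma quad_in_Pk: "quad K d \<in> Pk 2"
proof -
  let ?X = "xm K" and ?Y = "ym K"
  define c :: "nat \<Rightarrow> nat \<Rightarrow> real" where "c i j =
    (if i = 0 \<and> j = 0 then d 0 - d 1 * ?X - d 2 * ?Y + d 3 * ?X\<^sup>2 + d 4 * ?X * ?Y + d 5 * ?Y\<^sup>2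
     else if i = 1 \<and> j = 0 then d 1 - 2 * d 3 * ?X - d 4 * ?Y
     else if i = 0 \<and> j = 1 then d 2 - 2 * d 5 * ?Y - d 4 * ?X
     else if i = 2 then d 3 else if i = 1 then d 4 else d 5)" for i j
  have "quad K d (x, y) = (\<Sum>i\<le>2. \<Sum>j\<le>2 - i. c i j * x ^ i * y ^ j)" for x y
    by (simp add: numeral_2_eq_2 c_def quad_def) (simp add: algebra_simps power2_eq_square)
  then show ?thesis unfolding Pk_def by blast
qed

lemma Pk_imp_quad:
  assumes "p \<in> Pk 2"
  obtains d where "p = quad K d"
proof -
  obtain c where c: "\<And>x y. p (x, y) = (\<Sum>i\<le>2. \<Sum>j\<le>2 - i. c i j * x ^ i * y ^ j)"
    using assms by (auto simp: Pk_def)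
  let ?X = "xm K" and ?Y = "ym K"
  define d :: "nat \<Rightarrow> real" where "d i =
    (if i = 0 then c 0 0 + c 1 0 * ?X + c 0 1 * ?Y + c 2 0 * ?X\<^sup>2 + c 1 1 * ?X * ?Y + c 0 2 * ?Y\<^sup>2
     else if i = 1 then c 1 0 + 2 * c 2 0 * ?X + c 1 1 * ?Y
     else if i = 2 then c 0 1 + 2 * c 0 2 * ?Y + c 1 1 * ?X
     else if i = 3 then c 2 0 else if i = 4 then c 1 1 else c 0 2)" for i
  have "p (x, y) = quad K d (x, y)" for x y
    unfolding c by (simp add: numeral_2_eq_2 d_def quad_def) (simp add: algebra_simps power2_eq_square)
  then have "p = quad K d" by (auto simp: fun_eq_iff)
  then show ?thesis by (rule that)
qed

text \<open>The set where the two polynomials differ inside the cell is open and negligible, hence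
  empty. Evaluation of the difference at the centre, at two symmetric pairs of points and at one
  diagonal point then determines its six coefficients.\<close>

lemma quad_unique:
  assumes K: "nondegenerate K"
    and eq: "AE z in lebesgue_on (closed_rect K). quad K d z = quad K e z"
  shows "quad K d = quad K e"
proof -
  define D where "D i = d i - e i" for i
  have DE: "quad K d z - quad K e z = quad K D z" for z
    by (simp add: quad_def D_def algebra_simps)
  let ?U = "{z \<in> open_rect K. quad K D z \<noteq> 0}"
  have "open ?U"
  proof -
    have "?U = open_rect K \<inter> (quad K D -` (- {0}))" by auto
    then show ?thesis
      using continuous_open_preimage[OF continuous_quad[of "open_rect K" K D], of "- {0}"]
        open_box[of "(xl K, yl K)" "(xr K, yr K)"] open_Compl[of "{0::real}"]
      by (simp add: open_rect_def)
  qed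
  moreover have "negligible ?U"
  proof -
    have "AE z in lebesgue. z \<in> closed_rect K \<longrightarrow> quad K d z = quad K e z"
      using eq by (simp add: AE_restrict_space_iff)
    then have "AE z in lebesgue. z \<notin> ?U"
    proof eventually_elim
      case (elim z)
      then show ?case using open_rect_subset[of K] DE[of z] by auto
    qed
    then have "AE z in completion lborel. z \<notin> ?U" .
    then show ?thesis unfolding negligible_iff_null_sets using AE_iff_null_sets[of ?U lebesgue] \<open>open ?U\<close> by auto
  qed
  ultimately have "?U = {}" using open_not_negligible by blast
  then have zero: "quad K D (x, y) = 0" if "xl K < x" "x < xr K" "yl K < y" "y < yr K" for x y
    using that by (auto simp: open_rect_times)
  \<comment> \<open>A quarter of the side length keeps the evaluation points strictly inside the
    cell.\<close>
  define a b where "a = (xr K - xl K) / 4" and "b = (yr K - yl K) / 4"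
  have ab: "0 < a" "0 < b" using K by (auto simp: nondegenerate_def a_def b_def)
  have z: "quad K D (xm K + s * a, ym K + t * b) = 0" if "\<bar>s\<bar> \<le> 1" "\<bar>t\<bar> \<le> 1" for s t
  proof -
    have "\<bar>s * a\<bar> \<le> 1 * a" "\<bar>t * b\<bar> \<le> 1 * b"
      using that ab unfolding abs_mult by (intro mult_mono; simp)+
    then show ?thesis using K by (intro zero) (auto simp: xm_def ym_def a_def b_def nondegenerate_def abs_le_iff field_simps)
  qed
  have 0: "D 0 = 0" using z[of 0 0] by (simp add: quad_def)
  have "D 1 * a + D 3 * a\<^sup>2 = 0" "- D 1 * a + D 3 * a\<^sup>2 = 0"
    "D 2 * b + D 5 * b\<^sup>2 = 0" "- D 2 * b + D 5 * b\<^sup>2 = 0"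
    using z[of 1 0] z[of "-1" 0] z[of 0 1] z[of 0 "-1"] 0 by (simp_all add: quad_def)
  then have "D 1 * a = 0" "D 3 * a\<^sup>2 = 0" "D 2 * b = 0" "D 5 * b\<^sup>2 = 0" by linarith+
  then have 1: "D 1 = 0" "D 3 = 0" "D 2 = 0" "D 5 = 0" using ab by simp_all
  have "D 4 = 0" using z[of 1 1] 0 1 ab by (simp add: quad_def)
  with 0 1 have "quad K D z = 0" for z by (simp add: quad_def)
  then show ?thesis using DE by (simp add: fun_eq_iff del: split_paired_All)
qed

text \<open>Uniqueness turns the choice in \<open>piece\<close> into an explicit polynomial, so that
  traces can be computed from coefficients.\<close>

lemma piece_quad:
  assumes K: "nondegenerate K" and r: "restricts_to w K (quad K d)"
  shows "piece w K = quad K d"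
proof -
  have "piece w K \<in> Pk 2 \<and> restricts_to w K (piece w K)"
    unfolding piece_def by (rule someI[of _ "quad K d"]) (use r quad_in_Pk in auto)
  moreover then obtain e where e: "piece w K = quad K e" using Pk_imp_quad by blast
  ultimately have "AE z in lebesgue_on (closed_rect K). w z = quad K e z" by (simp add: restricts_to_def)
  with r[unfolded restricts_to_def] have "AE z in lebesgue_on (closed_rect K). quad K d z = quad K e z"
    by eventually_elim simp
  from quad_unique[OF K this] e show ?thesis by simp
qed

lemma grad_quad:
  "grad (quad K d) z = (d 1 + 2 * d 3 * (fst z - xm K) + d 4 * (snd z - ym K),
     d 2 + 2 * d 5 * (snd z - ym K) + d 4 * (fst z - xm K))"
proof -
  have "(quad K d has_derivative (\<lambda>h. (d 1 + 2 * d 3 * (fst z - xm K) + d 4 * (snd z - ym K)) * fst h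
      + (d 2 + 2 * d 5 * (snd z - ym K) + d 4 * (fst z - xm K)) * snd h)) (at z)"
    unfolding quad_def[abs_def] by (auto intro!: derivative_eq_intros simp: algebra_simps)
  from dx_eq[OF this] dy_eq[OF this] show ?thesis by (simp add: grad_def)
qed

text \<open>Along an edge the normal derivative is affine, and its slope term is odd about the
  midpoint of the edge, so \<open>d 4\<close> drops out. \<open>unit_normal\<close> is (1, 0) on
  vertical and (0, -1) on horizontal edges, whence the sign in the second formula.\<close>

lemma edge_mean_quad:
  assumes "nondegenerate K"
  shows "edge_mean ((x, yl K), (x, yr K)) (normal_deriv ((x, yl K), (x, yr K)) (quad K d))
      = d 1 + 2 * d 3 * (x - xm K)"
    and "edge_mean ((xl K, y), (xr K, y)) (normal_deriv ((xl K, y), (xr K, y)) (quad K d))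
      = - (d 2 + 2 * d 5 * (y - ym K))"
proof -
  have lt: "xl K < xr K" "yl K < yr K" using assms by (auto simp: nondegenerate_def)
  have nx: "unit_normal ((x, yl K), (x, yr K)) = (1, 0)" and ny: "unit_normal ((xl K, y), (xr K, y)) = (0, -1)"
    using lt by (simp_all add: unit_normal_def Let_def norm_Pair)
  have mean: "integral {0..1} (\<lambda>t. A + B * ((1 - t) * p + t * q - (p + q) / 2)) = A" for A B p q :: real
  proof -
    have "((\<lambda>t. A * t + B * ((t - t\<^sup>2 / 2) * p + t\<^sup>2 / 2 * q - (p + q) / 2 * t)) has_vector_derivative
        A + B * ((1 - t) * p + t * q - (p + q) / 2)) (at t within {0..1})" for t
      unfolding has_real_derivative_iff_has_vector_derivative[symmetric]
      by (auto intro!: derivative_eq_intros simp: field_simps)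
    from fundamental_theorem_of_calculus[OF zero_le_one this, THEN integral_unique]
    show ?thesis by (simp only:) (simp add: field_simps)
  qed
  have const: "(1 - t) * s + t * s = s" for s t :: real by (simp add: algebra_simps)
  show "edge_mean ((x, yl K), (x, yr K)) (normal_deriv ((x, yl K), (x, yr K)) (quad K d))
      = d 1 + 2 * d 3 * (x - xm K)"
    using mean[of "d 1 + 2 * d 3 * (x - xm K)" "d 4" "yl K" "yr K"]
    by (simp add: edge_mean_def normal_deriv_def nx grad_quad linepath_def const ym_def)
  have eq: "- (d 2 + 2 * d 5 * (y - ym K) + d 4 * ((1 - t) * xl K + t * xr K - xm K))
      = - (d 2 + 2 * d 5 * (y - ym K)) + (- d 4) * ((1 - t) * xl K + t * xr K - xm K)" for t by simp
  show "edge_mean ((xl K, y), (xr K, y)) (normal_deriv ((xl K, y), (xr K, y)) (quad K d))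
      = - (d 2 + 2 * d 5 * (y - ym K))"
    using mean[of "- (d 2 + 2 * d 5 * (y - ym K))" "- d 4" "xl K" "xr K"]
    by (simp add: edge_mean_def normal_deriv_def ny grad_quad linepath_def const eq xm_def)
qed

lemma has_integral_times_quad:
  fixes f g :: "real \<Rightarrow> real"
  assumes f: "continuous_on {xl K..xr K} f" "\<And>k. k \<le> 2 \<Longrightarrow> ((\<lambda>x. f x * (x - xm K) ^ k) has_integral F k) {xl K..xr K}"
    and g: "continuous_on {yl K..yr K} g" "\<And>k. k \<le> 2 \<Longrightarrow> ((\<lambda>y. g y * (y - ym K) ^ k) has_integral G k) {yl K..yr K}"
  shows "((\<lambda>z. f (fst z) * g (snd z) * quad K d z) has_integral
     d 0 * (F 0 * G 0) + d 1 * (F 1 * G 0) + d 2 * (F 0 * G 1) + d 3 * (F 2 * G 0)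
       + d 4 * (F 1 * G 1) + d 5 * (F 0 * G 2)) (closed_rect K)"
proof -
  have t: "((\<lambda>z. c * ((f (fst z) * (fst z - xm K) ^ i) * (g (snd z) * (snd z - ym K) ^ j))) has_integral c * (F i * G j))
      (closed_rect K)" if "i \<le> 2" "j \<le> 2" for c i j
    unfolding closed_rect_def
    by (intro has_integral_mult_right has_integral_times f g that continuous_intros)
  have eq: "f (fst z) * g (snd z) * quad K d z =
      d 0 * ((f (fst z) * (fst z - xm K) ^ 0) * (g (snd z) * (snd z - ym K) ^ 0))
    + d 1 * ((f (fst z) * (fst z - xm K) ^ 1) * (g (snd z) * (snd z - ym K) ^ 0))
    + d 2 * ((f (fst z) * (fst z - xm K) ^ 0) * (g (snd z) * (snd z - ym K) ^ 1))
    + d 3 * ((f (fst z) * (fst z - xm K) ^ 2) * (g (snd z) * (snd z - ym K) ^ 0))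
    + d 4 * ((f (fst z) * (fst z - xm K) ^ 1) * (g (snd z) * (snd z - ym K) ^ 1))
    + d 5 * ((f (fst z) * (fst z - xm K) ^ 0) * (g (snd z) * (snd z - ym K) ^ 2))" for z
    by (simp add: quad_def algebra_simps)
  show ?thesis unfolding eq by (intro has_integral_add t) simp_all
qed

lemma has_integral_centred_powers:
  fixes l r :: real
  assumes "l \<le> r" "k \<le> 2"
  shows "((\<lambda>x. (x - (l + r) / 2) ^ k) has_integral
    (if k = 0 then r - l else if k = 1 then 0 else ((r - l) / 2) ^ 3 * 2 / 3)) {l..r}"
proof -
  have d: "((\<lambda>x. (x - (l + r) / 2) ^ (k + 1) / real (k + 1)) has_vector_derivative (x - (l + r) / 2) ^ k) (at x within {l..r})" for x
  proof -
    have "((\<lambda>x. x - (l + r) / 2) has_real_derivative 1) (at x within {l..r})"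
      by (auto intro!: derivative_eq_intros)
    from DERIV_cdivide[OF DERIV_power_Suc[OF this, of k], of "real (k + 1)"]
    show ?thesis
      unfolding has_real_derivative_iff_has_vector_derivative[symmetric] by simp
  qed
  have "k = 0 \<or> k = 1 \<or> k = 2" using assms by auto
  moreover have "(r - (l + r) / 2) ^ (k + 1) / real (k + 1) - (l - (l + r) / 2) ^ (k + 1) / real (k + 1)
      = (if k = 0 then r - l else if k = 1 then 0 else ((r - l) / 2) ^ 3 * 2 / 3)"
  proof -
    have eq: "r - (l + r) / 2 = (r - l) / 2" "l - (l + r) / 2 = - ((r - l) / 2)" by (simp_all add: field_simps)
    show ?thesis unfolding eq using \<open>k = 0 \<or> k = 1 \<or> k = 2\<close>
      by (elim disjE) (simp_all add: power3_eq_cube power2_eq_square)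
  qed
  ultimately show ?thesis
    using fundamental_theorem_of_calculus[OF assms(1) d] by simp
qed

lemma has_integral_quad:
  assumes "nondegenerate K"
  shows "(quad K d has_integral hx K * hy K * (d 0 + d 3 * (hx K / 2)\<^sup>2 / 3 + d 5 * (hy K / 2)\<^sup>2 / 3)) (closed_rect K)"
proof -
  have lt: "xl K \<le> xr K" "yl K \<le> yr K" using assms by (auto simp: nondegenerate_def)
  define m where "m h k = (if k = (0::nat) then h else if k = 1 then 0 else (h / 2) ^ 3 * 2 / 3)" for h :: real and k
  have "((\<lambda>z. 1 * 1 * quad K d z) has_integral
     d 0 * (m (hx K) 0 * m (hy K) 0) + d 1 * (m (hx K) 1 * m (hy K) 0) + d 2 * (m (hx K) 0 * m (hy K) 1)
       + d 3 * (m (hx K) 2 * m (hy K) 0) + d 4 * (m (hx K) 1 * m (hy K) 1) + d 5 * (m (hx K) 0 * m (hy K) 2))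
     (closed_rect K)"
    by (rule has_integral_times_quad)
      (use has_integral_centred_powers[OF lt(1)] has_integral_centred_powers[OF lt(2)] in
        \<open>auto simp: m_def hx_def hy_def xm_def ym_def simp del: power_divide\<close>)
  moreover have "d 0 * (m (hx K) 0 * m (hy K) 0) + d 1 * (m (hx K) 1 * m (hy K) 0) + d 2 * (m (hx K) 0 * m (hy K) 1)
       + d 3 * (m (hx K) 2 * m (hy K) 0) + d 4 * (m (hx K) 1 * m (hy K) 1) + d 5 * (m (hx K) 0 * m (hy K) 2)
     = hx K * hy K * (d 0 + d 3 * (hx K / 2)\<^sup>2 / 3 + d 5 * (hy K / 2)\<^sup>2 / 3)"
    by (simp add: m_def field_simps power2_eq_square power3_eq_cube)
  ultimately show ?thesis by simp
qed

lemma integral_grad_quad: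
  assumes "nondegenerate K"
  shows "(LINT z|lebesgue_on (closed_rect K). grad (quad K d) z \<bullet> grad (quad K e) z)
    = hx K * hy K * (d 1 * e 1 + d 2 * e 2 + (4 * d 3 * e 3 + d 4 * e 4) * (hx K / 2)\<^sup>2 / 3
        + (4 * d 5 * e 5 + d 4 * e 4) * (hy K / 2)\<^sup>2 / 3)"
proof -
  \<comment> \<open>The inner product of the two gradients is again a quadratic in centred
    coordinates; only its coefficients 0, 3 and 5 survive integration.\<close>
  define c where "c i = (if i = 0 then d 1 * e 1 + d 2 * e 2
    else if i = 1 then 2 * d 1 * e 3 + 2 * d 3 * e 1 + d 2 * e 4 + d 4 * e 2
    else if i = 2 then 2 * d 2 * e 5 + 2 * d 5 * e 2 + d 1 * e 4 + d 4 * e 1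
    else if i = 3 then 4 * d 3 * e 3 + d 4 * e 4
    else if i = 4 then 2 * d 3 * e 4 + 2 * d 4 * e 3 + 2 * d 5 * e 4 + 2 * d 4 * e 5
    else 4 * d 5 * e 5 + d 4 * e 4)" for i :: nat
  have eq: "grad (quad K d) z \<bullet> grad (quad K e) z = quad K c z" for z
    by (simp add: grad_quad quad_def c_def) (simp add: algebra_simps power2_eq_square)
  have "(LINT z|lebesgue_on (closed_rect K). quad K c z) = integral (closed_rect K) (quad K c)"
    by (intro lebesgue_integral_eq_integral integrable_closed_rect continuous_quad) simp
  also have "\<dots> = hx K * hy K * (c 0 + c 3 * (hx K / 2)\<^sup>2 / 3 + c 5 * (hy K / 2)\<^sup>2 / 3)"
    by (rule integral_unique[OF has_integral_quad[OF assms]])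
  finally show ?thesis unfolding eq by (simp add: c_def)
qed

lemma AE_open_rect: "AE z in lebesgue_on (closed_rect K). z \<in> open_rect K"
proof -
  have "closed_rect K - open_rect K \<in> null_sets lebesgue"
    unfolding closed_rect_def open_rect_def using negligible_frontier_interval negligible_iff_null_sets by blast
  then have "AE z in lebesgue. z \<notin> closed_rect K - open_rect K" by (rule AE_not_in)
  then show ?thesis by (auto simp: AE_restrict_space_iff)
qed

lemma grid_integral:
  fixes f :: field
  assumes G: "rect_grid \<Omega> G" and f: "integrable (lebesgue_on (open_rect \<Omega>)) f"
    and p: "\<And>K. K \<in> G \<Longrightarrow> AE z in lebesgue_on (closed_rect K). f z = p K z"
    and I: "\<And>K. K \<in> G \<Longrightarrow> (p K has_integral I K) (closed_rect K)"
  shows "(LINT z|lebesgue_on (open_rect \<Omega>). f z) = (\<Sum>K\<in>G. I K)"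
proof -
  have fI: "(f has_integral I K) (closed_rect K)" if "K \<in> G" for K
  proof -
    have "AE z in lebesgue. z \<in> closed_rect K \<longrightarrow> f z = p K z"
      using p[OF that] by (simp add: AE_restrict_space_iff)
    then obtain N where N: "N \<in> null_sets lebesgue" "{z. \<not> (z \<in> closed_rect K \<longrightarrow> f z = p K z)} \<subseteq> N"
      unfolding eventually_ae_filter by auto
    show ?thesis
      by (rule has_integral_spike[OF _ _ I[OF that], of N]) (use N in \<open>auto simp: negligible_iff_null_sets\<close>)
  qed
  have "negligible (closed_rect K \<inter> closed_rect L)" if "K \<in> G" "L \<in> G" "K \<noteq> L" for K L
  proof (rule negligible_subset)
    show "negligible ((closed_rect K - open_rect K) \<union> (closed_rect L - open_rect L))"
      unfolding closed_rect_def open_rect_def by (intro negligible_Un negligible_frontier_interval)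
    show "closed_rect K \<inter> closed_rect L \<subseteq> (closed_rect K - open_rect K) \<union> (closed_rect L - open_rect L)"
      using G that unfolding rect_grid_def by blast
  qed
  then have "(f has_integral (\<Sum>K\<in>G. I K)) (\<Union>K\<in>G. closed_rect K)"
    using G by (intro has_integral_UN fI) (auto simp: rect_grid_def pairwise_def)
  then show ?thesis
    using G by (simp add: integral_open_rect[OF f] integral_unique rect_grid_def)
qed

section \<open>The discrete sine mode\<close>

text \<open>For s \<noteq> 0 these are the mean values over -1 \<le> u \<le> 1 of cos (s u), u sin
  (s u) and u^2 cos (s u).\<close>

definition \<kappa>\<^sub>0 :: "real \<Rightarrow> real" where "\<kappa>\<^sub>0 s = sin s / s"
definition \<kappa>\<^sub>1 :: "real \<Rightarrow> real" where "\<kappa>\<^sub>1 s = (sin s - s * cos s) / s\<^sup>2"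
definition \<kappa>\<^sub>2 :: "real \<Rightarrow> real" where "\<kappa>\<^sub>2 s = (s\<^sup>2 * sin s + 2 * s * cos s - 2 * sin s) / s ^ 3"

text \<open>The antiderivatives come from repeated integration by parts. In the results the position
  of the interval is separated from its width: by parity the even moments see only the sine at the
  centre and the odd one only the cosine.\<close>

lemma has_integral_sin_moments:
  fixes \<mu> a m l :: real
  assumes "0 < a" "\<mu> \<noteq> 0"
  shows "((\<lambda>x. sin (\<mu> * (x - l))) has_integral 2 * a * (sin (\<mu> * (m - l)) * \<kappa>\<^sub>0 (\<mu> * a))) {m - a..m + a}" (is ?I0)
    and "((\<lambda>x. sin (\<mu> * (x - l)) * (x - m)) has_integral 2 * a * (a * cos (\<mu> * (m - l)) * \<kappa>\<^sub>1 (\<mu> * a))) {m - a..m + a}" (is ?I1)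
    and "((\<lambda>x. sin (\<mu> * (x - l)) * (x - m)\<^sup>2) has_integral 2 * a * (a\<^sup>2 * sin (\<mu> * (m - l)) * \<kappa>\<^sub>2 (\<mu> * a))) {m - a..m + a}" (is ?I2)
proof -
  have le: "m - a \<le> m + a" using assms by simp
  define \<theta> where "\<theta> = \<mu> * (m - l)"
  have arg: "\<mu> * (m + a - l) = \<theta> + \<mu> * a" "\<mu> * (m - a - l) = \<theta> - \<mu> * a"
    by (simp_all add: \<theta>_def algebra_simps)
  have "((\<lambda>x. - cos (\<mu> * (x - l)) / \<mu>) has_vector_derivative sin (\<mu> * (x - l))) (at x within A)" for x A
    unfolding has_real_derivative_iff_has_vector_derivative[symmetric]
    using assms by (auto intro!: derivative_eq_intros)
  from fundamental_theorem_of_calculus[OF le this]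
  show ?I0
    by (rule has_integral_eq_rhs)
      (unfold \<theta>_def[symmetric] arg, use assms in \<open>simp add: \<kappa>\<^sub>0_def cos_add cos_diff field_simps\<close>)
  have "((\<lambda>x. - (x - m) * cos (\<mu> * (x - l)) / \<mu> + sin (\<mu> * (x - l)) / \<mu>\<^sup>2) has_vector_derivative
      sin (\<mu> * (x - l)) * (x - m)) (at x within A)" for x A
    unfolding has_real_derivative_iff_has_vector_derivative[symmetric]
    using assms by (auto intro!: derivative_eq_intros simp: field_simps power2_eq_square)
  from fundamental_theorem_of_calculus[OF le this]
  show ?I1
    by (rule has_integral_eq_rhs)
      (unfold \<theta>_def[symmetric] arg, use assms in \<open>simp add: \<kappa>\<^sub>1_def cos_add cos_diff sin_add sin_diff field_simps power2_eq_square\<close>)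
  have "((\<lambda>x. - (x - m)\<^sup>2 * cos (\<mu> * (x - l)) / \<mu> + 2 * (x - m) * sin (\<mu> * (x - l)) / \<mu>\<^sup>2 + 2 * cos (\<mu> * (x - l)) / \<mu> ^ 3)
      has_vector_derivative sin (\<mu> * (x - l)) * (x - m)\<^sup>2) (at x within A)" for x A
    unfolding has_real_derivative_iff_has_vector_derivative[symmetric]
    using assms by (auto intro!: derivative_eq_intros simp: field_simps power2_eq_square power3_eq_cube)
  from fundamental_theorem_of_calculus[OF le this]
  show ?I2
    by (rule has_integral_eq_rhs)
      (unfold \<theta>_def[symmetric] arg, use assms in \<open>simp add: \<kappa>\<^sub>2_def cos_add cos_diff sin_add sin_diff field_simps power2_eq_square power3_eq_cube\<close>)
qed

text \<open>The symbol of the discrete problem: on the sine mode the stiffness form acts as multiplication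
  of the nodal values by \<open>mode_stiff\<close> and the load functional as multiplication by \<open>mode_load\<close>,
  both relative to the area \<open>4 a b\<close> of a cell.\<close>

definition mode_stiff :: "real \<Rightarrow> real \<Rightarrow> real \<Rightarrow> real \<Rightarrow> real" where
  "mode_stiff \<mu> \<nu> a b = (let s = \<mu> * a; t = \<nu> * b in
     (sin s)\<^sup>2 * (cos t)\<^sup>2 / a\<^sup>2 * (1 + (sin s)\<^sup>2 / (3 * (cos s)\<^sup>2))
   + (cos s)\<^sup>2 * (sin t)\<^sup>2 / b\<^sup>2 * (1 + (sin t)\<^sup>2 / (3 * (cos t)\<^sup>2))
   + (sin s)\<^sup>2 * (sin t)\<^sup>2 * (a\<^sup>2 + b\<^sup>2) / (3 * a\<^sup>2 * b\<^sup>2))"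

text \<open>With u from -1 to 1 across a cell, the outer summands are the mean of cos (s u) against
  the even profile cos s + h (1 - u^2), where h = sin^2 s / (2 cos s), and the middle one is the
  mean of sin (s u) against the odd profile u sin s.\<close>

definition load_factor :: "real \<Rightarrow> real" where
  "load_factor s = \<kappa>\<^sub>0 s * cos s + \<kappa>\<^sub>1 s * sin s + (sin s)\<^sup>2 / (2 * cos s) * (\<kappa>\<^sub>0 s - \<kappa>\<^sub>2 s)"

definition mode_load :: "real \<Rightarrow> real \<Rightarrow> real" where
  "mode_load s t = \<kappa>\<^sub>0 t * cos t * load_factor s + \<kappa>\<^sub>0 s * cos s * load_factor t
     - \<kappa>\<^sub>0 s * \<kappa>\<^sub>0 t * cos s * cos t + \<kappa>\<^sub>1 s * sin s * (\<kappa>\<^sub>1 t * sin t)"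

text \<open>Coefficients of the quadratic polynomial with the nodal values \<open>\<alpha> sin sin\<close> and with matching
  normal derivatives on opposite edges; \<open>Sx, Cx, Sy, Cy\<close> are the sines and cosines at the
  centre of the cell.\<close>

definition mode_coeff :: "real \<Rightarrow> real \<Rightarrow> real \<Rightarrow> real \<Rightarrow> real \<Rightarrow> real \<Rightarrow> real \<Rightarrow> real \<Rightarrow> real \<Rightarrow> nat \<Rightarrow> real" where
  "mode_coeff \<alpha> a b s t Sx Cx Sy Cy i =
    (if i = 0 then \<alpha> * Sx * Sy * (cos s * cos t + (sin s)\<^sup>2 * cos t / (2 * cos s) + (sin t)\<^sup>2 * cos s / (2 * cos t))
     else if i = 1 then \<alpha> * Cx * Sy * sin s * cos t / a
     else if i = 2 then \<alpha> * Sx * Cy * cos s * sin t / b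
     else if i = 3 then - (\<alpha> * Sx * Sy * (sin s)\<^sup>2 * cos t / (2 * a\<^sup>2 * cos s))
     else if i = 4 then \<alpha> * Cx * Cy * sin s * sin t / (a * b)
     else - (\<alpha> * Sx * Sy * (sin t)\<^sup>2 * cos s / (2 * b\<^sup>2 * cos t)))"

text \<open>\<open>s\<close>, \<open>c\<close> and \<open>s'\<close>, \<open>c'\<close> are sine and
  cosine at a corner, the signs \<open>e\<close> and \<open>f\<close> tell which corner, and the
  bracketed factors are the values at the centre rotated back from there. Because the signs square
  to 1, the coefficient of s s' is the same at all four corners, so the single equation
  \<open>Q\<close> removes the double sine everywhere.\<close>

lemma rotate_expansion:
  fixes Q A00 A10 A01 A11 :: real
  assumes Q: "A00 * p * q + A10 * \<sigma> * q + A01 * p * \<tau> + A11 * \<sigma> * \<tau> = 0"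
    and e: "e\<^sup>2 = 1" "f\<^sup>2 = 1"
  shows "A00 * (s * p - e * c * \<sigma>) * (s' * q - f * c' * \<tau>) + e * A10 * (c * p + e * s * \<sigma>) * (s' * q - f * c' * \<tau>)
     + f * A01 * (s * p - e * c * \<sigma>) * (c' * q + f * s' * \<tau>) + e * f * A11 * (c * p + e * s * \<sigma>) * (c' * q + f * s' * \<tau>)
   = e * (- A00 * \<sigma> * q + A10 * p * q - A01 * \<sigma> * \<tau> + A11 * p * \<tau>) * (c * s')
     + f * (- A00 * p * \<tau> - A10 * \<sigma> * \<tau> + A01 * p * q + A11 * \<sigma> * q) * (s * c')
     + e * f * (A00 * \<sigma> * \<tau> - A10 * p * \<tau> - A01 * \<sigma> * q + A11 * p * q) * (c * c')"
  using Q e by algebra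

text \<open>The left side is the residual of one cell, with trigonometric values at its centre. The
  identities \<open>bx\<close> and \<open>bby\<close> trade the terms with \<open>E3\<close> and
  \<open>E5\<close> for differences of edge fluxes, at the cost of terms in \<open>X\<close> and
  \<open>Y\<close> that turn \<open>A10\<close>, \<open>A01\<close> into \<open>A10'\<close>,
  \<open>A01'\<close>. What remains is a combination of the four vertex values; rotating to each
  corner expresses its coefficient by trigonometric values at that corner, without the double sine.
  The signs then arrange every term as right minus left or top minus bottom.\<close>

lemma cell_residual:
  fixes p q \<sigma> \<tau> a b :: real
  assumes pyth: "p\<^sup>2 + \<sigma>\<^sup>2 = 1" "q\<^sup>2 + \<tau>\<^sup>2 = 1" and nz: "p \<noteq> 0" "q \<noteq> 0"
    and A10': "A10' = A10 - \<sigma> / (2 * p) * B3" and A01': "A01' = A01 - \<tau> / (2 * q) * B5"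
    and Q: "A00 * p * q + A10' * \<sigma> * q + A01' * p * \<tau> + A11 * \<sigma> * \<tau> = 0"
    and Q10: "Q10 = - A00 * \<sigma> * q + A10' * p * q - A01' * \<sigma> * \<tau> + A11 * p * \<tau>"
    and Q01: "Q01 = - A00 * p * \<tau> - A10' * \<sigma> * \<tau> + A01' * p * q + A11 * \<sigma> * q"
    and Q11: "Q11 = A00 * \<sigma> * \<tau> - A10' * p * \<tau> - A01' * \<sigma> * q + A11 * p * q"
    and x: "sr = Sx * p + Cx * \<sigma>" "cr = Cx * p - Sx * \<sigma>" "sl = Sx * p - Cx * \<sigma>" "cl = Cx * p + Sx * \<sigma>"
    and y: "st = Sy * q + Cy * \<tau>" "ct = Cy * q - Sy * \<tau>" "sb = Sy * q - Cy * \<tau>" "cb = Cy * q + Sy * \<tau>"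
    and w: "wrt = W + X + Y + Z" "wrb = W + X - Y - Z" "wlt = W - X + Y - Z" "wlb = W - X - Y + Z"
    and E: "E3 = e3 * a\<^sup>2" "E5 = e5 * b\<^sup>2" "X = e1 * a" "Y = e2 * b"
  shows "A00 * Sx * Sy * W + A10 * Cx * Sy * X + A01 * Sx * Cy * Y + A11 * Cx * Cy * Z
      + B3 * Sx * Sy * E3 + B5 * Sx * Sy * E5
    = Q10 / 4 * ((wrt * st + wrb * sb) * cr - (wlt * st + wlb * sb) * cl)
      + Q01 / 4 * ((wrt * sr + wlt * sl) * ct - (wrb * sr + wlb * sl) * cb)
      + Q11 / 4 * ((wrt * ct - wrb * cb) * cr - (wlt * ct - wlb * cb) * cl)
      + B3 * Sy * a / (4 * p) * (sr * (e1 + 2 * e3 * a) - sl * (e1 - 2 * e3 * a))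
      + B5 * Sx * b / (4 * q) * (st * (e2 + 2 * e5 * b) - sb * (e2 - 2 * e5 * b))"
proof -
  have x_back: "sr * p - cr * \<sigma> = Sx" "sl * p + cl * \<sigma> = Sx" "cr * p + sr * \<sigma> = Cx" "cl * p - sl * \<sigma> = Cx"
    using pyth(1) unfolding x by algebra+
  have y_back: "st * q - ct * \<tau> = Sy" "sb * q + cb * \<tau> = Sy" "ct * q + st * \<tau> = Cy" "cb * q - sb * \<tau> = Cy"
    using pyth(2) unfolding y by algebra+
  note ex = rotate_expansion[OF Q, folded Q10 Q01 Q11]
  have corners:
    "A00 * Sx * Sy + A10' * Cx * Sy + A01' * Sx * Cy + A11 * Cx * Cy = Q10 * (cr * st) + Q01 * (sr * ct) + Q11 * (cr * ct)"
    "A00 * Sx * Sy + A10' * Cx * Sy - A01' * Sx * Cy - A11 * Cx * Cy = Q10 * (cr * sb) - Q01 * (sr * cb) - Q11 * (cr * cb)"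
    "A00 * Sx * Sy - A10' * Cx * Sy + A01' * Sx * Cy - A11 * Cx * Cy = - Q10 * (cl * st) + Q01 * (sl * ct) - Q11 * (cl * ct)"
    "A00 * Sx * Sy - A10' * Cx * Sy - A01' * Sx * Cy + A11 * Cx * Cy = - Q10 * (cl * sb) - Q01 * (sl * cb) + Q11 * (cl * cb)"
    using ex[of 1 1 sr cr st ct] ex[of 1 "-1" sr cr sb cb] ex[of "-1" 1 sl cl st ct] ex[of "-1" "-1" sl cl sb cb]
    by (simp_all add: x_back y_back)
  have "A00 * Sx * Sy * W + A10' * Cx * Sy * X + A01' * Sx * Cy * Y + A11 * Cx * Cy * Z
    = ((A00 * Sx * Sy + A10' * Cx * Sy + A01' * Sx * Cy + A11 * Cx * Cy) * wrt
      + (A00 * Sx * Sy + A10' * Cx * Sy - A01' * Sx * Cy - A11 * Cx * Cy) * wrb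
      + (A00 * Sx * Sy - A10' * Cx * Sy + A01' * Sx * Cy - A11 * Cx * Cy) * wlt
      + (A00 * Sx * Sy - A10' * Cx * Sy - A01' * Sx * Cy + A11 * Cx * Cy) * wlb) / 4"
    unfolding w by (simp add: algebra_simps)
  also have "\<dots> = Q10 / 4 * ((wrt * st + wrb * sb) * cr - (wlt * st + wlb * sb) * cl)
      + Q01 / 4 * ((wrt * sr + wlt * sl) * ct - (wrb * sr + wlb * sl) * cb)
      + Q11 / 4 * ((wrt * ct - wrb * cb) * cr - (wlt * ct - wlb * cb) * cl)"
    unfolding corners by (simp add: algebra_simps add_divide_distrib diff_divide_distrib)
  finally have nodal: "A00 * Sx * Sy * W + A10' * Cx * Sy * X + A01' * Sx * Cy * Y + A11 * Cx * Cy * Z = \<dots>" .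
  have bx: "B3 * Sx * Sy * E3 = B3 * Sy * a / (4 * p) * (sr * (e1 + 2 * e3 * a) - sl * (e1 - 2 * e3 * a))
      - \<sigma> / (2 * p) * B3 * Cx * Sy * X"
    using nz unfolding x E by (simp add: field_simps power2_eq_square)
  have bby: "B5 * Sx * Sy * E5 = B5 * Sx * b / (4 * q) * (st * (e2 + 2 * e5 * b) - sb * (e2 - 2 * e5 * b))
      - \<tau> / (2 * q) * B5 * Sx * Cy * Y"
    using nz unfolding y E by (simp add: field_simps power2_eq_square)
  have "A10' * Cx * Sy * X = A10 * Cx * Sy * X - \<sigma> / (2 * p) * B3 * Cx * Sy * X"
    "A01' * Sx * Cy * Y = A01 * Sx * Cy * Y - \<tau> / (2 * q) * B5 * Sx * Cy * Y"
    unfolding A10' A01' by (simp_all add: algebra_simps)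
  with nodal bx bby show ?thesis by linarith
qed

text \<open>In each coefficient the summand with \<alpha> stems from the stiffness form and the
  other from the load. The whole combination is \<alpha> times \<open>mode_stiff\<close> minus
  \<open>mode_load\<close>, so the equation defining the amplitude is exactly the hypothesis
  \<open>Q\<close> of \<open>cell_residual\<close>.\<close>

lemma symbol_eq:
  fixes a b \<alpha> \<mu> \<nu> :: real
  defines "s \<equiv> \<mu> * a" and "t \<equiv> \<nu> * b"
  assumes nz: "a \<noteq> 0" "b \<noteq> 0" "cos s \<noteq> 0" "cos t \<noteq> 0"
    and \<alpha>: "\<alpha> * mode_stiff \<mu> \<nu> a b = mode_load s t"
    and A00: "A00 = - (\<kappa>\<^sub>0 s * \<kappa>\<^sub>0 t)"
    and A10: "A10 = \<alpha> * sin s * cos t / a\<^sup>2 - \<kappa>\<^sub>1 s * \<kappa>\<^sub>0 t"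
    and A01: "A01 = \<alpha> * cos s * sin t / b\<^sup>2 - \<kappa>\<^sub>0 s * \<kappa>\<^sub>1 t"
    and A11: "A11 = \<alpha> * sin s * sin t * (a\<^sup>2 + b\<^sup>2) / (3 * a\<^sup>2 * b\<^sup>2) - \<kappa>\<^sub>1 s * \<kappa>\<^sub>1 t"
    and B3: "B3 = (\<kappa>\<^sub>0 s - \<kappa>\<^sub>2 s) * \<kappa>\<^sub>0 t - 2 / 3 * \<alpha> * (sin s)\<^sup>2 * cos t / (cos s * a\<^sup>2)"
    and B5: "B5 = \<kappa>\<^sub>0 s * (\<kappa>\<^sub>0 t - \<kappa>\<^sub>2 t) - 2 / 3 * \<alpha> * (sin t)\<^sup>2 * cos s / (cos t * b\<^sup>2)"
  shows "A00 * cos s * cos t + (A10 - sin s / (2 * cos s) * B3) * sin s * cos t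
    + (A01 - sin t / (2 * cos t) * B5) * cos s * sin t + A11 * sin s * sin t = 0"
proof -
  define T1 where "T1 = ((sin s)\<^sup>2 * (cos t)\<^sup>2 / a\<^sup>2 * (1 + (sin s)\<^sup>2 / (3 * (cos s)\<^sup>2)))"
  define T2 where "T2 = ((cos s)\<^sup>2 * (sin t)\<^sup>2 / b\<^sup>2 * (1 + (sin t)\<^sup>2 / (3 * (cos t)\<^sup>2)))"
  define T3 where "T3 = ((sin s)\<^sup>2 * (sin t)\<^sup>2 * (a\<^sup>2 + b\<^sup>2) / (3 * a\<^sup>2 * b\<^sup>2))"
  have x: "(A10 - sin s / (2 * cos s) * B3) * sin s * cos t =
     \<alpha> * T1 - \<kappa>\<^sub>0 t * cos t * (load_factor s - \<kappa>\<^sub>0 s * cos s)"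
    unfolding A10 B3 load_factor_def T1_def using nz by (simp add: field_simps power2_eq_square)
  have y: "(A01 - sin t / (2 * cos t) * B5) * cos s * sin t =
     \<alpha> * T2 - \<kappa>\<^sub>0 s * cos s * (load_factor t - \<kappa>\<^sub>0 t * cos t)"
    unfolding A01 B5 load_factor_def T2_def using nz by (simp add: field_simps power2_eq_square)
  have z: "A11 * sin s * sin t = \<alpha> * T3 - \<kappa>\<^sub>1 s * sin s * (\<kappa>\<^sub>1 t * sin t)"
    unfolding A11 T3_def by (simp add: algebra_simps power2_eq_square)
  have "mode_stiff \<mu> \<nu> a b = T1 + T2 + T3"
    unfolding mode_stiff_def s_def[symmetric] t_def[symmetric] Let_def T1_def T2_def T3_def ..
  with \<alpha> have "\<alpha> * (T1 + T2 + T3) = mode_load s t" by simp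
  then show ?thesis
    unfolding x y z A00 mode_load_def by (simp add: algebra_simps)
qed

lemma L2_sum:
  assumes "finite F" "\<And>i. i \<in> F \<Longrightarrow> f i \<in> L2 S"
  shows "(\<lambda>z. \<Sum>i\<in>F. f i z) \<in> L2 S"
  using assms
proof (induction F rule: finite_induct)
  case empty
  then show ?case by (simp add: L2_def)
next
  case (insert i F)
  have "(\<lambda>z. 0) \<in> L2 S" by (simp add: L2_def)
  then have "(\<lambda>z. f i z - (0 - (\<Sum>i\<in>F. f i z))) \<in> L2 S"
    using insert by (intro L2_diff) auto
  then show ?case using insert by simp
qed

section \<open>The discrete sine mode solves the discrete problem\<close>

text \<open>Half side lengths \<open>a\<close> and \<open>b\<close> are used because the corners of
  a cell differ from its centre by the phases \<mu> a and \<nu> b. \<open>periodic\<close> makes the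
  mode vanish on the right and upper sides of \<Omega>.\<close>

locale sine_grid =
  fixes \<Omega> :: rect and G :: "rect set" and \<mu> \<nu> a b \<alpha> :: real
  assumes nondeg: "nondegenerate \<Omega>" and grid: "rect_grid \<Omega> G" and unif: "uniform_grid G"
    and size: "\<And>K. K \<in> G \<Longrightarrow> hx K = 2 * a \<and> hy K = 2 * b"
    and ab: "0 < a" "0 < b" and \<mu>\<nu>: "0 < \<mu>" "0 < \<nu>"
    and periodic: "sin (\<mu> * hx \<Omega>) = 0" "sin (\<nu> * hy \<Omega>) = 0"
    and cos_nz: "cos (\<mu> * a) \<noteq> 0" "cos (\<nu> * b) \<noteq> 0"
    and amplitude: "\<alpha> * mode_stiff \<mu> \<nu> a b = mode_load (\<mu> * a) (\<nu> * b)"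
begin

definition SX :: "real \<Rightarrow> real" where "SX x = sin (\<mu> * (x - xl \<Omega>))"
definition CX :: "real \<Rightarrow> real" where "CX x = cos (\<mu> * (x - xl \<Omega>))"
definition SY :: "real \<Rightarrow> real" where "SY y = sin (\<nu> * (y - yl \<Omega>))"
definition CY :: "real \<Rightarrow> real" where "CY y = cos (\<nu> * (y - yl \<Omega>))"

definition cell_coeff :: "rect \<Rightarrow> nat \<Rightarrow> real" where
  "cell_coeff K = mode_coeff \<alpha> a b (\<mu> * a) (\<nu> * b) (SX (xm K)) (CX (xm K)) (SY (ym K)) (CY (ym K))"

text \<open>The function is 0 on the edges of the grid, a null set; its traces there are taken from
  the polynomial pieces.\<close>

definition discrete_mode :: field where
  "discrete_mode z = (\<Sum>K\<in>G. indicator (open_rect K) z * quad K (cell_coeff K) z)"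

lemma sine_mode_SX_SY: "sine_mode \<Omega> \<mu> \<nu> z = SX (fst z) * SY (snd z)"
  by (simp add: sine_mode_def SX_def SY_def)

lemma cell_nondeg: "K \<in> G \<Longrightarrow> nondegenerate K"
  using grid by (auto simp: rect_grid_def)

lemma cell_bounds:
  assumes "K \<in> G"
  shows "xl K = xm K - a" "xr K = xm K + a" "yl K = ym K - b" "yr K = ym K + b"
  using size[OF assms] by (simp_all add: xm_def ym_def hx_def hy_def field_simps)

lemma rotations:
  shows "SX (x + a) = SX x * cos (\<mu> * a) + CX x * sin (\<mu> * a)" (is ?a) and "SX (x - a) = SX x * cos (\<mu> * a) - CX x * sin (\<mu> * a)" (is ?b) and
  "CX (x + a) = CX x * cos (\<mu> * a) - SX x * sin (\<mu> * a)" (is ?c) and "CX (x - a) = CX x * cos (\<mu> * a) + SX x * sin (\<mu> * a)" (is ?d) and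
  "SY (y + b) = SY y * cos (\<nu> * b) + CY y * sin (\<nu> * b)" (is ?e) and "SY (y - b) = SY y * cos (\<nu> * b) - CY y * sin (\<nu> * b)" (is ?f) and
  "CY (y + b) = CY y * cos (\<nu> * b) - SY y * sin (\<nu> * b)" (is ?g) and "CY (y - b) = CY y * cos (\<nu> * b) + SY y * sin (\<nu> * b)" (is ?h)
proof -
  have arg: "\<mu> * (x + a - xl \<Omega>) = \<mu> * (x - xl \<Omega>) + \<mu> * a" "\<mu> * (x - a - xl \<Omega>) = \<mu> * (x - xl \<Omega>) - \<mu> * a"
    "\<nu> * (y + b - yl \<Omega>) = \<nu> * (y - yl \<Omega>) + \<nu> * b" "\<nu> * (y - b - yl \<Omega>) = \<nu> * (y - yl \<Omega>) - \<nu> * b"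
    by (simp_all add: algebra_simps)
  show ?a ?b ?c ?d ?e ?f ?g ?h
    unfolding SX_def CX_def SY_def CY_def arg by (simp_all add: sin_add sin_diff cos_add cos_diff)
qed

lemma boundary_zero: "SX (xl \<Omega>) = 0" "SX (xr \<Omega>) = 0" "SY (yl \<Omega>) = 0" "SY (yr \<Omega>) = 0"
  using periodic by (auto simp: SX_def SY_def hx_def hy_def)

text \<open>At a vertex the pure squares cancel the two correction terms of the constant
  coefficient, and the addition theorems for the two phases remain.\<close>

lemma quad_coeff_vertex:
  assumes K: "K \<in> G" and z: "z \<in> vertices K"
  shows "quad K (cell_coeff K) z = \<alpha> * sine_mode \<Omega> \<mu> \<nu> z"
  using z ab cos_nz
  by (auto simp: vertices_def cell_bounds[OF K] sine_mode_SX_SY rotations quad_def cell_coeff_def mode_coeff_def)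
     (simp_all add: field_simps power2_eq_square)

text \<open>A value that refers to the edge alone, hence is common to both adjacent cells. Equal
  first coordinates of the end points single out the vertical edges; the sign for horizontal edges
  follows their normal (0, -1).\<close>

definition edge_value :: "point \<times> point \<Rightarrow> real" where
  "edge_value e = (if fst (fst e) = fst (snd e)
     then \<alpha> * (sin (\<mu> * a) / (a * cos (\<mu> * a))) * cos (\<nu> * b) * CX (fst (fst e)) * SY ((snd (fst e) + snd (snd e)) / 2)
     else - (\<alpha> * (sin (\<nu> * b) / (b * cos (\<nu> * b))) * cos (\<mu> * a) * SX ((fst (fst e) + fst (snd e)) / 2) * CY (snd (fst e))))"

text \<open>The square coefficient is chosen such that its contribution rotates the cosine from the
  centre of the cell to the edge, by the addition theorem. This is the recurrence between opposite
  edges, solved by a cosine.\<close>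

lemma edge_mean_cell_coeff:
  assumes K: "K \<in> G" and e: "e \<in> edges K"
  shows "edge_mean e (normal_deriv e (quad K (cell_coeff K))) = edge_value e"
proof -
  note m = edge_mean_quad[OF cell_nondeg[OF K]]
  have lt: "xl K < xr K" "yl K < yr K" using cell_nondeg[OF K] by (auto simp: nondegenerate_def)
  have mid: "(xl K + xr K) / 2 = xm K" "(yl K + yr K) / 2 = ym K" by (simp_all add: xm_def ym_def)
  have x: "edge_mean ((x, yl K), (x, yr K)) (normal_deriv ((x, yl K), (x, yr K)) (quad K (cell_coeff K)))
      = edge_value ((x, yl K), (x, yr K))" if "x = xl K \<or> x = xr K" for x
    using that ab cos_nz unfolding m edge_value_def
    by (auto simp: mid cell_coeff_def mode_coeff_def cell_bounds(1,2)[OF K] rotations)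
       (simp_all add: field_simps power2_eq_square)
  have y: "edge_mean ((xl K, y), (xr K, y)) (normal_deriv ((xl K, y), (xr K, y)) (quad K (cell_coeff K)))
      = edge_value ((xl K, y), (xr K, y))" if "y = yl K \<or> y = yr K" for y
    using that ab cos_nz lt unfolding m edge_value_def
    by (auto simp: mid cell_coeff_def mode_coeff_def cell_bounds(3,4)[OF K] rotations)
       (simp_all add: field_simps power2_eq_square)
  from e show ?thesis unfolding edges_def using x y by auto
qed

lemma discrete_mode_on_cell:
  assumes K: "K \<in> G" and z: "z \<in> open_rect K"
  shows "discrete_mode z = quad K (cell_coeff K) z"
proof -
  have "z \<notin> open_rect L" if "L \<in> G" "L \<noteq> K" for L
    using grid K z that unfolding rect_grid_def by blast
  then have "discrete_mode z = (\<Sum>L\<in>G. if L = K then quad K (cell_coeff K) z else 0)"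
    unfolding discrete_mode_def using z by (intro sum.cong) (auto simp: indicator_def)
  also have "\<dots> = quad K (cell_coeff K) z" using grid K by (simp add: rect_grid_def)
  finally show ?thesis .
qed

lemma discrete_mode_restricts_to:
  assumes K: "K \<in> G"
  shows "restricts_to discrete_mode K (quad K (cell_coeff K))"
  unfolding restricts_to_def using AE_open_rect[of K]
  by eventually_elim (rule discrete_mode_on_cell[OF K])

lemma piece_discrete_mode: "K \<in> G \<Longrightarrow> piece discrete_mode K = quad K (cell_coeff K)"
  by (rule piece_quad[OF cell_nondeg discrete_mode_restricts_to])

lemma discrete_mode_L2: "discrete_mode \<in> L2 (open_rect \<Omega>)"
proof -
  have ind: "(\<lambda>z. indicator (open_rect K) z * quad K d z) \<in> L2 (open_rect \<Omega>)" for K d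
  proof -
    have q: "quad K d \<in> borel_measurable (lebesgue_on (open_rect \<Omega>))"
        "integrable (lebesgue_on (open_rect \<Omega>)) (\<lambda>z. (quad K d z)\<^sup>2)"
      using continuous_L2[OF continuous_quad] by (auto simp: L2_def)
    have i: "indicator (open_rect K) \<in> borel_measurable (lebesgue_on (open_rect \<Omega>))"
      by (intro measurable_restrict_space1 borel_measurable_indicator) simp
    have m: "(\<lambda>z. indicator (open_rect K) z * quad K d z) \<in> borel_measurable (lebesgue_on (open_rect \<Omega>))"
      using q i by (intro borel_measurable_times) auto
    moreover have "integrable (lebesgue_on (open_rect \<Omega>)) (\<lambda>z. (indicator (open_rect K) z * quad K d z)\<^sup>2)"
      by (rule Bochner_Integration.integrable_bound[OF q(2)])
        (use m in \<open>auto intro!: AE_I2 borel_measurable_power simp: indicator_def\<close>)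
    ultimately show ?thesis by (simp add: L2_def)
  qed
  show ?thesis
    unfolding discrete_mode_def[abs_def] using grid by (intro L2_sum ind) (simp add: rect_grid_def)
qed

lemma vertex_in_closed: "K \<in> G \<Longrightarrow> z \<in> vertices K \<Longrightarrow> z \<in> closed_rect \<Omega>"
  using grid_subset[OF grid, of K] by (auto simp: vertices_def closed_rect_times)

lemma discrete_mode_RRM: "discrete_mode \<in> RRM \<Omega> G"
proof -
  have "sine_mode \<Omega> \<mu> \<nu> z = 0" if zb: "z \<in> boundary_vertices \<Omega> G" for z
  proof -
    obtain K where "K \<in> G" "z \<in> vertices K" "z \<notin> open_rect \<Omega>" using zb unfolding boundary_vertices_def by blast
    then have "z \<in> closed_rect \<Omega>" "z \<notin> open_rect \<Omega>" using vertex_in_closed by auto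
    then have "fst z = xl \<Omega> \<or> fst z = xr \<Omega> \<or> snd z = yl \<Omega> \<or> snd z = yr \<Omega>"
      by (cases z) (auto simp: closed_rect_times open_rect_times)
    then show ?thesis using boundary_zero by (auto simp: sine_mode_SX_SY)
  qed
  moreover have "\<exists>p\<in>Pk 2. restricts_to discrete_mode K p" if "K \<in> G" for K
    using discrete_mode_restricts_to[OF that] quad_in_Pk by blast
  ultimately show ?thesis
    unfolding RRM_def
    by (simp add: discrete_mode_L2 piece_discrete_mode quad_coeff_vertex edge_mean_cell_coeff)
qed

end

section \<open>The discrete equation for an arbitrary test function\<close>

context sine_grid
begin

text \<open>The pairwise matching conditions become one function on the plane. Its value 0 outside
  the open rectangle makes the boundary terms of the telescoping sums vanish.\<close>

lemma RRM_nodal: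
  assumes w: "w \<in> RRM \<Omega> G"
  obtains node where "\<And>K z. K \<in> G \<Longrightarrow> z \<in> vertices K \<Longrightarrow> piece w K z = node z"
    "\<And>z. z \<notin> open_rect \<Omega> \<Longrightarrow> node z = (0::real)"
proof -
  define node where "node z = (if z \<in> open_rect \<Omega> then piece w (SOME K. K \<in> G \<and> z \<in> vertices K) z else 0)" for z
  have "piece w K z = node z" if K: "K \<in> G" "z \<in> vertices K" for K z
  proof (cases "z \<in> open_rect \<Omega>")
    case True
    let ?L = "SOME K. K \<in> G \<and> z \<in> vertices K"
    have L: "?L \<in> G \<and> z \<in> vertices ?L" by (rule someI[of _ K]) (use K in simp)
    have "z \<in> interior_vertices \<Omega> G" using K True by (auto simp: interior_vertices_def)
    then have "piece w K z = piece w ?L z" using w K L unfolding RRM_def by blast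
    then show ?thesis using True by (simp add: node_def)
  next
    case False
    then have "z \<in> boundary_vertices \<Omega> G" using K by (auto simp: boundary_vertices_def)
    then have "piece w K z = 0" using w K unfolding RRM_def by blast
    then show ?thesis using False by (simp add: node_def)
  qed
  moreover have "node z = 0" if "z \<notin> open_rect \<Omega>" for z using that by (simp add: node_def)
  ultimately show ?thesis by (rule that)
qed

text \<open>Only interior edges are covered; on boundary edges the flux will be multiplied by a sine
  that vanishes there.\<close>

lemma RRM_edge:
  assumes w: "w \<in> RRM \<Omega> G"
  obtains flux :: "point \<times> point \<Rightarrow> real" where
    "\<And>K e. K \<in> G \<Longrightarrow> e \<in> edges K \<Longrightarrow> e \<in> interior_edges \<Omega> G \<Longrightarrow>
       edge_mean e (normal_deriv e (piece w K)) = flux e"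
proof -
  define flux where "flux e = edge_mean e (normal_deriv e (piece w (SOME K. K \<in> G \<and> e \<in> edges K)))" for e
  have "edge_mean e (normal_deriv e (piece w K)) = flux e"
    if K: "K \<in> G" "e \<in> edges K" "e \<in> interior_edges \<Omega> G" for K e
  proof -
    let ?L = "SOME K. K \<in> G \<and> e \<in> edges K"
    have L: "?L \<in> G \<and> e \<in> edges ?L" by (rule someI[of _ K]) (use K in simp)
    then show ?thesis using w K unfolding RRM_def flux_def by blast
  qed
  then show ?thesis by (rule that)
qed

lemma vertical_edge_interior:
  assumes K: "K \<in> G" and x: "x = xl K \<or> x = xr K" "x \<noteq> xl \<Omega>" "x \<noteq> xr \<Omega>"
  shows "((x, yl K), (x, yr K)) \<in> edges K" "((x, yl K), (x, yr K)) \<in> interior_edges \<Omega> G"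
proof -
  note sub = grid_subset[OF grid K]
  show e: "((x, yl K), (x, yr K)) \<in> edges K" using x by (auto simp: edges_def)
  have "z \<in> open_rect \<Omega>" if seg: "z \<in> open_segment (x, yl K) (x, yr K)" for z
  proof -
    obtain u where u: "0 < u" "u < 1" "z = (1 - u) *\<^sub>R (x, yl K) + u *\<^sub>R (x, yr K)"
      using seg by (auto simp: in_segment)
    have "fst z = x" using u by (simp add: algebra_simps)
    moreover have "snd z = yl K + u * (yr K - yl K)" using u by (simp add: algebra_simps)
    moreover have "0 < u * (yr K - yl K)" "u * (yr K - yl K) < yr K - yl K"
      using u sub by simp_all
    ultimately have "yl \<Omega> < snd z" "snd z < yr \<Omega>" "xl \<Omega> < fst z" "fst z < xr \<Omega>"
      using sub x by linarith+
    then show ?thesis by (cases z) (auto simp: open_rect_times)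
  qed
  then show "((x, yl K), (x, yr K)) \<in> interior_edges \<Omega> G"
    using e K by (auto simp: interior_edges_def)
qed

lemma horizontal_edge_interior:
  assumes K: "K \<in> G" and y: "y = yl K \<or> y = yr K" "y \<noteq> yl \<Omega>" "y \<noteq> yr \<Omega>"
  shows "((xl K, y), (xr K, y)) \<in> edges K" "((xl K, y), (xr K, y)) \<in> interior_edges \<Omega> G"
proof -
  note sub = grid_subset[OF grid K]
  show e: "((xl K, y), (xr K, y)) \<in> edges K" using y by (auto simp: edges_def)
  have "z \<in> open_rect \<Omega>" if seg: "z \<in> open_segment (xl K, y) (xr K, y)" for z
  proof -
    obtain u where u: "0 < u" "u < 1" "z = (1 - u) *\<^sub>R (xl K, y) + u *\<^sub>R (xr K, y)"
      using seg by (auto simp: in_segment)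
    have "snd z = y" using u by (simp add: algebra_simps)
    moreover have "fst z = xl K + u * (xr K - xl K)" using u by (simp add: algebra_simps)
    moreover have "0 < u * (xr K - xl K)" "u * (xr K - xl K) < xr K - xl K"
      using u sub by simp_all
    ultimately have "xl \<Omega> < fst z" "fst z < xr \<Omega>" "yl \<Omega> < snd z" "snd z < yr \<Omega>"
      using sub y by linarith+
    then show ?thesis by (cases z) (auto simp: open_rect_times)
  qed
  then show "((xl K, y), (xr K, y)) \<in> interior_edges \<Omega> G"
    using e K by (auto simp: interior_edges_def)
qed

lemma integral_sine_mode_quad:
  assumes K: "K \<in> G"
  shows "((\<lambda>z. sine_mode \<Omega> \<mu> \<nu> z * quad K e z) has_integral
    4 * a * b * (e 0 * (SX (xm K) * SY (ym K) * (\<kappa>\<^sub>0 (\<mu> * a) * \<kappa>\<^sub>0 (\<nu> * b)))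
      + e 1 * a * (CX (xm K) * SY (ym K) * (\<kappa>\<^sub>1 (\<mu> * a) * \<kappa>\<^sub>0 (\<nu> * b)))
      + e 2 * b * (SX (xm K) * CY (ym K) * (\<kappa>\<^sub>0 (\<mu> * a) * \<kappa>\<^sub>1 (\<nu> * b)))
      + e 3 * a\<^sup>2 * (SX (xm K) * SY (ym K) * (\<kappa>\<^sub>2 (\<mu> * a) * \<kappa>\<^sub>0 (\<nu> * b)))
      + e 4 * (a * b) * (CX (xm K) * CY (ym K) * (\<kappa>\<^sub>1 (\<mu> * a) * \<kappa>\<^sub>1 (\<nu> * b)))
      + e 5 * b\<^sup>2 * (SX (xm K) * SY (ym K) * (\<kappa>\<^sub>0 (\<mu> * a) * \<kappa>\<^sub>2 (\<nu> * b))))) (closed_rect K)"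
proof -
  define F where "F k = (if k = (0::nat) then 2 * a * (SX (xm K) * \<kappa>\<^sub>0 (\<mu> * a))
      else if k = 1 then 2 * a * (a * CX (xm K) * \<kappa>\<^sub>1 (\<mu> * a)) else 2 * a * (a\<^sup>2 * SX (xm K) * \<kappa>\<^sub>2 (\<mu> * a)))" for k
  define H where "H k = (if k = (0::nat) then 2 * b * (SY (ym K) * \<kappa>\<^sub>0 (\<nu> * b))
      else if k = 1 then 2 * b * (b * CY (ym K) * \<kappa>\<^sub>1 (\<nu> * b)) else 2 * b * (b\<^sup>2 * SY (ym K) * \<kappa>\<^sub>2 (\<nu> * b)))" for k
  have cases: "k = 0 \<or> k = 1 \<or> k = 2" if "k \<le> 2" for k :: nat using that by auto
  have "((\<lambda>z. SX (fst z) * SY (snd z) * quad K e z) has_integral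
     e 0 * (F 0 * H 0) + e 1 * (F 1 * H 0) + e 2 * (F 0 * H 1) + e 3 * (F 2 * H 0)
       + e 4 * (F 1 * H 1) + e 5 * (F 0 * H 2)) (closed_rect K)"
  proof (rule has_integral_times_quad)
    show "continuous_on {xl K..xr K} SX" "continuous_on {yl K..yr K} SY"
      unfolding SX_def SY_def by (intro continuous_intros)+
    show "((\<lambda>x. SX x * (x - xm K) ^ k) has_integral F k) {xl K..xr K}" if "k \<le> 2" for k
      using has_integral_sin_moments[of a \<mu> "xl \<Omega>" "xm K"] ab \<mu>\<nu> cases[OF that]
      by (auto simp: F_def SX_def CX_def cell_bounds[OF K])
    show "((\<lambda>y. SY y * (y - ym K) ^ k) has_integral H k) {yl K..yr K}" if "k \<le> 2" for k
      using has_integral_sin_moments[of b \<nu> "yl \<Omega>" "ym K"] ab \<mu>\<nu> cases[OF that]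
      by (auto simp: H_def SY_def CY_def cell_bounds[OF K])
  qed
  then show ?thesis
    unfolding sine_mode_SX_SY by (rule has_integral_eq_rhs) (simp add: F_def H_def algebra_simps)
qed

text \<open>The residual of a cell is a difference of edge quantities, because the amplitude annihilates
  the contribution of the sines at the vertices (the symbol) and only cosine terms remain.\<close>

lemma discrete_mode_solves:
  assumes w: "w \<in> RRM \<Omega> G"
  shows "a_h G discrete_mode w = (LINT z|lebesgue_on (open_rect \<Omega>). sine_mode \<Omega> \<mu> \<nu> z * w z)"
proof -
  let ?p = "cos (\<mu> * a)" and ?q = "cos (\<nu> * b)" and ?\<sigma> = "sin (\<mu> * a)" and ?\<tau> = "sin (\<nu> * b)"
  let ?k0 = "\<kappa>\<^sub>0 (\<mu> * a)" and ?k1 = "\<kappa>\<^sub>1 (\<mu> * a)" and ?k2 = "\<kappa>\<^sub>2 (\<mu> * a)"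
  let ?l0 = "\<kappa>\<^sub>0 (\<nu> * b)" and ?l1 = "\<kappa>\<^sub>1 (\<nu> * b)" and ?l2 = "\<kappa>\<^sub>2 (\<nu> * b)"
  \<comment> \<open>Stiffness minus load relative to the cell area: the A's multiply the vertex
    coordinates W, X, Y, Z of the test function and the B's its squares E3, E5. Differences such as
    \<open>?k0 - ?k2\<close> arise because the constant coefficient is W - E3 - E5.\<close>
  define A00 where "A00 = - (?k0 * ?l0)"
  define A10 where "A10 = \<alpha> * ?\<sigma> * ?q / a\<^sup>2 - ?k1 * ?l0"
  define A01 where "A01 = \<alpha> * ?p * ?\<tau> / b\<^sup>2 - ?k0 * ?l1"
  define A11 where "A11 = \<alpha> * ?\<sigma> * ?\<tau> * (a\<^sup>2 + b\<^sup>2) / (3 * a\<^sup>2 * b\<^sup>2) - ?k1 * ?l1"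
  define B3 where "B3 = (?k0 - ?k2) * ?l0 - 2 / 3 * \<alpha> * ?\<sigma>\<^sup>2 * ?q / (?p * a\<^sup>2)"
  define B5 where "B5 = ?k0 * (?l0 - ?l2) - 2 / 3 * \<alpha> * ?\<tau>\<^sup>2 * ?p / (?q * b\<^sup>2)"
  define A10' where "A10' = A10 - ?\<sigma> / (2 * ?p) * B3"
  define A01' where "A01' = A01 - ?\<tau> / (2 * ?q) * B5"
  define Q10 where "Q10 = - A00 * ?\<sigma> * ?q + A10' * ?p * ?q - A01' * ?\<sigma> * ?\<tau> + A11 * ?p * ?\<tau>"
  define Q01 where "Q01 = - A00 * ?p * ?\<tau> - A10' * ?\<sigma> * ?\<tau> + A01' * ?p * ?q + A11 * ?\<sigma> * ?q"
  define Q11 where "Q11 = A00 * ?\<sigma> * ?\<tau> - A10' * ?p * ?\<tau> - A01' * ?\<sigma> * ?q + A11 * ?p * ?q"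
  have symbol: "A00 * ?p * ?q + A10' * ?\<sigma> * ?q + A01' * ?p * ?\<tau> + A11 * ?\<sigma> * ?\<tau> = 0"
    unfolding A10'_def A01'_def
    by (rule symbol_eq[OF _ _ cos_nz amplitude A00_def A10_def A01_def A11_def B3_def B5_def]) (use ab in auto)
  obtain node where node: "\<And>K z. K \<in> G \<Longrightarrow> z \<in> vertices K \<Longrightarrow> piece w K z = node z"
    and node0: "\<And>z. z \<notin> open_rect \<Omega> \<Longrightarrow> node z = 0"
    by (rule RRM_nodal[OF w]) blast
  obtain flux :: "point \<times> point \<Rightarrow> real" where flux: "\<And>K e. K \<in> G \<Longrightarrow> e \<in> edges K \<Longrightarrow> e \<in> interior_edges \<Omega> G \<Longrightarrow>
       edge_mean e (normal_deriv e (piece w K)) = flux e"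
    by (rule RRM_edge[OF w]) blast
  have "\<exists>d. piece w K = quad K d \<and> restricts_to w K (quad K d)" if K: "K \<in> G" for K
  proof -
    obtain p where "p \<in> Pk 2" "restricts_to w K p" using w K unfolding RRM_def by blast
    moreover then obtain d where "p = quad K d" using Pk_imp_quad by blast
    ultimately show ?thesis using piece_quad[OF cell_nondeg[OF K]] by blast
  qed
  then obtain e where e: "\<And>K. K \<in> G \<Longrightarrow> piece w K = quad K (e K)"
    and er: "\<And>K. K \<in> G \<Longrightarrow> restricts_to w K (quad K (e K))" by metis
  \<comment> \<open>\<open>F1 x y\<close> gathers what \<open>cell_residual\<close> attaches to the
    vertical edge from (x, y) upwards, and \<open>F2 y x\<close> the same for the horizontal edge
    from (x, y) to the right, with the telescoping coordinate first. The minus sign before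
    \<open>flux\<close> in \<open>F2\<close> undoes the downward normal.\<close>
  define F1 where "F1 x y =
      Q10 / 4 * ((node (x, y + 2 * b) * SY (y + 2 * b) + node (x, y) * SY y) * CX x)
    + Q11 / 4 * ((node (x, y + 2 * b) * CY (y + 2 * b) - node (x, y) * CY y) * CX x)
    + B3 * SY (y + b) * a / (4 * ?p) * (SX x * flux ((x, y), (x, y + 2 * b)))" for x y
  define F2 where "F2 y x =
      Q01 / 4 * ((node (x + 2 * a, y) * SX (x + 2 * a) + node (x, y) * SX x) * CY y)
    + B5 * SX (x + a) * b / (4 * ?q) * (SY y * - flux ((x, y), (x + 2 * a, y)))" for x y
  define S where "S K = (LINT z|lebesgue_on (closed_rect K). grad (piece discrete_mode K) z \<bullet> grad (piece w K) z)" for K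
  define L where "L K = 
    4 * a * b * (e K 0 * (SX (xm K) * SY (ym K) * (?k0 * ?l0))
      + e K 1 * a * (CX (xm K) * SY (ym K) * (?k1 * ?l0))
      + e K 2 * b * (SX (xm K) * CY (ym K) * (?k0 * ?l1))
      + e K 3 * a\<^sup>2 * (SX (xm K) * SY (ym K) * (?k2 * ?l0))
      + e K 4 * (a * b) * (CX (xm K) * CY (ym K) * (?k1 * ?l1))
      + e K 5 * b\<^sup>2 * (SX (xm K) * SY (ym K) * (?k0 * ?l2)))" for K
  have residual: "S K - L K = 4 * a * b * ((F1 (xr K) (yl K) - F1 (xl K) (yl K)) + (F2 (yr K) (xl K) - F2 (yl K) (xl K)))"
    if K: "K \<in> G" for K
  proof -
    note cb = cell_bounds[OF K]
    define Sx Cx Sy Cy where "Sx = SX (xm K)" and "Cx = CX (xm K)" and "Sy = SY (ym K)" and "Cy = CY (ym K)"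
    define e0 e1 e2 e3 e4 e5 where "e0 = e K 0" and "e1 = e K 1" and "e2 = e K 2" and "e3 = e K 3" and "e4 = e K 4" and "e5 = e K 5"
    \<comment> \<open>W, X, Y, Z are the coordinates of the four vertex values in the sign patterns
      of the corners; E3 and E5 are what vertex values leave undetermined in a quadratic.\<close>
    define W X Y Z E3 E5 where "W = e0 + e3 * a\<^sup>2 + e5 * b\<^sup>2" and "X = e1 * a" and "Y = e2 * b" and "Z = e4 * (a * b)"
      and "E3 = e3 * a\<^sup>2" and "E5 = e5 * b\<^sup>2"
    have nv: "quad K (e K) z = node z" if "z \<in> vertices K" for z
      using node[OF K that] e[OF K] by simp
    have corner: "node (xr K, yr K) = W + X + Y + Z" "node (xr K, yl K) = W + X - Y - Z"
      "node (xl K, yr K) = W - X + Y - Z" "node (xl K, yl K) = W - X - Y + Z"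
      by (subst nv[symmetric], simp add: vertices_def,
          simp add: quad_def cb W_def X_def Y_def Z_def e0_def e1_def e2_def e3_def e4_def e5_def)+
    \<comment> \<open>On the boundary of \<Omega> both sides vanish through the sine, so flux
      continuity is needed only inside.\<close>
    have fx: "SX x * flux ((x, yl K), (x, yr K)) = SX x * (e1 + 2 * e3 * (x - xm K))" if "x = xl K \<or> x = xr K" for x
    proof (cases "x = xl \<Omega> \<or> x = xr \<Omega>")
      case True
      then show ?thesis using boundary_zero by auto
    next
      case False
      then show ?thesis
        using flux[OF K vertical_edge_interior[OF K that]] edge_mean_quad(1)[OF cell_nondeg[OF K], of x "e K"] e[OF K]
        by (simp add: e1_def e3_def)
    qed
    have fy: "SY y * - flux ((xl K, y), (xr K, y)) = SY y * (e2 + 2 * e5 * (y - ym K))" if "y = yl K \<or> y = yr K" for y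
    proof (cases "y = yl \<Omega> \<or> y = yr \<Omega>")
      case True
      then show ?thesis using boundary_zero by auto
    next
      case False
      have "flux ((xl K, y), (xr K, y)) = - (e2 + 2 * e5 * (y - ym K))"
        using False flux[OF K horizontal_edge_interior[OF K that]] edge_mean_quad(2)[OF cell_nondeg[OF K], of y "e K"] e[OF K]
        by (simp add: e2_def e5_def)
      then show ?thesis by simp
    qed
    have far: "yl K + 2 * b = yr K" "yl K + b = ym K" "xl K + 2 * a = xr K" "xl K + a = xm K"
      using cb by linarith+
    have rot: "SX (xr K) = Sx * ?p + Cx * ?\<sigma>" "CX (xr K) = Cx * ?p - Sx * ?\<sigma>"
        "SX (xl K) = Sx * ?p - Cx * ?\<sigma>" "CX (xl K) = Cx * ?p + Sx * ?\<sigma>"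
        "SY (yr K) = Sy * ?q + Cy * ?\<tau>" "CY (yr K) = Cy * ?q - Sy * ?\<tau>"
        "SY (yl K) = Sy * ?q - Cy * ?\<tau>" "CY (yl K) = Cy * ?q + Sy * ?\<tau>"
      unfolding cb Sx_def Cx_def Sy_def Cy_def by (rule rotations)+
    have ends: "xr K - xm K = a" "xl K - xm K = - a" "yr K - ym K = b" "yl K - ym K = - b" using cb by linarith+
    have SK: "S K = 4 * a * b * (\<alpha> * ?\<sigma> * ?q / a\<^sup>2 * Cx * Sy * X + \<alpha> * ?p * ?\<tau> / b\<^sup>2 * Sx * Cy * Y
        + \<alpha> * ?\<sigma> * ?\<tau> * (a\<^sup>2 + b\<^sup>2) / (3 * a\<^sup>2 * b\<^sup>2) * Cx * Cy * Z
        - 2 / 3 * \<alpha> * ?\<sigma>\<^sup>2 * ?q / (?p * a\<^sup>2) * Sx * Sy * E3 - 2 / 3 * \<alpha> * ?\<tau>\<^sup>2 * ?p / (?q * b\<^sup>2) * Sx * Sy * E5)"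
      unfolding S_def piece_discrete_mode[OF K] e[OF K] integral_grad_quad[OF cell_nondeg[OF K]]
      using ab cos_nz size[OF K]
      by (simp add: cell_coeff_def mode_coeff_def Sx_def[symmetric] Cx_def[symmetric] Sy_def[symmetric] Cy_def[symmetric]
          X_def Y_def Z_def E3_def E5_def e1_def e2_def e3_def e4_def e5_def)
        (simp add: field_simps power2_eq_square)
    have LK: "L K = 4 * a * b * ((W - E3 - E5) * Sx * Sy * (?k0 * ?l0) + X * (Cx * Sy * (?k1 * ?l0))
        + Y * (Sx * Cy * (?k0 * ?l1)) + E3 * (Sx * Sy * (?k2 * ?l0)) + Z * (Cx * Cy * (?k1 * ?l1)) + E5 * (Sx * Sy * (?k0 * ?l2)))"
      unfolding L_def W_def X_def Y_def Z_def E3_def E5_def e0_def e1_def e2_def e3_def e4_def e5_def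
        Sx_def Cx_def Sy_def Cy_def by (simp add: mult.assoc)
    have "S K - L K = 4 * a * b * (A00 * Sx * Sy * W + A10 * Cx * Sy * X + A01 * Sx * Cy * Y + A11 * Cx * Cy * Z
      + B3 * Sx * Sy * E3 + B5 * Sx * Sy * E5)"
      unfolding SK LK right_diff_distrib[symmetric] A00_def A10_def A01_def A11_def B3_def B5_def
      by (rule arg_cong[where f = "(*) (4 * a * b)"]) (simp add: algebra_simps)
    also have "A00 * Sx * Sy * W + A10 * Cx * Sy * X + A01 * Sx * Cy * Y + A11 * Cx * Cy * Z
      + B3 * Sx * Sy * E3 + B5 * Sx * Sy * E5
      = (F1 (xr K) (yl K) - F1 (xl K) (yl K)) + (F2 (yr K) (xl K) - F2 (yl K) (xl K))"
      unfolding cell_residual[OF _ _ cos_nz A10'_def A01'_def symbol Q10_def Q01_def Q11_def rot corner E3_def E5_def X_def Y_def,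
          OF sin_cos_squared_add2 sin_cos_squared_add2]
      unfolding F1_def F2_def far fx[OF disjI1[OF refl]] fx[OF disjI2[OF refl]]
        fy[OF disjI1[OF refl]] fy[OF disjI2[OF refl]] ends Sx_def[symmetric] Sy_def[symmetric]
      by (simp add: algebra_simps)
    finally show ?thesis .
  qed
  have "a_h G discrete_mode w - (\<Sum>K\<in>G. L K) = (\<Sum>K\<in>G. S K - L K)"
    by (simp add: a_h_def S_def sum_subtractf)
  also have "\<dots> = (\<Sum>K\<in>G. 4 * a * b * ((F1 (xr K) (yl K) - F1 (xl K) (yl K)) + (F2 (yr K) (xl K) - F2 (yl K) (xl K))))"
    by (rule sum.cong[OF refl residual])
  also have "\<dots> = 4 * a * b * ((\<Sum>K\<in>G. F1 (xr K) (yl K) - F1 (xl K) (yl K)) + (\<Sum>K\<in>G. F2 (yr K) (xl K) - F2 (yl K) (xl K)))"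
    by (simp only: sum.distrib[symmetric] sum_distrib_left)
  also have "\<dots> = 0"
  proof -
    \<comment> \<open>The terms with \<open>node\<close> vanish by the boundary condition of
      \<open>w\<close>, those with \<open>flux\<close> by that of the sine mode.\<close>
    have "F1 (xl \<Omega>) y = 0" "F1 (xr \<Omega>) y = 0" "F2 (yl \<Omega>) y = 0" "F2 (yr \<Omega>) y = 0" for y
      unfolding F1_def F2_def by (simp_all add: boundary_zero node0 open_rect_times)
    then show ?thesis
      using grid_telescope[OF nondeg grid unif] by simp
  qed
  finally have "a_h G discrete_mode w = (\<Sum>K\<in>G. L K)" by simp
  also have "\<dots> = (LINT z|lebesgue_on (open_rect \<Omega>). sine_mode \<Omega> \<mu> \<nu> z * w z)"
  proof (rule grid_integral[OF grid, symmetric])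
    show "integrable (lebesgue_on (open_rect \<Omega>)) (\<lambda>z. sine_mode \<Omega> \<mu> \<nu> z * w z)"
      using w by (intro L2_integrable_mult[OF continuous_L2[OF continuous_sine_mode]]) (simp add: RRM_def)
    show "AE z in lebesgue_on (closed_rect K). sine_mode \<Omega> \<mu> \<nu> z * w z = sine_mode \<Omega> \<mu> \<nu> z * quad K (e K) z"
      if "K \<in> G" for K
      using er[OF that] unfolding restricts_to_def by eventually_elim simp
    show "((\<lambda>z. sine_mode \<Omega> \<mu> \<nu> z * quad K (e K) z) has_integral L K) (closed_rect K)" if "K \<in> G" for K
      unfolding L_def by (rule integral_sine_mode_quad[OF that])
  qed
  finally show ?thesis .
qed

end

section \<open>Asymptotics of the discrete sine mode\<close>

abbreviation corner_filter :: "(real \<times> real) filter" where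
  "corner_filter \<equiv> at_right 0 \<times>\<^sub>F at_right 0"

definition sq_sum :: "real \<times> real \<Rightarrow> real" where "sq_sum p = (fst p)\<^sup>2 + (snd p)\<^sup>2"

lemma sq_sum_nonneg: "0 \<le> sq_sum p"
  by (simp add: sq_sum_def)

text \<open>a^2 and b^2 are each at most \<open>sq_sum\<close>, so one-variable estimates in either
  half side length survive in the joint limit.\<close>

lemma corner_lift:
  fixes f :: "real \<Rightarrow> real"
  shows "f \<in> o[at_right 0](\<lambda>x. x\<^sup>2) \<Longrightarrow> (\<lambda>p. f (fst p)) \<in> o[corner_filter](sq_sum)" (is "PROP ?L0")
    and "f \<in> o[at_right 0](\<lambda>x. x\<^sup>2) \<Longrightarrow> (\<lambda>p. f (snd p)) \<in> o[corner_filter](sq_sum)" (is "PROP ?L1")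
    and "f \<in> O[at_right 0](\<lambda>x. x\<^sup>2) \<Longrightarrow> (\<lambda>p. f (fst p)) \<in> O[corner_filter](sq_sum)" (is "PROP ?L2")
    and "f \<in> O[at_right 0](\<lambda>x. x\<^sup>2) \<Longrightarrow> (\<lambda>p. f (snd p)) \<in> O[corner_filter](sq_sum)" (is "PROP ?L3")
    and "f \<in> o[at_right 0](\<lambda>x. 1) \<Longrightarrow> (\<lambda>p. f (fst p)) \<in> o[corner_filter](\<lambda>_. 1)" (is "PROP ?L4")
    and "f \<in> o[at_right 0](\<lambda>x. 1) \<Longrightarrow> (\<lambda>p. f (snd p)) \<in> o[corner_filter](\<lambda>_. 1)" (is "PROP ?L5")
proof -
  have F: "filterlim fst (at_right 0) corner_filter" and S: "filterlim snd (at_right 0) corner_filter"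
    by (rule filterlim_fst filterlim_snd)+
  have b: "(\<lambda>p. (fst p)\<^sup>2) \<in> O[corner_filter](sq_sum)" "(\<lambda>p. (snd p)\<^sup>2) \<in> O[corner_filter](sq_sum)"
    by (rule bigoI[of _ 1], simp add: sq_sum_def)+
  show "PROP ?L0"
    "PROP ?L1"
    using landau_o.small_big_trans[OF landau_o.small.compose[OF _ F] b(1)]
      landau_o.small_big_trans[OF landau_o.small.compose[OF _ S] b(2)] by blast+
  show "PROP ?L2"
    "PROP ?L3"
    using landau_o.big_trans[OF landau_o.big.compose[OF _ F] b(1)]
      landau_o.big_trans[OF landau_o.big.compose[OF _ S] b(2)] by blast+
  show "PROP ?L4"
    "PROP ?L5"
    using landau_o.small.compose[OF _ F, of f "\<lambda>_. 1"] landau_o.small.compose[OF _ S, of f "\<lambda>_. 1"] by simp_all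
qed

text \<open>Everything is reduced to frequency 1 by s = \<mu> a. Two quadratic terms cancel: in the
  first claim -s^2 / 3 from sin^2 s / s^2 against s^2 / 3 from the squared tangent, and in
  \<open>load_factor\<close> -2/3 s^2 from the first summand against s^2 / 3 from each of the
  others.\<close>

lemma one_dim_expansions:
  fixes \<mu> :: real
  assumes "0 < \<mu>"
  shows "(\<lambda>a. (sin (\<mu> * a))\<^sup>2 / a\<^sup>2 * (1 + (sin (\<mu> * a))\<^sup>2 / (3 * (cos (\<mu> * a))\<^sup>2)) - \<mu>\<^sup>2) \<in> o[at_right 0](\<lambda>x. x\<^sup>2)" (is ?E0)
    and "(\<lambda>a. (cos (\<mu> * a))\<^sup>2 - (1 - \<mu>\<^sup>2 * a\<^sup>2)) \<in> o[at_right 0](\<lambda>x. x\<^sup>2)" (is ?E1)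
    and "(\<lambda>a. (sin (\<mu> * a))\<^sup>2 / a\<^sup>2 - \<mu>\<^sup>2) \<in> o[at_right 0](\<lambda>x. 1)" (is ?E2)
    and "(\<lambda>a. load_factor (\<mu> * a) - 1) \<in> o[at_right 0](\<lambda>x. x\<^sup>2)" (is ?E3)
    and "(\<lambda>a. load_factor (\<mu> * a) - \<kappa>\<^sub>0 (\<mu> * a) * cos (\<mu> * a)) \<in> O[at_right 0](\<lambda>x. x\<^sup>2)" (is ?E4)
    and "(\<lambda>a. \<kappa>\<^sub>1 (\<mu> * a) * sin (\<mu> * a)) \<in> O[at_right 0](\<lambda>x. x\<^sup>2)" (is ?E5)
proof -
  have m2: "\<mu>\<^sup>2 \<noteq> 0" using assms by simp
  have lim: "filterlim (\<lambda>a. \<mu> * a) (at_right 0) (at_right 0)"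
    using assms by real_asymp
  have o: "(\<lambda>a. f (\<mu> * a)) \<in> o[at_right 0](\<lambda>x. x\<^sup>2)" if "f \<in> o[at_right 0](\<lambda>x. x\<^sup>2)" for f :: "real \<Rightarrow> real"
    using landau_o.small.compose[OF that lim] assms by (simp add: power_mult_distrib)
  have O: "(\<lambda>a. f (\<mu> * a)) \<in> O[at_right 0](\<lambda>x. x\<^sup>2)" if "f \<in> O[at_right 0](\<lambda>x. x\<^sup>2)" for f :: "real \<Rightarrow> real"
    using landau_o.big.compose[OF that lim] assms by (simp add: power_mult_distrib)
  have "(\<lambda>s. (sin s)\<^sup>2 / s\<^sup>2 * (1 + (sin s)\<^sup>2 / (3 * (cos s)\<^sup>2)) - 1) \<in> o[at_right 0](\<lambda>x::real. x\<^sup>2)" by real_asymp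
  from o[OF this] have "(\<lambda>a. \<mu>\<^sup>2 * ((sin (\<mu> * a))\<^sup>2 / (\<mu> * a)\<^sup>2 * (1 + (sin (\<mu> * a))\<^sup>2 / (3 * (cos (\<mu> * a))\<^sup>2)) - 1)) \<in> o[at_right 0](\<lambda>x. x\<^sup>2)"
    by (simp only: landau_o.small.cmult_in_iff[OF m2])
  then show ?E0
    using assms by (simp add: power_mult_distrib right_diff_distrib)
  have "(\<lambda>s. (cos s)\<^sup>2 - (1 - s\<^sup>2)) \<in> o[at_right 0](\<lambda>x::real. x\<^sup>2)" by real_asymp
  from o[OF this] show ?E1
    by (simp add: power_mult_distrib)
  have "(\<lambda>s. (sin s)\<^sup>2 / s\<^sup>2 - 1) \<in> o[at_right 0](\<lambda>x::real. 1::real)" by real_asymp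
  from landau_o.small.compose[OF this lim]
  have "(\<lambda>a. \<mu>\<^sup>2 * ((sin (\<mu> * a))\<^sup>2 / (\<mu> * a)\<^sup>2 - 1)) \<in> o[at_right 0](\<lambda>x. 1)"
    by (simp only: landau_o.small.cmult_in_iff[OF m2])
  then show ?E2
    using assms by (simp add: power_mult_distrib right_diff_distrib)
  have "(\<lambda>s. load_factor s - 1) \<in> o[at_right 0](\<lambda>x. x\<^sup>2)"
    "(\<lambda>s. load_factor s - \<kappa>\<^sub>0 s * cos s) \<in> O[at_right 0](\<lambda>x. x\<^sup>2)"
    "(\<lambda>s. \<kappa>\<^sub>1 s * sin s) \<in> O[at_right 0](\<lambda>x. x\<^sup>2)"
    unfolding load_factor_def \<kappa>\<^sub>0_def \<kappa>\<^sub>1_def \<kappa>\<^sub>2_def by - real_asymp+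
  then show ?E3
    ?E4
    ?E5
    using o O by blast+
qed

lemma sq_sum_tendsto: "sq_sum \<in> o[corner_filter](\<lambda>_. 1)"
proof -
  have "(\<lambda>x::real. x\<^sup>2) \<in> o[at_right 0](\<lambda>x. 1)" by real_asymp
  from sum_in_smallo(1)[OF corner_lift(5,6)[OF this]] show ?thesis by (simp add: sq_sum_def[abs_def])
qed

text \<open>To second order the three summands are \<mu>^2 (1 - \<nu>^2 b^2), \<nu>^2 (1 - \<mu>^2
  a^2) and \<mu>^2 \<nu>^2 (a^2 + b^2) / 3, so the mixed terms add up with factor -1 + 1/3.\<close>

lemma mode_stiff_expansion:
  assumes "0 < \<mu>" "0 < \<nu>"
  shows "(\<lambda>p. mode_stiff \<mu> \<nu> (fst p) (snd p) - (\<mu>\<^sup>2 + \<nu>\<^sup>2 - 2 / 3 * \<mu>\<^sup>2 * \<nu>\<^sup>2 * sq_sum p)) \<in> o[corner_filter](sq_sum)"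
proof -
  define P where "P \<mu> a = (sin (\<mu> * a))\<^sup>2 / a\<^sup>2 * (1 + (sin (\<mu> * a))\<^sup>2 / (3 * (cos (\<mu> * a))\<^sup>2))" for \<mu> a :: real
  define J where "J \<mu> a = (sin (\<mu> * a))\<^sup>2 / a\<^sup>2" for \<mu> a :: real
  let ?c = "\<lambda>\<mu> a. (cos (\<mu> * a))\<^sup>2"
  have P: "(\<lambda>p. P \<mu> (fst p) - \<mu>\<^sup>2) \<in> o[corner_filter](sq_sum)" "(\<lambda>p. P \<nu> (snd p) - \<nu>\<^sup>2) \<in> o[corner_filter](sq_sum)"
    using corner_lift(1)[OF one_dim_expansions(1)[OF assms(1)]] corner_lift(2)[OF one_dim_expansions(1)[OF assms(2)]]
    by (simp_all add: P_def)
  have C: "(\<lambda>p. ?c \<mu> (fst p) - (1 - \<mu>\<^sup>2 * (fst p)\<^sup>2)) \<in> o[corner_filter](sq_sum)"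
    "(\<lambda>p. ?c \<nu> (snd p) - (1 - \<nu>\<^sup>2 * (snd p)\<^sup>2)) \<in> o[corner_filter](sq_sum)"
    using corner_lift(1)[OF one_dim_expansions(2)[OF assms(1)]] corner_lift(2)[OF one_dim_expansions(2)[OF assms(2)]]
    by simp_all
  have J: "(\<lambda>p. J \<mu> (fst p) - \<mu>\<^sup>2) \<in> o[corner_filter](\<lambda>_. 1)" "(\<lambda>p. J \<nu> (snd p) - \<nu>\<^sup>2) \<in> o[corner_filter](\<lambda>_. 1)"
    using corner_lift(5)[OF one_dim_expansions(3)[OF assms(1)]] corner_lift(6)[OF one_dim_expansions(3)[OF assms(2)]]
    by (simp_all add: J_def)
  have Cb: "(\<lambda>p. ?c \<mu> (fst p)) \<in> O[corner_filter](\<lambda>_. 1)" "(\<lambda>p. ?c \<nu> (snd p)) \<in> O[corner_filter](\<lambda>_. 1)"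
    by (rule bigoI[of _ 1], simp add: power_le_one abs_square_le_1)+
  have Jb: "(\<lambda>p. J \<nu> (snd p)) \<in> O[corner_filter](\<lambda>_. 1)"
    using sum_in_bigo(1)[OF landau_o.small_imp_big[OF J(2)], of "\<lambda>_. \<nu>\<^sup>2"] by simp
  have t1: "(\<lambda>p. (P \<mu> (fst p) - \<mu>\<^sup>2) * ?c \<nu> (snd p)) \<in> o[corner_filter](sq_sum)"
    and t2: "(\<lambda>p. (P \<nu> (snd p) - \<nu>\<^sup>2) * ?c \<mu> (fst p)) \<in> o[corner_filter](sq_sum)"
    using landau_o.small_big_mult[OF P(1) Cb(2)] landau_o.small_big_mult[OF P(2) Cb(1)] by simp_all
  have t3: "(\<lambda>p. \<mu>\<^sup>2 * (?c \<nu> (snd p) - (1 - \<nu>\<^sup>2 * (snd p)\<^sup>2))) \<in> o[corner_filter](sq_sum)"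
    and t4: "(\<lambda>p. \<nu>\<^sup>2 * (?c \<mu> (fst p) - (1 - \<mu>\<^sup>2 * (fst p)\<^sup>2))) \<in> o[corner_filter](sq_sum)"
    using C assms by (simp_all add: landau_o.small.cmult_in_iff)
  have "(\<lambda>p. (J \<mu> (fst p) - \<mu>\<^sup>2) * J \<nu> (snd p) + \<mu>\<^sup>2 * (J \<nu> (snd p) - \<nu>\<^sup>2)) \<in> o[corner_filter](\<lambda>_. 1)"
    using landau_o.small_big_mult[OF J(1) Jb] J(2) assms
    by (intro sum_in_smallo) (simp_all add: landau_o.small.cmult_in_iff)
  from landau_o.small_big_mult[OF this landau_o.big_refl[of sq_sum]]
  have "(\<lambda>p. ((J \<mu> (fst p) - \<mu>\<^sup>2) * J \<nu> (snd p) + \<mu>\<^sup>2 * (J \<nu> (snd p) - \<nu>\<^sup>2)) * sq_sum p) \<in> o[corner_filter](sq_sum)"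
    by simp
  then have t5: "(\<lambda>p. 1 / 3 * (((J \<mu> (fst p) - \<mu>\<^sup>2) * J \<nu> (snd p) + \<mu>\<^sup>2 * (J \<nu> (snd p) - \<nu>\<^sup>2)) * sq_sum p)) \<in> o[corner_filter](sq_sum)"
    by (simp add: landau_o.small.cmult_in_iff)
  have "mode_stiff \<mu> \<nu> (fst p) (snd p) - (\<mu>\<^sup>2 + \<nu>\<^sup>2 - 2 / 3 * \<mu>\<^sup>2 * \<nu>\<^sup>2 * sq_sum p) =
     (P \<mu> (fst p) - \<mu>\<^sup>2) * ?c \<nu> (snd p) + (P \<nu> (snd p) - \<nu>\<^sup>2) * ?c \<mu> (fst p)
     + \<mu>\<^sup>2 * (?c \<nu> (snd p) - (1 - \<nu>\<^sup>2 * (snd p)\<^sup>2)) + \<nu>\<^sup>2 * (?c \<mu> (fst p) - (1 - \<mu>\<^sup>2 * (fst p)\<^sup>2))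
     + 1 / 3 * (((J \<mu> (fst p) - \<mu>\<^sup>2) * J \<nu> (snd p) + \<mu>\<^sup>2 * (J \<nu> (snd p) - \<nu>\<^sup>2)) * sq_sum p)" for p
  proof -
    have "mode_stiff \<mu> \<nu> (fst p) (snd p) = P \<mu> (fst p) * ?c \<nu> (snd p) + P \<nu> (snd p) * ?c \<mu> (fst p)
        + 1 / 3 * (J \<mu> (fst p) * J \<nu> (snd p) * sq_sum p)"
      by (simp add: mode_stiff_def Let_def P_def J_def sq_sum_def mult.commute mult.left_commute)
    then show ?thesis by (simp add: algebra_simps sq_sum_def)
  qed
  then show ?thesis using t1 t2 t3 t4 t5 by (simp only:) (intro sum_in_smallo)
qed

text \<open>\<open>mode_load\<close> differs from the product of the two load factors only by
  products of two quantities that are each of second order.\<close>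

lemma mode_load_expansion:
  assumes "0 < \<mu>" "0 < \<nu>"
  shows "(\<lambda>p. mode_load (\<mu> * fst p) (\<nu> * snd p) - 1) \<in> o[corner_filter](sq_sum)"
proof -
  define M where "M \<mu> a = load_factor (\<mu> * a)" for \<mu> a
  define m where "m \<mu> a = load_factor (\<mu> * a) - \<kappa>\<^sub>0 (\<mu> * a) * cos (\<mu> * a)" for \<mu> a
  define k where "k \<mu> a = \<kappa>\<^sub>1 (\<mu> * a) * sin (\<mu> * a)" for \<mu> a
  note L = one_dim_expansions[OF assms(1)] and R = one_dim_expansions[OF assms(2)]
  have M: "(\<lambda>p. M \<mu> (fst p) - 1) \<in> o[corner_filter](sq_sum)" "(\<lambda>p. M \<nu> (snd p) - 1) \<in> o[corner_filter](sq_sum)"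
    using corner_lift(1)[OF L(4)] corner_lift(2)[OF R(4)] by (simp_all add: M_def)
  have m: "(\<lambda>p. m \<mu> (fst p)) \<in> O[corner_filter](sq_sum)" "(\<lambda>p. m \<nu> (snd p)) \<in> O[corner_filter](sq_sum)"
    using corner_lift(3)[OF L(5)] corner_lift(4)[OF R(5)] by (simp_all add: m_def)
  have k: "(\<lambda>p. k \<mu> (fst p)) \<in> O[corner_filter](sq_sum)" "(\<lambda>p. k \<nu> (snd p)) \<in> O[corner_filter](sq_sum)"
    using corner_lift(3)[OF L(6)] corner_lift(4)[OF R(6)] by (simp_all add: k_def)
  note small = landau_o.big_small_trans[OF _ sq_sum_tendsto]
  have Mb: "(\<lambda>p. M \<nu> (snd p)) \<in> O[corner_filter](\<lambda>_. 1)"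
    using sum_in_bigo(1)[OF landau_o.small_imp_big[OF small[OF landau_o.small_imp_big[OF M(2)]]], of "\<lambda>_. 1"] by simp
  have t1: "(\<lambda>p. (M \<mu> (fst p) - 1) * M \<nu> (snd p)) \<in> o[corner_filter](sq_sum)"
    using landau_o.small_big_mult[OF M(1) Mb] by simp
  have t2: "(\<lambda>p. m \<mu> (fst p) * m \<nu> (snd p)) \<in> o[corner_filter](sq_sum)"
    and t3: "(\<lambda>p. k \<mu> (fst p) * k \<nu> (snd p)) \<in> o[corner_filter](sq_sum)"
    using landau_o.small_big_mult[OF small[OF m(1)] m(2)] landau_o.small_big_mult[OF small[OF k(1)] k(2)] by simp_all
  have "mode_load (\<mu> * fst p) (\<nu> * snd p) - 1 = (M \<mu> (fst p) - 1) * M \<nu> (snd p) + (M \<nu> (snd p) - 1)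
      - m \<mu> (fst p) * m \<nu> (snd p) + k \<mu> (fst p) * k \<nu> (snd p)" for p
    by (simp add: mode_load_def M_def m_def k_def algebra_simps)
  then show ?thesis
    using sum_in_smallo(1)[OF sum_in_smallo(2)[OF sum_in_smallo(1)[OF t1 M(2)] t2] t3] by (simp only:)
qed

lemma amplitude_expansion:
  assumes "0 < \<mu>" "0 < \<nu>"
  defines "\<Lambda> \<equiv> \<mu>\<^sup>2 + \<nu>\<^sup>2"
  shows "\<forall>\<^sub>F p in corner_filter. 0 < mode_stiff \<mu> \<nu> (fst p) (snd p) \<and>
    \<mu>\<^sup>2 * \<nu>\<^sup>2 / (2 * \<Lambda>\<^sup>2) * sq_sum p \<le> mode_load (\<mu> * fst p) (\<nu> * snd p) / mode_stiff \<mu> \<nu> (fst p) (snd p) - 1 / \<Lambda> \<and>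
    mode_load (\<mu> * fst p) (\<nu> * snd p) / mode_stiff \<mu> \<nu> (fst p) (snd p) \<le> 4 / \<Lambda>"
proof -
  let ?m = "\<mu>\<^sup>2 * \<nu>\<^sup>2"
  have L: "0 < \<Lambda>" and m: "0 < ?m" using assms by (simp_all add: sum_power2_gt_zero_iff)
  \<comment> \<open>The remainders of load and stiffness together amount to \<epsilon> (1 +
    \<Lambda>) q. This choice lets them consume exactly the difference 1/6 between the true
    coefficient 2/3 and the claimed 1/2.\<close>
  define \<epsilon> where "\<epsilon> = ?m / (6 * (1 + \<Lambda>))"
  have e: "0 < \<epsilon>" "\<epsilon> * (1 + \<Lambda>) = ?m / 6" using L m by (simp_all add: \<epsilon>_def field_simps)
  have D: "\<forall>\<^sub>F p in corner_filter. norm (mode_stiff \<mu> \<nu> (fst p) (snd p) - (\<mu>\<^sup>2 + \<nu>\<^sup>2 - 2 / 3 * \<mu>\<^sup>2 * \<nu>\<^sup>2 * sq_sum p)) \<le> \<epsilon> * norm (sq_sum p)"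
    by (rule landau_o.smallD[OF mode_stiff_expansion[OF assms(1,2)] e(1)])
  have N: "\<forall>\<^sub>F p in corner_filter. norm (mode_load (\<mu> * fst p) (\<nu> * snd p) - 1) \<le> \<epsilon> * norm (sq_sum p)"
    by (rule landau_o.smallD[OF mode_load_expansion[OF assms(1,2)] e(1)])
  \<comment> \<open>The first bound will give n \<le> 2, the second d \<ge> \<Lambda> / 2.\<close>
  have S: "\<forall>\<^sub>F p in corner_filter. norm (sq_sum p) \<le> min (1 / \<epsilon>) (\<Lambda> / (2 * ?m)) * norm (1::real)"
    by (rule landau_o.smallD[OF sq_sum_tendsto]) (use e L m in auto)
  show ?thesis
    using D N S
  proof eventually_elim
    case (elim p)
    define d n q where "d = mode_stiff \<mu> \<nu> (fst p) (snd p)" and "n = mode_load (\<mu> * fst p) (\<nu> * snd p)" and "q = sq_sum p"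
    have q: "0 \<le> q" by (simp add: q_def sq_sum_nonneg)
    have 1: "\<bar>d - (\<Lambda> - 2 / 3 * ?m * q)\<bar> \<le> \<epsilon> * q" "\<bar>n - 1\<bar> \<le> \<epsilon> * q" "q \<le> 1 / \<epsilon>" "q \<le> \<Lambda> / (2 * ?m)"
      using elim q by (simp_all add: d_def n_def q_def \<Lambda>_def mult.assoc)
    have eq: "\<epsilon> * q \<le> 1" using 1(3) e by (simp add: field_simps)
    have mq: "?m * q \<le> \<Lambda> / 2" using 1(4) m by (simp add: field_simps)
    have le: "\<epsilon> * q \<le> ?m / 6 * q"
    proof -
      have "\<epsilon> \<le> \<epsilon> * (1 + \<Lambda>)" using e L by (simp add: algebra_simps)
      then show ?thesis unfolding e(2) by (rule mult_right_mono[OF _ q])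
    qed
    have d: "\<Lambda> / 2 \<le> d" "d \<le> \<Lambda>" using 1(1) le mq q m by (auto simp: abs_le_iff algebra_simps)
    have n: "n \<le> 2" using 1(2) eq by linarith
    have "\<Lambda> * (1 - \<epsilon> * q) \<le> \<Lambda> * n" using 1(2) L by (intro mult_left_mono) auto
    then have "\<Lambda> * n - d \<ge> 2 / 3 * ?m * q - \<epsilon> * (1 + \<Lambda>) * q" using 1(1) by (simp add: abs_le_iff algebra_simps)
    then have diff: "?m / 2 * q \<le> \<Lambda> * n - d" unfolding e(2) by (simp add: algebra_simps)
    have dpos: "0 < d" using d L by linarith
    have "?m / (2 * \<Lambda>\<^sup>2) * q = (?m / 2 * q) / (\<Lambda> * \<Lambda>)" by (simp add: power2_eq_square)
    also have "\<dots> \<le> (\<Lambda> * n - d) / (\<Lambda> * d)"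
    proof (rule frac_le)
      have "0 \<le> ?m / 2 * q" using m q by simp
      then show "0 \<le> \<Lambda> * n - d" using diff by (rule order_trans)
    qed (use diff d dpos L in auto)
    also have "\<dots> = n / d - 1 / \<Lambda>" using dpos L by (simp add: field_simps)
    finally have low: "?m / (2 * \<Lambda>\<^sup>2) * q \<le> n / d - 1 / \<Lambda>" .
    have "n / d \<le> 2 / (\<Lambda> / 2)" using n d L by (intro frac_le) auto
    then have "n / d \<le> 4 / \<Lambda>" by simp
    with low dpos show ?case by (simp add: d_def n_def q_def)
  qed
qed

section \<open>Pointwise distance between the discrete mode and the scaled sine mode\<close>

lemma abs_sin_diff_le: "\<bar>sin x - x\<bar> \<le> \<bar>x\<bar> ^ 3" for x :: real
proof -
  have "\<bar>sin x - (\<Sum>m<3. sin_coeff m * x ^ m)\<bar> \<le> inverse (fact 3) * \<bar>x\<bar> ^ 3"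
    by (rule Maclaurin_sin_bound)
  also have "(\<Sum>m<3. sin_coeff m * x ^ m) = x" by (simp add: numeral_3_eq_3 sin_coeff_def)
  also have "inverse (fact 3) * \<bar>x\<bar> ^ 3 \<le> 1 * \<bar>x\<bar> ^ 3"
    by (rule mult_right_mono) (simp_all add: fact_numeral)
  finally show ?thesis by simp
qed

text \<open>Half angles reduce the claim to the sine: with y = x / 2 the difference factors as -2
  (sin y - y) (sin y + y).\<close>

lemma abs_cos_diff_le: "\<bar>cos x - (1 - x\<^sup>2 / 2)\<bar> \<le> \<bar>x\<bar> ^ 4" for x :: real
proof -
  define y where "y = x / 2"
  have "cos x = 1 - 2 * (sin y)\<^sup>2" using cos_double_sin[of y] by (simp add: y_def)
  then have "cos x - (1 - x\<^sup>2 / 2) = - (2 * (sin y - y) * (sin y + y))"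
    by (simp add: y_def power2_eq_square algebra_simps)
  then have "\<bar>cos x - (1 - x\<^sup>2 / 2)\<bar> = 2 * \<bar>sin y - y\<bar> * \<bar>sin y + y\<bar>"
    by (simp only: abs_minus_cancel abs_mult abs_numeral)
  also have "\<dots> \<le> 2 * \<bar>y\<bar> ^ 3 * (2 * \<bar>y\<bar>)"
    using abs_sin_diff_le[of y] abs_sin_x_le_abs_x[of y] abs_triangle_ineq[of "sin y" y]
    by (intro mult_mono) auto
  also have "\<dots> = \<bar>x\<bar> ^ 4 / 4" by (simp add: y_def power_divide numeral_eq_Suc)
  also have "\<dots> \<le> \<bar>x\<bar> ^ 4" by simp
  finally show ?thesis .
qed

text \<open>Height of the parabola 1 - u^2 that the square coefficients add on a cell; it vanishes
  at the ends u = -1 and u = 1 and imitates cos (s u) - cos s.\<close>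

definition bubble :: "real \<Rightarrow> real" where "bubble s = (sin s)\<^sup>2 / (2 * cos s)"

definition small_phase :: "real \<Rightarrow> bool" where
  "small_phase s \<longleftrightarrow> 0 < s \<and> s \<le> 1 \<and> 0 < cos s \<and> \<bar>bubble s - s\<^sup>2 / 2\<bar> \<le> s ^ 3 \<and> bubble s \<le> s\<^sup>2"

lemma eventually_small_phase: "\<forall>\<^sub>F s in at_right 0. small_phase s"
proof -
  have "\<forall>\<^sub>F s::real in at_right 0. \<bar>bubble s - s\<^sup>2 / 2\<bar> \<le> s ^ 3" "\<forall>\<^sub>F s in at_right 0. bubble s \<le> s\<^sup>2"
    "\<forall>\<^sub>F s::real in at_right 0. 0 < cos s" "\<forall>\<^sub>F s::real in at_right 0. s \<le> 1" "\<forall>\<^sub>F s::real in at_right 0. 0 < s"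
    unfolding bubble_def by - real_asymp+
  then show ?thesis by eventually_elim (simp add: small_phase_def)
qed

text \<open>cos (s u) - cos s equals s^2 (1 - u^2) / 2 up to fourth order, and the bubble has height
  s^2 / 2 up to third order; both sin (s u) and u sin s are s u up to third order.\<close>

lemma one_dim_cell_errors:
  assumes s: "small_phase s" and u: "\<bar>u\<bar> \<le> 1"
  shows "\<bar>sin (s * u) - u * sin s\<bar> \<le> 2 * s ^ 3"
    and "\<bar>cos (s * u) - (cos s + bubble s * (1 - u\<^sup>2))\<bar> \<le> 3 * s ^ 3"
    and "\<bar>cos (s * u) - cos s\<bar> \<le> s\<^sup>2"
    and "\<bar>u * sin s\<bar> \<le> s"
    and "0 \<le> bubble s * (1 - u\<^sup>2)" "bubble s * (1 - u\<^sup>2) \<le> s\<^sup>2"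
proof -
  have s': "0 < s" "s \<le> 1" "0 < cos s" "\<bar>bubble s - s\<^sup>2 / 2\<bar> \<le> s ^ 3" "bubble s \<le> s\<^sup>2"
    using s by (auto simp: small_phase_def)
  have su: "\<bar>s * u\<bar> \<le> s" using u s' mult_left_mono[of "\<bar>u\<bar>" 1 s] by (simp add: abs_mult)
  have u2: "u\<^sup>2 \<le> 1" using u by (simp add: abs_square_le_1)
  have p3: "\<bar>s * u\<bar> ^ 3 \<le> s ^ 3" "\<bar>s * u\<bar> ^ 4 \<le> s ^ 4" by (rule power_mono[OF su abs_ge_zero])+
  have p43: "s ^ 4 \<le> s ^ 3" using s' by (intro power_decreasing) auto
  have "\<bar>u * (sin s - s)\<bar> \<le> 1 * s ^ 3"
    unfolding abs_mult using u abs_sin_diff_le[of s] s' by (intro mult_mono) auto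
  moreover have "sin (s * u) - u * sin s = (sin (s * u) - s * u) - u * (sin s - s)" by (simp add: algebra_simps)
  ultimately show "\<bar>sin (s * u) - u * sin s\<bar> \<le> 2 * s ^ 3"
    using abs_sin_diff_le[of "s * u"] p3 by linarith
  have b0: "0 \<le> bubble s" using s' by (simp add: bubble_def)
  have "\<bar>(bubble s - s\<^sup>2 / 2) * (1 - u\<^sup>2)\<bar> \<le> s ^ 3 * 1"
    unfolding abs_mult using s' u2 by (intro mult_mono) auto
  moreover have "cos (s * u) - (cos s + bubble s * (1 - u\<^sup>2))
      = (cos (s * u) - (1 - (s * u)\<^sup>2 / 2)) - (cos s - (1 - s\<^sup>2 / 2)) - (bubble s - s\<^sup>2 / 2) * (1 - u\<^sup>2)"
    by (simp add: algebra_simps power_mult_distrib diff_divide_distrib)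
  moreover have "\<bar>cos s - (1 - s\<^sup>2 / 2)\<bar> \<le> s ^ 4" using abs_cos_diff_le[of s] by simp
  ultimately show "\<bar>cos (s * u) - (cos s + bubble s * (1 - u\<^sup>2))\<bar> \<le> 3 * s ^ 3"
    using abs_cos_diff_le[of "s * u"] p3 p43 by linarith
  have lower: "1 - x\<^sup>2 / 2 \<le> cos x" for x :: real
  proof -
    have "cos x = 1 - 2 * (sin (x / 2))\<^sup>2" using cos_double_sin[of "x / 2"] by simp
    moreover have "(sin (x / 2))\<^sup>2 \<le> (x / 2)\<^sup>2" using abs_sin_x_le_abs_x[of "x / 2"] by (simp only: abs_le_square_iff)
    ultimately show ?thesis by (simp add: power_divide)
  qed
  have "(s * u)\<^sup>2 \<le> s\<^sup>2" using su s' by (metis abs_le_square_iff abs_of_pos)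
  then show "\<bar>cos (s * u) - cos s\<bar> \<le> s\<^sup>2"
    using lower[of s] lower[of "s * u"] cos_le_one[of s] cos_le_one[of "s * u"] zero_le_power2[of s] by linarith
  have "\<bar>u * sin s\<bar> \<le> 1 * s"
    unfolding abs_mult using u abs_sin_x_le_abs_x[of s] s' by (intro mult_mono) auto
  then show "\<bar>u * sin s\<bar> \<le> s" by simp
  show "0 \<le> bubble s * (1 - u\<^sup>2)" using b0 u2 by simp
  have "bubble s * (1 - u\<^sup>2) \<le> s\<^sup>2 * 1" using b0 u2 s' by (intro mult_mono) auto
  then show "bubble s * (1 - u\<^sup>2) \<le> s\<^sup>2" by simp
qed

lemma abs_prod_diff_le:
  fixes f g p q :: real
  assumes "\<bar>f - p\<bar> \<le> A" "\<bar>g\<bar> \<le> G" "\<bar>p\<bar> \<le> P" "\<bar>g - q\<bar> \<le> B"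
  shows "\<bar>f * g - p * q\<bar> \<le> A * G + P * B"
proof -
  have "0 \<le> A" "0 \<le> P" using assms abs_ge_zero order_trans by blast+
  then have "\<bar>f - p\<bar> * \<bar>g\<bar> \<le> A * G" "\<bar>p\<bar> * \<bar>g - q\<bar> \<le> P * B"
    using assms by (auto intro!: mult_mono)
  moreover have "f * g - p * q = (f - p) * g + p * (g - q)" by (simp add: algebra_simps)
  then have "\<bar>f * g - p * q\<bar> \<le> \<bar>f - p\<bar> * \<bar>g\<bar> + \<bar>p\<bar> * \<bar>g - q\<bar>"
    using abs_triangle_ineq[of "(f - p) * g" "p * (g - q)"] by (simp add: abs_mult)
  ultimately show ?thesis by linarith
qed

text \<open>The product of the one-dimensional profiles contains a product of two bubbles that a
  quadratic lacks; it is at most s^2 t^2. In the mixed terms a bubble is missing too, at a cost of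
  t^2 or s^2, but the factor u sin s or w sin t supplies the third order.\<close>

lemma two_dim_cell_error:
  fixes Sx Cx Sy Cy :: real
  assumes s: "small_phase s" and t: "small_phase t" and u: "\<bar>u\<bar> \<le> 1" and w: "\<bar>w\<bar> \<le> 1"
    and S: "\<bar>Sx\<bar> \<le> 1" "\<bar>Cx\<bar> \<le> 1" "\<bar>Sy\<bar> \<le> 1" "\<bar>Cy\<bar> \<le> 1"
  shows "\<bar>Sx * Sy * (cos s * cos t + bubble s * cos t * (1 - u\<^sup>2) + bubble t * cos s * (1 - w\<^sup>2))
      + Cx * Sy * (u * sin s * cos t) + Sx * Cy * (cos s * (w * sin t)) + Cx * Cy * (u * sin s * (w * sin t))
      - (Sx * cos (s * u) + Cx * sin (s * u)) * (Sy * cos (t * w) + Cy * sin (t * w))\<bar>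
     \<le> 20 * ((s + t) * (s\<^sup>2 + t\<^sup>2))"
proof -
  note es = one_dim_cell_errors[OF s u] and et = one_dim_cell_errors[OF t w]
  have pos: "0 < s" "s \<le> 1" "0 < t" "t \<le> 1" using s t by (auto simp: small_phase_def)
  define R where "R = (s + t) * (s\<^sup>2 + t\<^sup>2)"
  have R: "s ^ 3 + t ^ 3 + s * t\<^sup>2 + s\<^sup>2 * t = R"
    by (simp add: R_def algebra_simps power2_eq_square power3_eq_cube)
  have nn: "0 \<le> s ^ 3" "0 \<le> t ^ 3" "0 \<le> s * t\<^sup>2" "0 \<le> s\<^sup>2 * t" using pos by simp_all
  have s2: "s\<^sup>2 \<le> 1" "t\<^sup>2 \<le> 1" using pos by (simp_all add: power_le_one)
  have st: "s\<^sup>2 * t\<^sup>2 \<le> s * t\<^sup>2" "s * t ^ 3 \<le> t ^ 3"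
    using pos by (auto simp: power2_eq_square intro!: mult_right_mono mult_left_le_one_le)
  define Bs Bt where "Bs = bubble s * (1 - u\<^sup>2)" and "Bt = bubble t * (1 - w\<^sup>2)"
  have B: "0 \<le> Bs" "Bs \<le> s\<^sup>2" "0 \<le> Bt" "Bt \<le> t\<^sup>2" using es(5,6) et(5,6) by (simp_all add: Bs_def Bt_def)
  have BB: "0 \<le> Bs * Bt" "Bs * Bt \<le> s\<^sup>2 * t\<^sup>2" using B by (auto intro!: mult_mono)
  have "\<bar>cos s + Bs\<bar> \<le> 2" using B s2 abs_cos_le_one[of s] by linarith
  then have "\<bar>cos (s * u) * cos (t * w) - (cos s + Bs) * (cos t + Bt)\<bar> \<le> 3 * s ^ 3 * 1 + 2 * (3 * t ^ 3)"
    using es(2) et(2) by (intro abs_prod_diff_le) (auto simp: Bs_def Bt_def)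
  moreover define Q where "Q = cos s * cos t + bubble s * cos t * (1 - u\<^sup>2) + bubble t * cos s * (1 - w\<^sup>2)"
  moreover define E where "E = Bs * Bt"
  moreover have "(cos s + Bs) * (cos t + Bt) = Q + E"
    by (simp add: Q_def E_def Bs_def Bt_def algebra_simps)
  ultimately have "\<bar>cos (s * u) * cos (t * w) - (Q + E)\<bar> \<le> 3 * s ^ 3 * 1 + 2 * (3 * t ^ 3)" "0 \<le> E" "E \<le> s * t\<^sup>2"
    using BB st by simp_all
  then have "\<bar>Q - cos (s * u) * cos (t * w)\<bar> \<le> 3 * s ^ 3 + 6 * t ^ 3 + E" "E \<le> s * t\<^sup>2" by linarith+
  moreover from this(2) have "3 * s ^ 3 + 6 * t ^ 3 + E \<le> 6 * R" using nn R by argo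
  ultimately have "\<bar>Q - cos (s * u) * cos (t * w)\<bar> \<le> 6 * R" by (blast intro: order_trans)
  then have 1: "\<bar>(cos s * cos t + bubble s * cos t * (1 - u\<^sup>2) + bubble t * cos s * (1 - w\<^sup>2)) - cos (s * u) * cos (t * w)\<bar> \<le> 6 * R"
    unfolding Q_def .
  have "\<bar>sin (s * u) * cos (t * w) - u * sin s * cos t\<bar> \<le> 2 * s ^ 3 * 1 + s * t\<^sup>2"
    using es(1,4) et(3) by (intro abs_prod_diff_le) auto
  then have 2: "\<bar>u * sin s * cos t - sin (s * u) * cos (t * w)\<bar> \<le> 2 * R"
    using nn R by (subst abs_minus_commute) argo
  have "\<bar>sin (t * w) * cos (s * u) - w * sin t * cos s\<bar> \<le> 2 * t ^ 3 * 1 + t * s\<^sup>2"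
    using et(1,4) es(3) by (intro abs_prod_diff_le) auto
  moreover have "t * s\<^sup>2 = s\<^sup>2 * t" by simp
  moreover have "cos s * (w * sin t) - cos (s * u) * sin (t * w) = - (sin (t * w) * cos (s * u) - w * sin t * cos s)"
    by (simp add: algebra_simps)
  ultimately have 3: "\<bar>cos s * (w * sin t) - cos (s * u) * sin (t * w)\<bar> \<le> 2 * R"
    using nn R by (simp only: abs_minus_cancel)
  have "\<bar>sin (s * u) * sin (t * w) - u * sin s * (w * sin t)\<bar> \<le> 2 * s ^ 3 * 1 + s * (2 * t ^ 3)"
    using es(1,4) et(1) by (intro abs_prod_diff_le) auto
  then have 4: "\<bar>u * sin s * (w * sin t) - sin (s * u) * sin (t * w)\<bar> \<le> 2 * R"
    using nn st R by (subst abs_minus_commute) argo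
  have wt: "\<bar>a * b * d\<bar> \<le> D" if "\<bar>a\<bar> \<le> 1" "\<bar>b\<bar> \<le> 1" "\<bar>d\<bar> \<le> D" for a b d D :: real
  proof -
    have "\<bar>a\<bar> * \<bar>b\<bar> * \<bar>d\<bar> \<le> 1 * 1 * D" using that by (intro mult_mono) auto
    then show ?thesis by (simp add: abs_mult)
  qed
  \<comment> \<open>The four groups contribute 6, 2, 2 and 2 times R, within the constant
    20.\<close>
  note parts = wt[OF S(1) S(3) 1] wt[OF S(2) S(3) 2] wt[OF S(1) S(4) 3] wt[OF S(2) S(4) 4]
  have R0: "0 \<le> R" using nn unfolding R[symmetric] by linarith
  have "Sx * Sy * (cos s * cos t + bubble s * cos t * (1 - u\<^sup>2) + bubble t * cos s * (1 - w\<^sup>2))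
      + Cx * Sy * (u * sin s * cos t) + Sx * Cy * (cos s * (w * sin t)) + Cx * Cy * (u * sin s * (w * sin t))
      - (Sx * cos (s * u) + Cx * sin (s * u)) * (Sy * cos (t * w) + Cy * sin (t * w))
    = Sx * Sy * ((cos s * cos t + bubble s * cos t * (1 - u\<^sup>2) + bubble t * cos s * (1 - w\<^sup>2)) - cos (s * u) * cos (t * w))
      + Cx * Sy * (u * sin s * cos t - sin (s * u) * cos (t * w))
      + Sx * Cy * (cos s * (w * sin t) - cos (s * u) * sin (t * w))
      + Cx * Cy * (u * sin s * (w * sin t) - sin (s * u) * sin (t * w))"
    by (simp add: algebra_simps)
  then show ?thesis using parts R0 unfolding R_def[symmetric] by linarith
qed

context sine_grid
begin

text \<open>In the coordinates u, w scaled to the cell, the coefficients of the mode become the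
  sines and bubbles of \<open>two_dim_cell_error\<close>.\<close>

lemma cell_coeff_error:
  assumes small: "small_phase (\<mu> * a)" "small_phase (\<nu> * b)" and "0 \<le> \<alpha>" and K: "K \<in> G" and z: "z \<in> open_rect K"
  shows "\<bar>quad K (cell_coeff K) z - \<alpha> * sine_mode \<Omega> \<mu> \<nu> z\<bar>
    \<le> 20 * \<alpha> * ((\<mu> * a + \<nu> * b) * ((\<mu> * a)\<^sup>2 + (\<nu> * b)\<^sup>2))"
proof -
  define u w where "u = (fst z - xm K) / a" and "w = (snd z - ym K) / b"
  have coord: "fst z = xm K + a * u" "snd z = ym K + b * w" using ab by (simp_all add: u_def w_def)
  have "xl K < fst z" "fst z < xr K" "yl K < snd z" "snd z < yr K"
    using z by (auto simp: open_rect_times)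
  then have "\<bar>a * u\<bar> \<le> a" "\<bar>b * w\<bar> \<le> b"
    unfolding coord cell_bounds[OF K] by linarith+
  then have uw: "\<bar>u\<bar> \<le> 1" "\<bar>w\<bar> \<le> 1" using ab by (simp_all add: abs_mult)
  have "\<mu> * (fst z - xl \<Omega>) = \<mu> * (xm K - xl \<Omega>) + \<mu> * a * u" "\<nu> * (snd z - yl \<Omega>) = \<nu> * (ym K - yl \<Omega>) + \<nu> * b * w"
    unfolding coord by (simp_all add: algebra_simps)
  then have mode: "sine_mode \<Omega> \<mu> \<nu> z =
      (SX (xm K) * cos (\<mu> * a * u) + CX (xm K) * sin (\<mu> * a * u)) * (SY (ym K) * cos (\<nu> * b * w) + CY (ym K) * sin (\<nu> * b * w))"
    unfolding sine_mode_def SX_def CX_def SY_def CY_def by (simp only: sin_add)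
  have quad: "quad K (cell_coeff K) z = \<alpha> *
     (SX (xm K) * SY (ym K) * (cos (\<mu> * a) * cos (\<nu> * b) + bubble (\<mu> * a) * cos (\<nu> * b) * (1 - u\<^sup>2)
        + bubble (\<nu> * b) * cos (\<mu> * a) * (1 - w\<^sup>2))
      + CX (xm K) * SY (ym K) * (u * sin (\<mu> * a) * cos (\<nu> * b)) + SX (xm K) * CY (ym K) * (cos (\<mu> * a) * (w * sin (\<nu> * b)))
      + CX (xm K) * CY (ym K) * (u * sin (\<mu> * a) * (w * sin (\<nu> * b))))"
    unfolding quad_def coord cell_coeff_def mode_coeff_def bubble_def
    using ab cos_nz by (simp add: field_simps power2_eq_square)
  have "\<bar>SX (xm K)\<bar> \<le> 1" "\<bar>CX (xm K)\<bar> \<le> 1" "\<bar>SY (ym K)\<bar> \<le> 1" "\<bar>CY (ym K)\<bar> \<le> 1"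
    by (simp_all add: SX_def CX_def SY_def CY_def)
  from mult_left_mono[OF two_dim_cell_error[OF small uw this] \<open>0 \<le> \<alpha>\<close>]
  show ?thesis
    unfolding quad mode right_diff_distrib[symmetric] abs_mult using \<open>0 \<le> \<alpha>\<close> by (simp only: abs_of_nonneg mult.assoc mult.left_commute[of \<alpha>])
qed

lemma AE_in_cell: "AE z in lebesgue_on (open_rect \<Omega>). \<exists>K\<in>G. z \<in> open_rect K"
proof -
  have "(\<Union>K\<in>G. closed_rect K - open_rect K) \<in> null_sets lebesgue"
    unfolding closed_rect_def open_rect_def using grid negligible_frontier_interval
    by (intro null_sets.finite_UN) (auto simp: rect_grid_def negligible_iff_null_sets)
  then have "AE z in lebesgue. z \<notin> (\<Union>K\<in>G. closed_rect K - open_rect K)" by (rule AE_not_in)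
  moreover have "open_rect \<Omega> \<subseteq> (\<Union>K\<in>G. closed_rect K)"
    using grid open_rect_subset[of \<Omega>] by (simp add: rect_grid_def)
  ultimately show ?thesis
    by (auto simp: AE_restrict_space_iff elim!: eventually_mono)
qed

text \<open>Symmetry of \<open>a_h\<close> lets the two discrete solutions test each other's
  equation, so the pairing of \<open>w\<close> with the mode becomes that of \<open>g\<close> with
  \<open>discrete_mode\<close>; the pairing of \<open>u\<close> is known from the eigenvalue
  relation. Replacing \<open>discrete_mode\<close> by \<alpha> times the mode costs only the
  pointwise cell error, weighted with the L1 norm of \<open>g\<close>.\<close>

lemma error_pairing:
  assumes small: "small_phase (\<mu> * a)" "small_phase (\<nu> * b)" and \<alpha>: "0 \<le> \<alpha>"
    and u: "u \<in> H10 (open_rect \<Omega>)" and g: "g \<in> L2 (open_rect \<Omega>)"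
    and weak: "\<And>v. v \<in> H10 (open_rect \<Omega>) \<Longrightarrow>
      (LINT z|lebesgue_on (open_rect \<Omega>). weak_grad (open_rect \<Omega>) u z \<bullet> weak_grad (open_rect \<Omega>) v z)
        = (LINT z|lebesgue_on (open_rect \<Omega>). g z * v z)"
    and w: "w \<in> RRM \<Omega> G"
    and discrete: "\<And>v. v \<in> RRM \<Omega> G \<Longrightarrow> a_h G w v = (LINT z|lebesgue_on (open_rect \<Omega>). g z * v z)"
  shows "(\<alpha> - 1 / (\<mu>\<^sup>2 + \<nu>\<^sup>2)) * \<bar>LINT z|lebesgue_on (open_rect \<Omega>). g z * sine_mode \<Omega> \<mu> \<nu> z\<bar>
      - 20 * \<alpha> * ((\<mu> * a + \<nu> * b) * ((\<mu> * a)\<^sup>2 + (\<nu> * b)\<^sup>2)) * (LINT z|lebesgue_on (open_rect \<Omega>). \<bar>g z\<bar>)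
    \<le> \<bar>LINT z|lebesgue_on (open_rect \<Omega>). sine_mode \<Omega> \<mu> \<nu> z * (u z - w z)\<bar>"
proof -
  let ?M = "lebesgue_on (open_rect \<Omega>)"
  let ?\<phi> = "sine_mode \<Omega> \<mu> \<nu>"
  define \<Lambda> where "\<Lambda> = \<mu>\<^sup>2 + \<nu>\<^sup>2"
  have L: "0 < \<Lambda>" using \<mu>\<nu> by (simp add: \<Lambda>_def add_pos_pos)
  have \<phi>L: "?\<phi> \<in> L2 (open_rect \<Omega>)" by (rule continuous_L2[OF continuous_sine_mode])
  have uL: "u \<in> L2 (open_rect \<Omega>)" using u by (simp add: H10_def Hk_def)
  have wL: "w \<in> L2 (open_rect \<Omega>)" using w by (simp add: RRM_def)
  define P where "P = (LINT z|?M. g z * ?\<phi> z)"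
  have "\<Lambda> * (LINT z|?M. u z * ?\<phi> z) = P"
    unfolding P_def \<Lambda>_def by (rule weak_solution_sine_mode[OF nondeg u g weak periodic])
  then have "(LINT z|?M. u z * ?\<phi> z) = P / \<Lambda>" using L by (simp add: field_simps)
  then have up: "(LINT z|?M. ?\<phi> z * u z) = P / \<Lambda>" by (simp add: mult.commute)
  have "a_h G w discrete_mode = a_h G discrete_mode w" by (simp add: a_h_def inner_commute)
  then have wp: "(LINT z|?M. ?\<phi> z * w z) = (LINT z|?M. g z * discrete_mode z)"
    using discrete[OF discrete_mode_RRM] discrete_mode_solves[OF w] by simp
  note dL = discrete_mode_L2
  have split: "(LINT z|?M. g z * discrete_mode z) = \<alpha> * P + (LINT z|?M. g z * (discrete_mode z - \<alpha> * ?\<phi> z))"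
    using L2_integrable_mult[OF g dL] L2_integrable_mult[OF g \<phi>L]
    by (simp add: P_def right_diff_distrib mult.left_commute[of _ \<alpha>])
  define E where "E = (LINT z|?M. g z * (discrete_mode z - \<alpha> * ?\<phi> z))"
  have E: "\<bar>E\<bar> \<le> 20 * \<alpha> * ((\<mu> * a + \<nu> * b) * ((\<mu> * a)\<^sup>2 + (\<nu> * b)\<^sup>2)) * (LINT z|?M. \<bar>g z\<bar>)"
    unfolding E_def
  proof (rule abs_integral_mult_le[OF L2_integrable[OF g]])
    show "(\<lambda>z. discrete_mode z - \<alpha> * ?\<phi> z) \<in> borel_measurable ?M"
      using dL \<phi>L by (auto simp: L2_def)
    show "AE z in ?M. \<bar>discrete_mode z - \<alpha> * ?\<phi> z\<bar> \<le> 20 * \<alpha> * ((\<mu> * a + \<nu> * b) * ((\<mu> * a)\<^sup>2 + (\<nu> * b)\<^sup>2))"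
      using AE_in_cell
    proof eventually_elim
      case (elim z)
      then obtain K where K: "K \<in> G" "z \<in> open_rect K" by blast
      show ?case using cell_coeff_error[OF small \<alpha> K] discrete_mode_on_cell[OF K] by simp
    qed
  qed
  have "(LINT z|?M. ?\<phi> z * (u z - w z)) = P / \<Lambda> - (\<alpha> * P + E)"
    using L2_integrable_mult[OF \<phi>L uL] L2_integrable_mult[OF \<phi>L wL] up wp split
    by (simp add: right_diff_distrib E_def)
  then have eq: "(LINT z|?M. ?\<phi> z * (u z - w z)) = - ((\<alpha> - 1 / \<Lambda>) * P + E)"
    by (simp add: algebra_simps)
  have "(\<alpha> - 1 / \<Lambda>) * \<bar>P\<bar> \<le> \<bar>\<alpha> - 1 / \<Lambda>\<bar> * \<bar>P\<bar>" by (intro mult_right_mono) auto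
  then have "(\<alpha> - 1 / \<Lambda>) * \<bar>P\<bar> \<le> \<bar>(\<alpha> - 1 / \<Lambda>) * P\<bar>" by (simp add: abs_mult)
  then have "(\<alpha> - 1 / \<Lambda>) * \<bar>P\<bar> - \<bar>E\<bar> \<le> \<bar>LINT z|?M. ?\<phi> z * (u z - w z)\<bar>"
    unfolding eq abs_minus_cancel by linarith
  with E show ?thesis unfolding P_def[symmetric] \<Lambda>_def[symmetric] by linarith
qed

end

lemma eventually_corner_filterD:
  assumes "\<forall>\<^sub>F p in corner_filter. P p"
  obtains \<delta> where "0 < \<delta>" "\<And>a b. 0 < a \<Longrightarrow> a < \<delta> \<Longrightarrow> 0 < b \<Longrightarrow> b < \<delta> \<Longrightarrow> P (a, b)"
proof -
  obtain P1 P2 where P: "eventually P1 (at_right (0::real))" "eventually P2 (at_right (0::real))" "\<And>a b. P1 a \<Longrightarrow> P2 b \<Longrightarrow> P (a, b)"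
    using assms unfolding eventually_prod_filter by blast
  obtain d1 d2 where "0 < d1" "\<And>a. 0 < a \<Longrightarrow> a < d1 \<Longrightarrow> P1 a" "0 < d2" "\<And>b. 0 < b \<Longrightarrow> b < d2 \<Longrightarrow> P2 b"
    using P(1,2) unfolding eventually_at_right_field by auto
  then show ?thesis using P(3) by (intro that[of "min d1 d2"]) auto
qed

theorem theorem5p2:
  fixes \<Omega> :: rect and \<rho> f u :: field and c0 :: real
    and \<G> :: "'i \<Rightarrow> rect set" and uR :: "'i \<Rightarrow> field"
  assumes "nondegenerate \<Omega>"
    and "\<rho> \<in> Linf (open_rect \<Omega>)"
    and "c0 > 0" and "AE z in lebesgue_on (open_rect \<Omega>). \<rho> z \<ge> c0"
    and "shape_regular \<G>"
    and "\<And>i. rect_grid \<Omega> (\<G> i)"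
    and "\<And>i. uniform_grid (\<G> i)"
    and "\<And>i. hypothesis_RT \<Omega> (\<G> i)"
    and "f \<in> L2 (open_rect \<Omega>)"
    and "u \<in> H10 (open_rect \<Omega>)"
    and "\<And>v. v \<in> H10 (open_rect \<Omega>) \<Longrightarrow>
           (LINT z|lebesgue_on (open_rect \<Omega>).
              weak_grad (open_rect \<Omega>) u z \<bullet> weak_grad (open_rect \<Omega>) v z) = b_form \<Omega> \<rho> f v"
    and "\<And>i. uR i \<in> RRM \<Omega> (\<G> i)"
    and "\<And>i v. v \<in> RRM \<Omega> (\<G> i) \<Longrightarrow> a_h (\<G> i) (uR i) v = b_form \<Omega> \<rho> f v"
    and "norm_0 \<Omega> \<rho> f \<noteq> 0"
    and "u \<in> Hk 3 (open_rect \<Omega>)"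
  shows "\<exists>c>0. \<exists>h0>0. \<forall>i. mesh_size (\<G> i) \<le> h0 \<longrightarrow>
           norm_0 \<Omega> \<rho> (\<lambda>z. u z - uR i z) \<ge> c * (mesh_size (\<G> i))\<^sup>2"
proof -
  let ?S = "open_rect \<Omega>"
  let ?M = "lebesgue_on ?S"
  note nd = assms(1)
  \<comment> \<open>The weight is absorbed into the load, which stays square integrable because
    \<rho> is bounded.\<close>
  define g where "g z = \<rho> z * f z" for z
  have b_form_g: "b_form \<Omega> \<rho> f v = (LINT z|?M. g z * v z)" for v
    by (simp add: b_form_def g_def)
  have \<rho>: "\<rho> \<in> borel_measurable ?M" and f: "f \<in> borel_measurable ?M" "integrable ?M (\<lambda>z. (f z)\<^sup>2)"
    using assms(2,9) by (auto simp: Linf_def L2_def)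
  obtain C where C: "AE z in ?M. \<bar>\<rho> z\<bar> \<le> C" using assms(2) by (auto simp: Linf_def)
  have \<rho>_sq: "integrable ?M (\<lambda>z. (h z)\<^sup>2 * \<rho> z)" if "h \<in> L2 ?S" for h
    using that \<rho> C by (intro integrable_mult_bounded_right[of _ _ _ C]) (auto simp: L2_def)
  have gL: "g \<in> L2 ?S"
  proof -
    have "AE z in ?M. \<bar>(\<rho> z)\<^sup>2\<bar> \<le> C\<^sup>2"
      using C by eventually_elim (simp add: abs_le_square_iff[symmetric])
    then have "integrable ?M (\<lambda>z. (f z)\<^sup>2 * (\<rho> z)\<^sup>2)"
      by (intro integrable_mult_bounded_right[of _ _ _ "C\<^sup>2"] f borel_measurable_power \<rho>)
    moreover have "g \<in> borel_measurable ?M" unfolding g_def[abs_def] using \<rho> f by simp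
    ultimately show ?thesis by (simp add: L2_def g_def power_mult_distrib mult.commute)
  qed
  \<comment> \<open>If \<rho> f vanished almost everywhere, so would \<rho> f^2, against the nonzero
    weighted norm of \<open>f\<close>.\<close>
  have "\<not> (AE z in ?M. g z = 0)"
  proof
    assume "AE z in ?M. g z = 0"
    then have "AE z in ?M. g z * f z = 0" by eventually_elim simp
    then have "b_form \<Omega> \<rho> f f = 0" unfolding b_form_g by (rule integral_eq_zero_AE)
    with assms(14) show False by (simp add: norm_0_def)
  qed
  from exists_sine_mode_not_orthogonal[OF nd L2_integrable[OF gL] this]
  obtain m n :: nat where mn: "0 < m" "0 < n"
    and P0: "(LINT z|?M. g z * sine_mode \<Omega> (real m * pi / hx \<Omega>) (real n * pi / hy \<Omega>) z) \<noteq> 0"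
    by blast
  define \<mu> \<nu> where "\<mu> = real m * pi / hx \<Omega>" and "\<nu> = real n * pi / hy \<Omega>"
  have h: "0 < hx \<Omega>" "0 < hy \<Omega>" using nd by (auto simp: nondegenerate_def hx_def hy_def)
  have \<mu>\<nu>: "0 < \<mu>" "0 < \<nu>" using h mn by (simp_all add: \<mu>_def \<nu>_def)
  have per: "sin (\<mu> * hx \<Omega>) = 0" "sin (\<nu> * hy \<Omega>) = 0" using h by (simp_all add: \<mu>_def \<nu>_def)
  define P where "P = \<bar>LINT z|?M. g z * sine_mode \<Omega> \<mu> \<nu> z\<bar>"
  have P: "0 < P" using P0 by (simp add: P_def \<mu>_def \<nu>_def)
  define \<Lambda> where "\<Lambda> = \<mu>\<^sup>2 + \<nu>\<^sup>2"
  have L: "0 < \<Lambda>" using \<mu>\<nu> by (simp add: \<Lambda>_def add_pos_pos)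
  define I where "I = (LINT z|?M. \<bar>g z\<bar>)"
  have I: "0 \<le> I" by (simp add: I_def)
  \<comment> \<open>k (a^2 + b^2) will bound the second-order part of the pairing from
    below.\<close>
  define k where "k = \<mu>\<^sup>2 * \<nu>\<^sup>2 / (2 * \<Lambda>\<^sup>2) * P"
  have k: "0 < k" using P L \<mu>\<nu> by (simp add: k_def)
  define A where "A = (LINT z|?M. (sine_mode \<Omega> \<mu> \<nu> z)\<^sup>2)"
  have A: "0 \<le> A" by (simp add: A_def)
  have scale: "filterlim (\<lambda>x. c * x) (at_right 0) (at_right (0::real))" if "0 < c" for c :: real
    using that by real_asymp
  have small: "\<forall>\<^sub>F p in corner_filter. small_phase (\<mu> * fst p) \<and> small_phase (\<nu> * snd p)"
    using filterlim_compose[OF scale[OF \<mu>\<nu>(1)] filterlim_fst[of "at_right 0" "at_right (0::real)"]]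
      filterlim_compose[OF scale[OF \<mu>\<nu>(2)] filterlim_snd[of "at_right 0" "at_right (0::real)"]]
    by (intro eventually_conj) (auto simp: filterlim_iff intro: eventually_small_phase)
  \<comment> \<open>The third-order remainder divided by a^2 + b^2; 80 is the 20 of
    \<open>error_pairing\<close> times the 4 in \<alpha> \<le> 4 / \<Lambda>. The bound k / 2 leaves
    half of the main term.\<close>
  have remainder: "\<forall>\<^sub>F p in corner_filter. 80 / \<Lambda> * ((\<mu> * fst p + \<nu> * snd p) * \<Lambda>) * I \<le> k / 2"
  proof -
    have "((\<lambda>p::real \<times> real. 80 / \<Lambda> * ((\<mu> * fst p + \<nu> * snd p) * \<Lambda>) * I) \<longlongrightarrow> 80 / \<Lambda> * ((\<mu> * 0 + \<nu> * 0) * \<Lambda>) * I) corner_filter"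
      by (intro tendsto_intros filterlim_compose[OF _ filterlim_fst[of "at_right 0" "at_right (0::real)"]]
          filterlim_compose[OF _ filterlim_snd[of "at_right 0" "at_right (0::real)"]] tendsto_ident_at)
    then have "\<forall>\<^sub>F p in corner_filter. 80 / \<Lambda> * ((\<mu> * fst p + \<nu> * snd p) * \<Lambda>) * I < k / 2"
      by (rule order_tendstoD(2)) (use k in simp)
    then show ?thesis by eventually_elim simp
  qed
  obtain \<delta> where \<delta>: "0 < \<delta>" and good: "\<And>a b. 0 < a \<Longrightarrow> a < \<delta> \<Longrightarrow> 0 < b \<Longrightarrow> b < \<delta> \<Longrightarrow>
      small_phase (\<mu> * a) \<and> small_phase (\<nu> * b) \<and>
      80 / \<Lambda> * ((\<mu> * a + \<nu> * b) * \<Lambda>) * I \<le> k / 2 \<and>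
      0 < mode_stiff \<mu> \<nu> a b \<and>
      \<mu>\<^sup>2 * \<nu>\<^sup>2 / (2 * \<Lambda>\<^sup>2) * sq_sum (a, b) \<le> mode_load (\<mu> * a) (\<nu> * b) / mode_stiff \<mu> \<nu> a b - 1 / \<Lambda> \<and>
      mode_load (\<mu> * a) (\<nu> * b) / mode_stiff \<mu> \<nu> a b \<le> 4 / \<Lambda>"
    using eventually_corner_filterD[OF eventually_conj[OF small eventually_conj[OF remainder
        amplitude_expansion[OF \<mu>\<nu>, folded \<Lambda>_def]]]] by (metis fst_conv snd_conv)
  \<comment> \<open>k / 2 survives the remainder, and a factor 4 is lost in passing from a^2 + b^2
    to the squared mesh size. sqrt c0 leads to the weighted norm, and A + 1 instead of A keeps the
    divisor from Cauchy-Schwarz positive.\<close>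
  define c where "c = k / 8 * (sqrt c0 / sqrt (A + 1))"
  have c: "0 < c" using k assms(3) A by (simp add: c_def)
  have "c * (mesh_size (\<G> i))\<^sup>2 \<le> norm_0 \<Omega> \<rho> (\<lambda>z. u z - uR i z)" if mesh: "mesh_size (\<G> i) \<le> \<delta>" for i
  proof -
    obtain H V nx ny where HV: "0 < H" "0 < V" "\<And>K. K \<in> \<G> i \<Longrightarrow> hx K = H \<and> hy K = V"
      and n: "0 < nx" "0 < ny" "bij_betw (grid_cell \<Omega> H V) ({..<nx} \<times> {..<ny}) (\<G> i)"
      by (rule uniform_grid_eq_product[OF nd assms(6)[of i] assms(7)[of i]]) blast
    have "\<G> i \<noteq> {}" using n by (auto simp: bij_betw_def)
    then have "(\<lambda>K. max (hx K) (hy K)) ` \<G> i = {max H V}" using HV(3) by auto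
    then have mesh_eq: "mesh_size (\<G> i) = max H V" by (simp add: mesh_size_def)
    define a b where "a = H / 2" and "b = V / 2"
    \<comment> \<open>Halving the side lengths gives the strict inequalities of \<open>good\<close>
      even when the mesh size equals \<delta>.\<close>
    have ab: "0 < a" "0 < b" "a < \<delta>" "b < \<delta>" using HV mesh mesh_eq by (auto simp: a_def b_def)
    note g_ab = good[OF ab(1,3,2,4)]
    define \<alpha> where "\<alpha> = mode_load (\<mu> * a) (\<nu> * b) / mode_stiff \<mu> \<nu> a b"
    interpret sine_grid \<Omega> "\<G> i" \<mu> \<nu> a b \<alpha>
      by unfold_locales (use nd assms(6,7) HV ab \<mu>\<nu> per g_ab in \<open>auto simp: a_def b_def \<alpha>_def small_phase_def\<close>)
    define q where "q = sq_sum (a, b)"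
    have q: "0 \<le> q" "q = a\<^sup>2 + b\<^sup>2" by (simp_all add: q_def sq_sum_def)
    have low: "\<mu>\<^sup>2 * \<nu>\<^sup>2 / (2 * \<Lambda>\<^sup>2) * q \<le> \<alpha> - 1 / \<Lambda>" and up: "\<alpha> \<le> 4 / \<Lambda>" using g_ab by (simp_all add: \<alpha>_def q_def)
    have "0 \<le> \<mu>\<^sup>2 * \<nu>\<^sup>2 / (2 * \<Lambda>\<^sup>2) * q" using q by simp
    moreover have "0 < 1 / \<Lambda>" using L by simp
    ultimately have \<alpha>: "0 \<le> \<alpha>" using low by linarith
    define D where "D = (LINT z|?M. sine_mode \<Omega> \<mu> \<nu> z * (u z - uR i z))"
    have pairing: "(\<alpha> - 1 / \<Lambda>) * P - 20 * \<alpha> * ((\<mu> * a + \<nu> * b) * ((\<mu> * a)\<^sup>2 + (\<nu> * b)\<^sup>2)) * I \<le> \<bar>D\<bar>"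
      unfolding P_def I_def \<Lambda>_def D_def
      by (rule error_pairing) (use g_ab \<alpha> assms(10-13) gL b_form_g in auto)
    have "k * q = \<mu>\<^sup>2 * \<nu>\<^sup>2 / (2 * \<Lambda>\<^sup>2) * q * P" by (simp add: k_def)
    also have "\<dots> \<le> (\<alpha> - 1 / \<Lambda>) * P" using low P by (intro mult_right_mono) auto
    finally have main: "k * q \<le> (\<alpha> - 1 / \<Lambda>) * P" .
    have "(\<mu> * a)\<^sup>2 + (\<nu> * b)\<^sup>2 \<le> \<Lambda> * q"
      unfolding q \<Lambda>_def by (simp add: algebra_simps power_mult_distrib)
    then have "20 * \<alpha> * ((\<mu> * a + \<nu> * b) * ((\<mu> * a)\<^sup>2 + (\<nu> * b)\<^sup>2)) * I
        \<le> 20 * (4 / \<Lambda>) * ((\<mu> * a + \<nu> * b) * (\<Lambda> * q)) * I"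
      using \<alpha> up I \<mu>\<nu> ab L by (intro mult_mono mult_right_mono mult_left_mono mult_nonneg_nonneg) auto
    also have "\<dots> = 80 / \<Lambda> * ((\<mu> * a + \<nu> * b) * \<Lambda>) * I * q" by simp
    also have "\<dots> \<le> k / 2 * q" using g_ab q by (intro mult_right_mono) auto
    finally have D: "k / 2 * q \<le> \<bar>D\<bar>" using main pairing by linarith
    have dL: "(\<lambda>z. u z - uR i z) \<in> L2 ?S"
      using assms(10) assms(12)[of i] by (intro L2_diff) (auto simp: H10_def Hk_def RRM_def)
    define N where "N = (LINT z|?M. (u z - uR i z)\<^sup>2)"
    have "c0 * N \<le> b_form \<Omega> \<rho> (\<lambda>z. u z - uR i z) (\<lambda>z. u z - uR i z)"
    proof -
      have "c0 * N = (LINT z|?M. (u z - uR i z)\<^sup>2 * c0)" by (simp add: N_def)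
      also have "\<dots> \<le> (LINT z|?M. (u z - uR i z)\<^sup>2 * \<rho> z)"
      proof (rule integral_mono_AE)
        show "AE z in ?M. (u z - uR i z)\<^sup>2 * c0 \<le> (u z - uR i z)\<^sup>2 * \<rho> z"
          using assms(4) by eventually_elim (simp add: mult_left_mono)
      qed (use dL \<rho>_sq[OF dL] in \<open>auto simp: L2_def\<close>)
      finally show ?thesis by (simp add: b_form_def power2_eq_square ac_simps)
    qed
    then have norm: "sqrt c0 * sqrt N \<le> norm_0 \<Omega> \<rho> (\<lambda>z. u z - uR i z)"
      unfolding norm_0_def real_sqrt_mult[symmetric] by (rule real_sqrt_le_mono)
    have "\<bar>D\<bar> \<le> sqrt A * sqrt N"
      unfolding D_def A_def N_def by (rule abs_integral_mult_L2_le[OF continuous_L2[OF continuous_sine_mode] dL])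
    also have "\<dots> \<le> sqrt (A + 1) * sqrt N" by (intro mult_right_mono) (auto simp: N_def)
    finally have "k / 2 * q \<le> sqrt (A + 1) * sqrt N" using D by linarith
    moreover have "(mesh_size (\<G> i))\<^sup>2 \<le> 4 * q"
      unfolding mesh_eq q a_def b_def by (auto simp: max_def power_divide)
    then have "k / 8 * (mesh_size (\<G> i))\<^sup>2 \<le> k / 8 * (4 * q)" using k by (intro mult_left_mono) auto
    ultimately have "k / 8 * (mesh_size (\<G> i))\<^sup>2 \<le> sqrt (A + 1) * sqrt N" by simp
    then have "k / 8 * (mesh_size (\<G> i))\<^sup>2 * (sqrt c0 / sqrt (A + 1)) \<le> sqrt (A + 1) * sqrt N * (sqrt c0 / sqrt (A + 1))"
      using assms(3) A by (intro mult_right_mono) auto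
    also have "\<dots> = sqrt c0 * sqrt N" using A by simp
    finally have "c * (mesh_size (\<G> i))\<^sup>2 \<le> sqrt c0 * sqrt N" by (simp add: c_def mult_ac)
    with norm show ?thesis by linarith
  qed
  with c \<delta> show ?thesis by blast
qed

end
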